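(* PCP restricted to instances with $q=2$ and $k=2$ is NP-complete.
   Context: The Partition Coloring Problem (PCP): given a simple undirected graph $G=(V,E)$, a partition $\mathcal{V}=\{V_1,\dots,V_p\}$ of $V$ into pairwise disjoint parts whose union is $V$, and an integer $k$ (the number of colors), decide whether there is a selection $S$ of $\mathcal{V}$ (a set $S\subseteq V$ with $|S\cap V_i|=1$ for every $i$) such that $\chi(G[S])\le k$. Here $q=\max_{1\le i\le p}|V_i|$; "$q=2$" means every part has at most 2 vertices. *)

theory Defs
  imports
    "HOL-Library.Disjoint_Sets"
    "HOL-Computational_Algebra.Polynomial"
begin

section \<open>Deterministic multi-tape Turing machines\<close>

text \<open>
  States and tape symbols are initial segments of the natural numbers. Symbol 0 is the blank, 1 and
  2 are the bits False and True, and any further symbols are work symbols. Tapes are infinite in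
  both directions. The second component of an action is the head movement.
\<close>

record tm =
  tapes :: nat
  states :: nat
  symbols :: nat
  start :: nat
  accept :: nat
  reject :: nat
  delta :: "nat \<Rightarrow> nat list \<Rightarrow> nat \<times> (nat \<times> int) list"

definition turing_machine :: "tm \<Rightarrow> bool" where
  "turing_machine M \<longleftrightarrow>
     2 \<le> tapes M \<and> 3 \<le> symbols M \<and>
     start M < states M \<and> accept M < states M \<and> reject M < states M \<and> accept M \<noteq> reject M \<and>
     (\<forall>q < states M. \<forall>ss. length ss = tapes M \<and> set ss \<subseteq> {..<symbols M} \<longrightarrow>
        fst (delta M q ss) < states M \<and>
        length (snd (delta M q ss)) = tapes M \<and>
        set (snd (delta M q ss)) \<subseteq> {..<symbols M} \<times> {-1, 0, 1})"

record config =
  state :: nat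
  head :: "nat \<Rightarrow> int"
  tape :: "nat \<Rightarrow> int \<Rightarrow> nat"

definition halted :: "tm \<Rightarrow> config \<Rightarrow> bool" where
  "halted M c \<longleftrightarrow> state c \<in> {accept M, reject M}"

definition step :: "tm \<Rightarrow> config \<Rightarrow> config" where
  "step M c =
     (if halted M c then c
      else let (q, as) = delta M (state c) (map (\<lambda>i. tape c i (head c i)) [0..<tapes M])
           in \<lparr>state = q,
               head = (\<lambda>i. if i < tapes M then head c i + snd (as ! i) else head c i),
               tape = (\<lambda>i. if i < tapes M then (tape c i)(head c i := fst (as ! i)) else tape c i)\<rparr>)"

definition word_tape :: "bool list \<Rightarrow> int \<Rightarrow> nat" where
  "word_tape w j = (if 0 \<le> j \<and> j < int (length w) then (if w ! nat j then 2 else 1) else 0)"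

definition initial :: "tm \<Rightarrow> bool list list \<Rightarrow> config" where
  "initial M ws =
     \<lparr>state = start M,
      head = (\<lambda>i. 0),
      tape = (\<lambda>i. word_tape (if i < length ws then ws ! i else []))\<rparr>"

text \<open>Halting configurations are fixed by \<^const>\<open>step\<close>, so this is the situation reached within
  \<open>t\<close> steps.\<close>

definition run :: "tm \<Rightarrow> nat \<Rightarrow> bool list list \<Rightarrow> config" where
  "run M t ws = (step M ^^ t) (initial M ws)"


section \<open>NP-completeness\<close>

text \<open>A function is computed from tape 0 to tape 1.\<close>

definition polytime_computable :: "(bool list \<Rightarrow> bool list) \<Rightarrow> bool" where
  "polytime_computable f \<longleftrightarrow>
     (\<exists>M (p :: nat poly). turing_machine M \<and>
        (\<forall>x. halted M (run M (poly p (length x)) [x]) \<and>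
             tape (run M (poly p (length x)) [x]) 1 = word_tape (f x)))"

definition poly_reducible :: "bool list set \<Rightarrow> bool list set \<Rightarrow> bool" where
  "poly_reducible A B \<longleftrightarrow> (\<exists>f. polytime_computable f \<and> (\<forall>x. x \<in> A \<longleftrightarrow> f x \<in> B))"

text \<open>A verifier receives the input on tape 0 and the certificate on tape 1.\<close>

definition NP :: "bool list set set" where
  "NP = {L. \<exists>M (p :: nat poly) (r :: nat poly). turing_machine M \<and>
     (\<forall>x c. length c \<le> poly p (length x) \<longrightarrow> halted M (run M (poly r (length x)) [x, c])) \<and>
     (\<forall>x. x \<in> L \<longleftrightarrow>
        (\<exists>c. length c \<le> poly p (length x) \<and> state (run M (poly r (length x)) [x, c]) = accept M))}"

definition NP_hard :: "bool list set \<Rightarrow> bool" where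
  "NP_hard L \<longleftrightarrow> (\<forall>A \<in> NP. poly_reducible A L)"

definition NP_complete :: "bool list set \<Rightarrow> bool" where
  "NP_complete L \<longleftrightarrow> L \<in> NP \<and> NP_hard L"


section \<open>The Partition Coloring Problem\<close>

definition simple_graph :: "'a set \<Rightarrow> 'a set set \<Rightarrow> bool" where
  "simple_graph V E \<longleftrightarrow> finite V \<and> (\<forall>e \<in> E. e \<subseteq> V \<and> card e = 2)"

definition induced_edges :: "'a set set \<Rightarrow> 'a set \<Rightarrow> 'a set set" where
  "induced_edges E S = {e \<in> E. e \<subseteq> S}"

definition proper_coloring :: "'a set \<Rightarrow> 'a set set \<Rightarrow> nat \<Rightarrow> ('a \<Rightarrow> nat) \<Rightarrow> bool" where
  "proper_coloring V E k f \<longleftrightarrow>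
     (\<forall>v \<in> V. f v < k) \<and> (\<forall>u \<in> V. \<forall>v \<in> V. {u, v} \<in> E \<longrightarrow> f u \<noteq> f v)"

definition chromatic_number :: "'a set \<Rightarrow> 'a set set \<Rightarrow> nat" where
  "chromatic_number V E = (LEAST k. \<exists>f. proper_coloring V E k f)"

definition selection :: "'a set \<Rightarrow> 'a set set \<Rightarrow> 'a set \<Rightarrow> bool" where
  "selection V P S \<longleftrightarrow> S \<subseteq> V \<and> (\<forall>X \<in> P. card (S \<inter> X) = 1)"

definition pcp_instance :: "'a set \<Rightarrow> 'a set set \<Rightarrow> 'a set set \<Rightarrow> bool" where
  "pcp_instance V E P \<longleftrightarrow> simple_graph V E \<and> partition_on V P"

definition pcp_yes :: "'a set \<Rightarrow> 'a set set \<Rightarrow> 'a set set \<Rightarrow> nat \<Rightarrow> bool" where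
  "pcp_yes V E P k \<longleftrightarrow> (\<exists>S. selection V P S \<and> chromatic_number S (induced_edges E S) \<le> k)"

text \<open>
  Encoding: the vertices are 0, ..., n - 1, the partition is given by a class label for each vertex,
  and the edges are listed as pairs, in any order. The word is the concatenation of the
  self-delimiting unary codes of n, k, the n labels and the end points of the edges. Since vertices
  are smaller than n and n labels suffice, unary and binary codes of these numbers give
  polynomially related lengths.
\<close>

definition unary :: "nat \<Rightarrow> bool list" where
  "unary n = replicate n True @ [False]"

definition pcp_word :: "nat \<Rightarrow> nat list \<Rightarrow> (nat \<times> nat) list \<Rightarrow> bool list" where
  "pcp_word k ls es =
     concat (map unary ([length ls, k] @ ls @ concat (map (\<lambda>(u, v). [u, v]) es)))"

definition pcp_encodes ::
  "bool list \<Rightarrow> nat set \<Rightarrow> nat set set \<Rightarrow> nat set set \<Rightarrow> nat \<Rightarrow> bool" where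
  "pcp_encodes w V E P k \<longleftrightarrow>
     (\<exists>ls es. w = pcp_word k ls es \<and>
        V = {..<length ls} \<and>
        E = {{u, v} | u v. (u, v) \<in> set es} \<and>
        P = {{v \<in> V. ls ! v = l} | l. l \<in> set ls})"

text \<open>The problem restricted to instances whose parts have at most \<open>q\<close> vertices and whose number
  of colors is \<open>k\<close>.\<close>

definition PCP_restricted :: "nat \<Rightarrow> nat \<Rightarrow> bool list set" where
  "PCP_restricted q k =
     {w. \<exists>V E P. pcp_encodes w V E P k \<and> pcp_instance V E P \<and> (\<forall>X \<in> P. card X \<le> q) \<and>
                 pcp_yes V E P k}"

lemma unary_append_eq: "unary a @ xs = unary b @ ys \<longleftrightarrow> a = b \<and> xs = ys"
proof (induction a arbitrary: b)
  case 0
  then show ?case by (cases b) (auto simp: unary_def)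
next
  case (Suc a)
  then show ?case by (cases b) (auto simp: unary_def)
qed

lemma concat_unary_inj: "concat (map unary xs) = concat (map unary ys) \<longleftrightarrow> xs = ys"
proof (induction xs arbitrary: ys)
  case Nil
  then show ?case by (cases ys) (auto simp: unary_def)
next
  case (Cons x xs)
  then show ?case
    by (cases ys) (auto simp: unary_append_eq, auto simp: unary_def)
qed

lemma concat_pairs_inj:
  "concat (map (\<lambda>(u, v). [u, v]) es) = concat (map (\<lambda>(u, v). [u, v]) es') \<longleftrightarrow> es = es'"
proof (induction es arbitrary: es')
  case Nil
  then show ?case by (cases es') auto
next
  case (Cons e es)
  then show ?case by (cases es') (auto split: prod.splits)
qed

lemma pcp_word_inj: "pcp_word k ls es = pcp_word k' ls' es' \<longleftrightarrow> k = k' \<and> ls = ls' \<and> es = es'"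
  unfolding pcp_word_def concat_unary_inj by (auto simp: concat_pairs_inj)

text \<open>A word encodes at most one instance; together with the next fact, every instance is encoded
  by some word, up to renaming of the vertices.\<close>

lemma pcp_encodes_unique:
  assumes "pcp_encodes w V E P k" and "pcp_encodes w V' E' P' k'"
  shows "V = V' \<and> E = E' \<and> P = P' \<and> k = k'"
  using assms by (auto simp: pcp_encodes_def pcp_word_inj)

lemma pcp_encodes_exists:
  assumes "pcp_instance {..<n} E P"
  shows "\<exists>w. pcp_encodes w {..<n} E P k"
proof -
  have part: "partition_on {..<n} P" and gr: "\<forall>e \<in> E. e \<subseteq> {..<n} \<and> card e = 2"
    using assms by (auto simp: pcp_instance_def simple_graph_def)
  have "finite P"
    using part finite_elements by blast
  then obtain g :: "nat set \<Rightarrow> nat" where g: "inj_on g P"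
    using finite_imp_inj_to_nat_seg by blast
  define part_of where "part_of v = (THE X. X \<in> P \<and> v \<in> X)" for v
  have part_of: "part_of v = X" if "X \<in> P" "v \<in> X" for X v
    unfolding part_of_def using that part
    by (intro the_equality) (auto simp: partition_on_def disjoint_def)
  have ex: "part_of v \<in> P \<and> v \<in> part_of v" if "v < n" for v
  proof -
    have "v \<in> \<Union>P" using that part by (simp add: partition_on_def)
    then obtain X where "X \<in> P" "v \<in> X" by blast
    then show ?thesis using part_of by auto
  qed
  define ls where "ls = map (\<lambda>v. g (part_of v)) [0..<n]"
  have fibre: "{v \<in> {..<n}. ls ! v = g X} = X" if "X \<in> P" for X
  proof -
    have "X \<subseteq> {..<n}" using that part by (auto simp: partition_on_def)
    moreover have "g (part_of v) = g X \<longleftrightarrow> v \<in> X" if "v < n" for v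
      using inj_on_eq_iff[OF g conjunct1[OF ex[OF that]] \<open>X \<in> P\<close>] ex[OF that] part_of[OF \<open>X \<in> P\<close>]
      by blast
    ultimately show ?thesis by (auto simp: ls_def)
  qed
  have labels: "set ls = g ` P"
  proof -
    have "part_of ` {..<n} = P"
    proof (intro equalityI subsetI)
      fix X assume X: "X \<in> P"
      then have "X \<noteq> {}" "X \<subseteq> {..<n}" using part by (auto simp: partition_on_def)
      then obtain v where v: "v \<in> X" "v \<in> {..<n}" by blast
      show "X \<in> part_of ` {..<n}" using part_of[OF X v(1)] v(2) by blast
    qed (use ex in blast)
    moreover have "set ls = g ` part_of ` {..<n}"
      by (simp add: ls_def image_image lessThan_atLeast0)
    ultimately show ?thesis by simp
  qed
  have "P = {{v \<in> {..<n}. ls ! v = l} | l. l \<in> set ls}"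
  proof -
    have "{{v \<in> {..<n}. ls ! v = l} | l. l \<in> set ls} = (\<lambda>X. {v \<in> {..<n}. ls ! v = g X}) ` P"
      unfolding labels by blast
    also have "\<dots> = (\<lambda>X. X) ` P" by (rule image_cong) (simp_all only: fibre)
    finally show ?thesis by simp
  qed
  moreover have "finite {(u, v). {u, v} \<in> E}"
    by (rule finite_subset[of _ "{..<n} \<times> {..<n}"]) (use gr in auto)
  then obtain es where "set es = {(u, v). {u, v} \<in> E}"
    using finite_list by blast
  then have es: "(u, v) \<in> set es \<longleftrightarrow> {u, v} \<in> E" for u v by simp
  have "E = {{u, v} | u v. (u, v) \<in> set es}"
  proof -
    have "\<exists>u v. e = {u, v}" if "e \<in> E" for e using gr that by (meson card_2_iff)
    then show ?thesis unfolding es by blast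
  qed
  moreover have "{..<n} = {..<length ls}" by (simp add: ls_def)
  ultimately show ?thesis unfolding pcp_encodes_def by blast
qed

end

theory Submission imports Defs begin

text \<open>
  Both halves rest on one class of functions: those built from input bits, addition, truncated
  subtraction and bounded sums. A multi-tape machine evaluates them with the head positions of work
  tapes as counters, and since all values are polynomially bounded, it does so in polynomial time.
  This class contains a verifier for partition colouring, whose certificate lists for each vertex
  whether it is selected and its colour.

  For hardness, the computation of a verifier is described by triples of literals that must not hold
  simultaneously, where tapes are recorded relative to their heads. To forbid a triple, each of its
  literals gets a private copy, selected whenever the literal is, and the three copies form a
  triangle. As long as no triple is violated, the selected vertices induce a forest, so two colours
  suffice.
\<close>



section \<open>Structured programs for Turing machines\<close>

text \<open>The gadget follows from the two parameters. With \<open>q = 2\<close>, a part made of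
  the two literals of a variable turns a selection into a truth assignment. With
  \<open>k = 2\<close>, the obstructions are odd cycles, and the shortest one, a triangle, forbids
  three vertices to be selected together. Literal vertices shared by several triangles could close
  unintended odd cycles, hence the copies. The limit of three literals in turn shapes the
  description of computations: a transition depends on the state and on the scanned symbols of all
  \<open>K\<close> tapes at once, too much for one triple. They are therefore packed into a single
  number, the view, one tape per clause with two premises and one conclusion. Recording tapes
  relative to the heads puts the scanned cell at a fixed index, so no premise is spent on head
  positions. On the machine side, polynomially bounded values make unary counters affordable, and
  closure under bounded sums lets word decoding, division and quantifiers be expressed by equations,
  so that computability of the verifier and of the reduction follows by introduction rules.\<close>

datatype com =
    Act nat "nat \<Rightarrow> nat" int
  | Seq com com
  | IfN nat nat com
  | WhileN nat nat com

type_synonym tstate = "(nat \<Rightarrow> int) \<times> (nat \<Rightarrow> int \<Rightarrow> nat)"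

definition scan :: "tstate \<Rightarrow> nat \<Rightarrow> nat" where
  "scan \<sigma> i = snd \<sigma> i (fst \<sigma> i)"

definition act :: "nat \<Rightarrow> (nat \<Rightarrow> nat) \<Rightarrow> int \<Rightarrow> tstate \<Rightarrow> tstate" where
  "act i f m \<sigma> =
     ((fst \<sigma>)(i := fst \<sigma> i + m), (snd \<sigma>)(i := (snd \<sigma> i)(fst \<sigma> i := f (scan \<sigma> i))))"

text \<open>The time is the exact number of machine steps of the compiled code: one per action or
  test, and one more per loop round for the jump back.\<close>

inductive exec :: "com \<Rightarrow> tstate \<Rightarrow> nat \<Rightarrow> tstate \<Rightarrow> bool" where
  exec_Act: "exec (Act i f m) \<sigma> 1 (act i f m \<sigma>)"
| exec_Seq: "exec a \<sigma> t \<sigma>' \<Longrightarrow> exec b \<sigma>' t' \<sigma>'' \<Longrightarrow> exec (Seq a b) \<sigma> (t + t') \<sigma>''"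
| exec_IfN_skip: "scan \<sigma> i = s \<Longrightarrow> exec (IfN i s c) \<sigma> 1 \<sigma>"
| exec_IfN: "scan \<sigma> i \<noteq> s \<Longrightarrow> exec c \<sigma> t \<sigma>' \<Longrightarrow> exec (IfN i s c) \<sigma> (1 + t) \<sigma>'"
| exec_WhileN_end: "scan \<sigma> i = s \<Longrightarrow> exec (WhileN i s c) \<sigma> 1 \<sigma>"
| exec_WhileN: "scan \<sigma> i \<noteq> s \<Longrightarrow> exec c \<sigma> t \<sigma>' \<Longrightarrow> exec (WhileN i s c) \<sigma>' t' \<sigma>'' \<Longrightarrow>
    exec (WhileN i s c) \<sigma> (1 + (t + (1 + t'))) \<sigma>''"

text \<open>An instruction inspects one tape; its table maps the scanned symbol to the symbol to write,
  the head movement and the next instruction.\<close>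

type_synonym instr = "nat \<times> (nat \<Rightarrow> nat \<times> int \<times> nat)"

section \<open>Compilation to instruction lists\<close>

fun csize :: "com \<Rightarrow> nat" where
  "csize (Act i f m) = 1"
| "csize (Seq a b) = csize a + csize b"
| "csize (IfN i s c) = 1 + csize c"
| "csize (WhileN i s c) = 2 + csize c"

text \<open>Jump targets are absolute, hence the start address \<open>p\<close>. Control always
  leaves a block at \<open>p + csize c\<close>, so sequencing is concatenation.\<close>

fun compile :: "com \<Rightarrow> nat \<Rightarrow> instr list" where
  "compile (Act i f m) p = [(i, \<lambda>s. (f s, m, p + 1))]"
| "compile (Seq a b) p = compile a p @ compile b (p + csize a)"
| "compile (IfN i s c) p = (i, \<lambda>x. (x, 0, if x = s then p + 1 + csize c else p + 1)) # compile c (p + 1)"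
| "compile (WhileN i s c) p =
     (i, \<lambda>x. (x, 0, if x = s then p + 2 + csize c else p + 1)) # compile c (p + 1) @ [(i, \<lambda>x. (x, 0, p))]"

lemma length_compile [simp]: "length (compile c p) = csize c"
  by (induction c arbitrary: p) auto

fun well_formed :: "com \<Rightarrow> bool" where
  "well_formed (Act i f m) \<longleftrightarrow> (\<forall>s<3. f s < 3) \<and> m \<in> {-1, 0, 1}"
| "well_formed (Seq a b) \<longleftrightarrow> well_formed a \<and> well_formed b"
| "well_formed (IfN i s c) \<longleftrightarrow> well_formed c"
| "well_formed (WhileN i s c) \<longleftrightarrow> well_formed c"

fun tape_bound :: "com \<Rightarrow> nat" where
  "tape_bound (Act i f m) = Suc i"
| "tape_bound (Seq a b) = max (tape_bound a) (tape_bound b)"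
| "tape_bound (IfN i s c) = max (Suc i) (tape_bound c)"
| "tape_bound (WhileN i s c) = max (Suc i) (tape_bound c)"

text \<open>The accepting and rejecting states are the two addresses right behind the code: running
  off its end accepts, and rejecting takes a jump one address further.\<close>

definition machine :: "nat \<Rightarrow> instr list \<Rightarrow> tm" where
  "machine K ins = \<lparr>tapes = K, states = length ins + 2, symbols = 3, start = 0,
     accept = length ins, reject = length ins + 1,
     delta = (\<lambda>q ss. if q < length ins then
         (case ins ! q of (i, g) \<Rightarrow> case g (ss ! i) of (s', m, q') \<Rightarrow>
            (q', map (\<lambda>j. if j = i then (s', m) else (ss ! j, 0)) [0..<K]))
       else (q, map (\<lambda>s. (s, 0)) ss))\<rparr>"

definition ok_instr :: "nat \<Rightarrow> nat \<Rightarrow> instr \<Rightarrow> bool" where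
  "ok_instr K L I \<longleftrightarrow> fst I < K \<and>
     (\<forall>s<3. fst (snd I s) < 3 \<and> fst (snd (snd I s)) \<in> {-1, 0, 1} \<and> snd (snd (snd I s)) < L)"

text \<open>The inequality \<open>p + csize c < L\<close> is strict because the exit address is
  itself a jump target and must be a state.\<close>

lemma ok_compile:
  "well_formed c \<Longrightarrow> tape_bound c \<le> K \<Longrightarrow> p + csize c < L \<Longrightarrow> I \<in> set (compile c p) \<Longrightarrow> ok_instr K L I"
proof (induction c arbitrary: p)
  case (Act i f m)
  then show ?case by (auto simp: ok_instr_def)
next
  case (Seq a b)
  then show ?case using Seq.IH(1)[of p] Seq.IH(2)[of "p + csize a"] by auto
next
  case (IfN i s c)
  have "I \<in> set (compile c (p + 1)) \<Longrightarrow> ?case" using IfN.IH[of "p + 1"] IfN.prems by simp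
  then show ?case using IfN.prems by (auto simp: ok_instr_def)
next
  case (WhileN i s c)
  have "I \<in> set (compile c (p + 1)) \<Longrightarrow> ?case" using WhileN.IH[of "p + 1"] WhileN.prems by simp
  then show ?case using WhileN.prems by (auto simp: ok_instr_def)
qed

lemma turing_machine_machine:
  assumes "2 \<le> K" and ok: "\<And>I. I \<in> set ins \<Longrightarrow> ok_instr K (length ins + 2) I"
  shows "turing_machine (machine K ins)"
proof -
  have "fst (delta (machine K ins) q ss) < length ins + 2 \<and>
        length (snd (delta (machine K ins) q ss)) = K \<and>
        set (snd (delta (machine K ins) q ss)) \<subseteq> {..<3} \<times> {-1, 0, 1}"
    if q: "q < length ins + 2" and ss: "length ss = K" "set ss \<subseteq> {..<3}" for q ss
  proof (cases "q < length ins")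
    case True
    obtain i g where ig: "ins ! q = (i, g)" by force
    have "ok_instr K (length ins + 2) (i, g)" using ok[OF nth_mem[OF True]] ig by simp
    moreover have nth: "ss ! j < 3" if "j < K" for j using ss that nth_mem by blast
    ultimately show ?thesis using True ig
      by (auto simp: machine_def ok_instr_def split: prod.splits) (metis fst_conv snd_conv)+
  next
    case False
    then show ?thesis using q ss by (auto simp: machine_def)
  qed
  then show ?thesis using assms(1) by (simp add: turing_machine_def) (simp add: machine_def)
qed

lemma step_machine:
  assumes q: "state c < length ins" and ig: "ins ! state c = (i, g)" and i: "i < K"
    and g: "g (tape c i (head c i)) = (s', m, q')"
  shows "step (machine K ins) c =
    \<lparr>state = q', head = (head c)(i := head c i + m), tape = (tape c)(i := (tape c i)(head c i := s'))\<rparr>"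
proof -
  have "\<not> halted (machine K ins) c" using q by (simp add: halted_def machine_def)
  then show ?thesis using assms
    by (auto simp: step_def machine_def fun_eq_iff)
qed

text \<open>Tapes from \<open>K\<close> on are ignored: the abstract states used later carry marks
  on all counter tapes, while a machine can only prepare its own.\<close>

definition agree :: "nat \<Rightarrow> config \<Rightarrow> tstate \<Rightarrow> bool" where
  "agree K c \<sigma> \<longleftrightarrow> (\<forall>i<K. head c i = fst \<sigma> i \<and> tape c i = snd \<sigma> i)"

lemma step_test:
  assumes "state c < length ins" "ins ! state c = (i, g)" "i < K" "agree K c \<sigma>"
    and "g (scan \<sigma> i) = (scan \<sigma> i, 0, q')"
  shows "state (step (machine K ins) c) = q' \<and> agree K (step (machine K ins) c) \<sigma>"
proof -
  have "tape c i (head c i) = scan \<sigma> i" using assms(3,4) by (simp add: agree_def scan_def)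
  with step_machine[OF assms(1-3)] assms(4,5) show ?thesis
    by (auto simp: agree_def scan_def)
qed

text \<open>Induction over the execution rather than the program, so that the remaining loop rounds
  are covered by an induction hypothesis. The surrounding code \<open>pre\<close> and
  \<open>post\<close> is arbitrary because every subprogram runs in place.\<close>

lemma simulation:
  assumes "exec c \<sigma> t \<sigma>'" and "tape_bound c \<le> K"
    and "ins = pre @ compile c (length pre) @ post"
    and "state cf = length pre" and "agree K cf \<sigma>"
  shows "state ((step (machine K ins) ^^ t) cf) = length pre + csize c \<and>
         agree K ((step (machine K ins) ^^ t) cf) \<sigma>'"
  using assms
proof (induction arbitrary: cf pre post)
  case (exec_Act i f m \<sigma>)
  have "step (machine K ins) cf =
    \<lparr>state = length pre + 1, head = (head cf)(i := head cf i + m),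
     tape = (tape cf)(i := (tape cf i)(head cf i := f (tape cf i (head cf i))))\<rparr>"
    using exec_Act by (intro step_machine[where g = "\<lambda>s. (f s, m, length pre + 1)"]) auto
  then show ?case using exec_Act by (auto simp: agree_def act_def scan_def)
next
  case (exec_Seq a \<sigma> t \<sigma>' b t' \<sigma>'')
  let ?cf = "(step (machine K ins) ^^ t) cf"
  have 1: "state ?cf = length pre + csize a \<and> agree K ?cf \<sigma>'"
    using exec_Seq.prems by (intro exec_Seq.IH(1)[where post = "compile b (length pre + csize a) @ post"]) auto
  have "state ((step (machine K ins) ^^ t') ?cf) = length (pre @ compile a (length pre)) + csize b \<and>
        agree K ((step (machine K ins) ^^ t') ?cf) \<sigma>''"
    using exec_Seq.prems 1
    by (intro exec_Seq.IH(2)[where pre = "pre @ compile a (length pre)"]) auto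
  then show ?case by (simp add: funpow_add add.commute[of t t'] add.assoc)
next
  case (exec_IfN_skip \<sigma> i s c)
  then show ?case
    using step_test[of cf ins i _ K \<sigma> "length pre + 1 + csize c"] by (auto simp: nth_append)
next
  case (exec_IfN \<sigma> i s c t \<sigma>')
  let ?cf = "step (machine K ins) cf"
  let ?I = "(i, \<lambda>x. (x, 0, if x = s then length pre + 1 + csize c else length pre + 1)) :: instr"
  have 1: "state ?cf = length pre + 1 \<and> agree K ?cf \<sigma>"
    using exec_IfN.prems exec_IfN.hyps by (intro step_test[where i = i and g = "snd ?I"]) (auto simp: nth_append)
  have "state ((step (machine K ins) ^^ t) ?cf) = length (pre @ [?I]) + csize c \<and>
        agree K ((step (machine K ins) ^^ t) ?cf) \<sigma>'"
    using exec_IfN.prems 1 by (intro exec_IfN.IH[where post = post]) auto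
  then show ?case by (simp add: funpow_swap1)
next
  case (exec_WhileN_end \<sigma> i s c)
  then show ?case
    using step_test[of cf ins i _ K \<sigma> "length pre + 2 + csize c"] by (auto simp: nth_append)
next
  case (exec_WhileN \<sigma> i s c t \<sigma>' t' \<sigma>'')
  let ?M = "machine K ins"
  let ?cf = "step ?M cf"
  let ?I = "(i, \<lambda>x. (x, 0, if x = s then length pre + 2 + csize c else length pre + 1)) :: instr"
  let ?J = "(i, \<lambda>x. (x, 0, length pre)) :: instr"
  have 1: "state ?cf = length pre + 1 \<and> agree K ?cf \<sigma>"
    using exec_WhileN.prems exec_WhileN.hyps by (intro step_test[where i = i and g = "snd ?I"]) (auto simp: nth_append)
  have 2: "state ((step ?M ^^ t) ?cf) = length (pre @ [?I]) + csize c \<and> agree K ((step ?M ^^ t) ?cf) \<sigma>'"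
    using exec_WhileN.prems 1 by (intro exec_WhileN.IH(1)[where post = "[?J] @ post"]) auto
  let ?cf2 = "step ?M ((step ?M ^^ t) ?cf)"
  have 3: "state ?cf2 = length pre \<and> agree K ?cf2 \<sigma>'"
    using exec_WhileN.prems 2 by (intro step_test[where i = i and g = "snd ?J"]) (auto simp: nth_append)
  have "state ((step ?M ^^ t') ?cf2) = length pre + csize (WhileN i s c) \<and> agree K ((step ?M ^^ t') ?cf2) \<sigma>''"
    using exec_WhileN.prems 3 by (intro exec_WhileN.IH(2)[where post = post]) auto
  moreover have "(step ?M ^^ (1 + (t + (1 + t')))) cf = (step ?M ^^ t') ?cf2"
    using funpow_add[of t' "1 + (t + 1)" "step ?M"] funpow_add[of 1 "t + 1" "step ?M"]
      funpow_add[of t 1 "step ?M"]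
    by (simp add: add_ac funpow_swap1)
  ultimately show ?case by simp
qed


section \<open>Polynomial functions\<close>

definition polynomial :: "(nat \<Rightarrow> nat) \<Rightarrow> bool" where
  "polynomial T \<longleftrightarrow> (\<exists>p. \<forall>N. T N = poly p N)"

named_theorems polynomial_intros

lemma polynomial_const [polynomial_intros]: "polynomial (\<lambda>N. c)"
  unfolding polynomial_def by (rule exI[of _ "[:c:]"]) simp

lemma polynomial_id [polynomial_intros]: "polynomial (\<lambda>N. N)"
  unfolding polynomial_def by (rule exI[of _ "[:0, 1:]"]) simp

lemma polynomial_add [polynomial_intros]:
  "polynomial S \<Longrightarrow> polynomial T \<Longrightarrow> polynomial (\<lambda>N. S N + T N)"
  unfolding polynomial_def by (metis poly_add)

lemma polynomial_mult [polynomial_intros]: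
  "polynomial S \<Longrightarrow> polynomial T \<Longrightarrow> polynomial (\<lambda>N. S N * T N)"
  unfolding polynomial_def by (metis poly_mult)

lemma polynomial_Suc [polynomial_intros]: "polynomial T \<Longrightarrow> polynomial (\<lambda>N. Suc (T N))"
  using polynomial_add[OF polynomial_const[of 1]] by simp

lemma polynomial_comp: "polynomial S \<Longrightarrow> polynomial T \<Longrightarrow> polynomial (\<lambda>N. S (T N))"
  unfolding polynomial_def by (metis poly_pcompose)


section \<open>Counters\<close>

text \<open>Counter \<open>j\<close> is the head position on tape \<open>j + 2\<close>, whose cell 0 carries a mark so that the
  value 0 can be recognised. The tapes 0 and 1 hold words and are described by \<open>io\<close>.\<close>

definition mark :: "int \<Rightarrow> nat" where
  "mark j = (if j = 0 then 1 else 0)"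

definition cstate :: "(nat \<Rightarrow> int \<times> (int \<Rightarrow> nat)) \<Rightarrow> (nat \<Rightarrow> nat) \<Rightarrow> tstate" where
  "cstate io r =
     (\<lambda>i. if i < 2 then fst (io i) else int (r (i - 2)), \<lambda>i. if i < 2 then snd (io i) else mark)"

text \<open>Only an upper bound of the time is tracked, so that it can be rounded up to a function
  of the input size.\<close>

definition runs :: "com \<Rightarrow> tstate \<Rightarrow> nat \<Rightarrow> tstate \<Rightarrow> bool" where
  "runs c \<sigma> b \<sigma>' \<longleftrightarrow> (\<exists>t\<le>b. exec c \<sigma> t \<sigma>')"

lemma runs_mono: "runs c \<sigma> b \<sigma>' \<Longrightarrow> b \<le> b' \<Longrightarrow> runs c \<sigma> b' \<sigma>'"
  unfolding runs_def by (meson order_trans)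

lemma runs_Act: "act i f m \<sigma> = \<sigma>' \<Longrightarrow> runs (Act i f m) \<sigma> 1 \<sigma>'"
  unfolding runs_def using exec_Act by blast

lemma runs_Seq: "runs a \<sigma> m \<sigma>' \<Longrightarrow> runs b \<sigma>' n \<sigma>'' \<Longrightarrow> runs (Seq a b) \<sigma> (m + n) \<sigma>''"
  unfolding runs_def by (meson exec_Seq add_mono)

lemma runs_IfN:
  assumes "scan \<sigma> i \<noteq> s \<Longrightarrow> runs c \<sigma> b \<sigma>'" and "scan \<sigma> i = s \<Longrightarrow> \<sigma>' = \<sigma>"
  shows "runs (IfN i s c) \<sigma> (1 + b) \<sigma>'"
proof (cases "scan \<sigma> i = s")
  case True
  then have "exec (IfN i s c) \<sigma> 1 \<sigma>'" using assms(2) exec_IfN_skip by simp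
  then show ?thesis unfolding runs_def by (intro exI[of _ 1]) simp
next
  case False
  then show ?thesis using assms(1) exec_IfN unfolding runs_def by (meson add_left_mono)
qed

text \<open>The states before the rounds are given in advance as a family \<open>S\<close>, which
  makes the number of rounds part of the rule. A round costs two steps beyond its body, the test and
  the jump back.\<close>

lemma runs_WhileN:
  assumes "\<And>k. k < n \<Longrightarrow> scan (S k) i \<noteq> s" and "scan (S n) i = s"
    and "\<And>k. k < n \<Longrightarrow> runs c (S k) b (S (Suc k))"
  shows "runs (WhileN i s c) (S 0) (n * (b + 2) + 1) (S n)"
  using assms
proof (induction n arbitrary: S)
  case 0
  then show ?case using exec_WhileN_end[of "S 0" i s c] by (auto simp: runs_def)
next
  case (Suc n)
  have "runs (WhileN i s c) (S (Suc 0)) (n * (b + 2) + 1) (S (Suc n))"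
    using Suc.prems by (intro Suc.IH[of "\<lambda>k. S (Suc k)"]) auto
  then obtain t' where t': "t' \<le> n * (b + 2) + 1" "exec (WhileN i s c) (S (Suc 0)) t' (S (Suc n))"
    unfolding runs_def by blast
  obtain t where t: "t \<le> b" "exec c (S 0) t (S (Suc 0))"
    using Suc.prems(3)[of 0] unfolding runs_def by blast
  have "exec (WhileN i s c) (S 0) (1 + (t + (1 + t'))) (S (Suc n))"
    using Suc.prems(1)[of 0] t t' by (intro exec_WhileN) auto
  then show ?case unfolding runs_def
    using t(1) t'(1) by (intro exI[of _ "1 + (t + (1 + t'))"]) auto
qed

definition inc :: "nat \<Rightarrow> com" where "inc j = Act (j + 2) (\<lambda>s. s) 1"
definition dec :: "nat \<Rightarrow> com" where "dec j = Act (j + 2) (\<lambda>s. s) (- 1)"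
definition while_pos :: "nat \<Rightarrow> com \<Rightarrow> com" where "while_pos j c = WhileN (j + 2) 1 c"
definition move :: "nat \<Rightarrow> nat \<Rightarrow> com" where "move x y = while_pos x (Seq (dec x) (inc y))"
definition clear :: "nat \<Rightarrow> com" where "clear x = while_pos x (dec x)"

lemma well_formed_macros [simp]:
  "well_formed (inc j)" "well_formed (dec j)" "well_formed (while_pos j c) \<longleftrightarrow> well_formed c"
  "well_formed (move x y)" "well_formed (clear x)"
  by (simp_all add: inc_def dec_def while_pos_def move_def clear_def)

lemma scan_cstate_counter [simp]: "scan (cstate io r) (Suc (Suc j)) = (if r j = 0 then 1 else 0)"
  by (simp add: scan_def cstate_def mark_def)

lemma scan_cstate_word: "i < 2 \<Longrightarrow> scan (cstate io r) i = snd (io i) (fst (io i))"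
  by (simp add: scan_def cstate_def)

lemma runs_inc: "r' = r(j := r j + 1) \<Longrightarrow> runs (inc j) (cstate io r) 1 (cstate io r')"
  unfolding inc_def by (rule runs_Act) (auto simp: act_def cstate_def scan_def fun_eq_iff)

lemma runs_dec: "0 < r j \<Longrightarrow> r' = r(j := r j - 1) \<Longrightarrow> runs (dec j) (cstate io r) 1 (cstate io r')"
  unfolding dec_def by (rule runs_Act) (auto simp: act_def cstate_def scan_def fun_eq_iff)

lemma runs_shift_word:
  "i < 2 \<Longrightarrow> io' = io(i := (fst (io i) + m, snd (io i))) \<Longrightarrow>
   runs (Act i (\<lambda>s. s) m) (cstate io r) 1 (cstate io' r)"
  by (rule runs_Act) (auto simp: act_def cstate_def scan_def fun_eq_iff)

text \<open>The outer states enter through equations, since they usually agree with members of the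
  family only after function updates have been simplified.\<close>

lemma runs_while_pos:
  assumes "\<And>k. k < n \<Longrightarrow> R k j \<noteq> 0" and "R n j = 0"
    and "\<And>k. k < n \<Longrightarrow> runs c (cstate (IO k) (R k)) b (cstate (IO (Suc k)) (R (Suc k)))"
    and "cstate io r = cstate (IO 0) (R 0)" and "cstate io' r' = cstate (IO n) (R n)"
  shows "runs (while_pos j c) (cstate io r) (n * (b + 2) + 1) (cstate io' r')"
  unfolding while_pos_def assms(4,5)
  by (rule runs_WhileN[where S = "\<lambda>k. cstate (IO k) (R k)"]) (use assms(1-3) in auto)

lemma runs_move:
  assumes "x \<noteq> y" and "r' = r(x := 0, y := r y + r x)"
  shows "runs (move x y) (cstate io r) (r x * 4 + 1) (cstate io r')"
proof -
  have "runs (move x y) (cstate io r) (r x * (2 + 2) + 1) (cstate io r')"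
    unfolding move_def
  proof (rule runs_while_pos[where R = "\<lambda>k. r(x := r x - k, y := r y + k)" and IO = "\<lambda>_. io"])
    fix k assume k: "k < r x"
    have "runs (Seq (dec x) (inc y)) (cstate io (r(x := r x - k, y := r y + k))) (1 + 1)
        (cstate io (r(x := r x - Suc k, y := r y + Suc k)))"
      using k assms(1)
      by (intro runs_Seq[OF runs_dec[OF _ refl] runs_inc]) (auto simp: fun_eq_iff)
    then show "runs (Seq (dec x) (inc y)) (cstate io (r(x := r x - k, y := r y + k))) 2
        (cstate io (r(x := r x - Suc k, y := r y + Suc k)))" by (simp add: numeral_2_eq_2)
  qed (use assms in auto)
  then show ?thesis by simp
qed

lemma runs_clear:
  assumes "r' = r(x := 0)"
  shows "runs (clear x) (cstate io r) (r x * 3 + 1) (cstate io r')"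
proof -
  have eq: "r x * 3 + 1 = r x * (1 + 2) + 1" by simp
  show ?thesis
    unfolding clear_def eq
  proof (rule runs_while_pos[where R = "\<lambda>k. r(x := r x - k)" and IO = "\<lambda>_. io"])
    fix k assume k: "k < r x"
    then show "runs (dec x) (cstate io (r(x := r x - k))) 1 (cstate io (r(x := r x - Suc k)))"
      by (intro runs_dec) (auto simp: fun_eq_iff)
  qed (use assms in auto)
qed



section \<open>Counter-computable functions\<close>

text \<open>Functions of input words \<open>w 0, w 1\<close> and of a stack \<open>s\<close> of numeric variables (de Bruijn
  indices); \<open>U\<close> is the set of words that may be inspected.\<close>

inductive computable ::
  "nat set \<Rightarrow> ((nat \<Rightarrow> bool list) \<Rightarrow> (nat \<Rightarrow> nat) \<Rightarrow> nat) \<Rightarrow> bool" for U where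
  var: "computable U (\<lambda>w s. s n)"
| const: "computable U (\<lambda>w s. n)"
| len: "k \<in> U \<Longrightarrow> computable U (\<lambda>w s. length (w k))"
| bit: "k \<in> U \<Longrightarrow> computable U A \<Longrightarrow>
    computable U (\<lambda>w s. of_bool (A w s < length (w k) \<and> w k ! A w s))"
| plus: "computable U A \<Longrightarrow> computable U B \<Longrightarrow> computable U (\<lambda>w s. A w s + B w s)"
| minus: "computable U A \<Longrightarrow> computable U B \<Longrightarrow> computable U (\<lambda>w s. A w s - B w s)"
| sum_stack: "computable U A \<Longrightarrow> computable U B \<Longrightarrow>
    computable U (\<lambda>w s. \<Sum>i<A w s. B w (case_nat i s))"

text \<open>Counters hold values in unary, so bounds on values are what bounds the running time. In
  a sum, the index pushed on the stack can be nearly \<open>V N\<close>; the summand is therefore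
  bounded at \<open>N + V N\<close>.\<close>

lemma computable_bounded:
  assumes "computable U F"
  shows "\<exists>V. polynomial V \<and>
    (\<forall>w s N. (\<forall>k\<in>U. length (w k) \<le> N) \<longrightarrow> (\<forall>v. s v \<le> N) \<longrightarrow> F w s \<le> V N)"
  using assms
proof induction
  case (var n)
  show ?case by (rule exI[of _ "\<lambda>N. N"]) (auto intro: polynomial_intros)
next
  case (const n)
  show ?case by (rule exI[of _ "\<lambda>N. n"]) (auto intro: polynomial_intros)
next
  case (len k)
  then show ?case by (intro exI[of _ "\<lambda>N. N"]) (auto intro: polynomial_intros)
next
  case (bit k A)
  show ?case by (rule exI[of _ "\<lambda>N. 1"]) (auto intro: polynomial_intros)
next
  case (plus A B)
  then obtain V W where "polynomial V" "polynomial W"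
    "\<And>w s N. \<lbrakk>\<forall>k\<in>U. length (w k) \<le> N; \<forall>v. s v \<le> N\<rbrakk> \<Longrightarrow> A w s \<le> V N"
    "\<And>w s N. \<lbrakk>\<forall>k\<in>U. length (w k) \<le> N; \<forall>v. s v \<le> N\<rbrakk> \<Longrightarrow> B w s \<le> W N" by metis
  then show ?case
    by (intro exI[of _ "\<lambda>N. V N + W N"]) (auto intro!: polynomial_intros add_mono)
next
  case (minus A B)
  then obtain V where "polynomial V"
    "\<And>w s N. \<lbrakk>\<forall>k\<in>U. length (w k) \<le> N; \<forall>v. s v \<le> N\<rbrakk> \<Longrightarrow> A w s \<le> V N" by metis
  then show ?case
    by (intro exI[of _ V]) (auto intro: le_trans[OF diff_le_self])
next
  case (sum_stack A B)
  then obtain V W where V: "polynomial V"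
    "\<And>w s N. \<lbrakk>\<forall>k\<in>U. length (w k) \<le> N; \<forall>v. s v \<le> N\<rbrakk> \<Longrightarrow> A w s \<le> V N"
    and W: "polynomial W"
    "\<And>w s N. \<lbrakk>\<forall>k\<in>U. length (w k) \<le> N; \<forall>v. s v \<le> N\<rbrakk> \<Longrightarrow> B w s \<le> W N" by metis
  have "(\<Sum>i<A w s. B w (case_nat i s)) \<le> V N * W (N + V N)"
    if N: "\<forall>k\<in>U. length (w k) \<le> N" "\<forall>v. s v \<le> N" for w s N
  proof -
    have "B w (case_nat i s) \<le> W (N + V N)" if "i < A w s" for i
    proof (rule W(2))
      show "\<forall>v. case_nat i s v \<le> N + V N"
        using that V(2)[OF N] N by (auto split: nat.split intro: trans_le_add1)
    qed (use N in \<open>auto intro: trans_le_add1\<close>)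
    then have "(\<Sum>i<A w s. B w (case_nat i s)) \<le> A w s * W (N + V N)"
      using sum_bounded_above[of "{..<A w s}" "\<lambda>i. B w (case_nat i s)" "W (N + V N)"] by auto
    also have "\<dots> \<le> V N * W (N + V N)" using V(2)[OF N] by simp
    finally show ?thesis .
  qed
  then show ?case using V(1) W(1)
    by (intro exI[of _ "\<lambda>N. V N * W (N + V N)"])
       (auto intro!: polynomial_intros polynomial_comp[of W])
qed

lemma computable_boundedE:
  assumes "computable U F"
  obtains V where "polynomial V"
    and "\<And>w s N. \<lbrakk>\<forall>k\<in>U. length (w k) \<le> N; \<forall>v. s v \<le> N\<rbrakk> \<Longrightarrow> F w s \<le> V N"
  using computable_bounded[OF assms] by blast

text \<open>\<open>\<rho>\<close> tells which counter holds a stack variable, and \<open>d\<close>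
  is the first free counter. Apart from the result in \<open>d\<close> everything is restored:
  scratch counters are zero again and the heads on the words return, so that evaluations can be
  nested and repeated.\<close>

definition evaluates ::
  "nat set \<Rightarrow> ((nat \<Rightarrow> bool list) \<Rightarrow> (nat \<Rightarrow> nat) \<Rightarrow> nat) \<Rightarrow> (nat \<Rightarrow> nat) \<Rightarrow> nat \<Rightarrow> com \<Rightarrow>
   (nat \<Rightarrow> nat) \<Rightarrow> bool" where
  "evaluates U F \<rho> d c T \<longleftrightarrow> well_formed c \<and> polynomial T \<and>
     (\<forall>io w r N. (\<forall>k\<in>U. k < 2 \<and> io k = (0, word_tape (w k)) \<and> length (w k) \<le> N) \<longrightarrow>
        (\<forall>j\<ge>d. r j = 0) \<longrightarrow> (\<forall>j. r j \<le> N) \<longrightarrow>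
        runs c (cstate io r) (T N) (cstate io (r(d := F w (\<lambda>v. r (\<rho> v))))))"

lemma evaluatesD:
  assumes "evaluates U F \<rho> d c T"
    and "\<And>k. k \<in> U \<Longrightarrow> k < 2 \<and> io k = (0, word_tape (w k)) \<and> length (w k) \<le> N"
    and "\<And>j. d \<le> j \<Longrightarrow> r j = 0" and "\<And>j. r j \<le> N" and "x = F w (\<lambda>v. r (\<rho> v))"
  shows "runs c (cstate io r) (T N) (cstate io (r(d := x)))"
  using assms unfolding evaluates_def by blast

lemma word_tape_nonblank: "word_tape w (int j) \<noteq> 0 \<longleftrightarrow> j < length w"
  by (simp add: word_tape_def)

lemma word_tape_eq_2: "word_tape w (int j) = 2 \<longleftrightarrow> j < length w \<and> w ! j"
  by (simp add: word_tape_def)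

text \<open>A counter can only be read by emptying it; it is poured into two others, one of which
  refills it.\<close>

lemma evaluates_var:
  assumes "\<rho> n < d"
  shows "\<exists>c T. evaluates U (\<lambda>w s. s n) \<rho> d c T"
proof -
  let ?x = "\<rho> n"
  let ?body = "Seq (dec ?x) (Seq (inc d) (inc (Suc d)))"
  let ?c = "Seq (while_pos ?x ?body) (move (Suc d) ?x)"
  have "runs ?c (cstate io r) (9 * N + 2) (cstate io (r(d := r ?x)))"
    if r: "\<forall>j\<ge>d. r j = 0" and N: "\<forall>j. r j \<le> N" for io r N
  proof -
    let ?R = "\<lambda>k. r(?x := r ?x - k, d := k, Suc d := k)"
    have 1: "runs (while_pos ?x ?body) (cstate io r) (r ?x * (3 + 2) + 1) (cstate io (?R (r ?x)))"
    proof (rule runs_while_pos[where R = ?R and IO = "\<lambda>_. io"])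
      fix k assume k: "k < r ?x"
      have "runs ?body (cstate io (?R k)) (1 + (1 + 1)) (cstate io (?R (Suc k)))"
        using k assms
        by (intro runs_Seq[OF runs_dec[OF _ refl] runs_Seq[OF runs_inc[OF refl] runs_inc]])
           (auto simp: fun_eq_iff)
      then show "runs ?body (cstate io (?R k)) 3 (cstate io (?R (Suc k)))" by (simp add: eval_nat_numeral)
    next
      have "r = ?R 0" using r by (auto simp: fun_eq_iff)
      then show "cstate io r = cstate io (?R 0)" by simp
    qed (use assms in auto)
    have 2: "runs (move (Suc d) ?x) (cstate io (?R (r ?x))) (r ?x * 4 + 1) (cstate io (r(d := r ?x)))"
      using runs_move[of "Suc d" ?x _ "?R (r ?x)" io] assms r by (auto simp: fun_eq_iff)
    show ?thesis
      by (rule runs_mono[OF runs_Seq[OF 1 2]]) (use N[rule_format, of ?x] in simp)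
  qed
  then have "evaluates U (\<lambda>w s. s n) \<rho> d ?c (\<lambda>N. 9 * N + 2)"
    unfolding evaluates_def by (auto intro!: polynomial_intros)
  then show ?thesis by blast
qed

lemma evaluates_const: "\<exists>c T. evaluates U (\<lambda>w s. n) \<rho> d c T"
proof -
  \<comment> \<open>\<open>Act 0 (\<lambda>s. s) 0\<close> changes nothing and serves as the program
    for 0.\<close>
  define c where "c = (rec_nat (Act 0 (\<lambda>s. s) 0) (\<lambda>_ c. Seq c (inc d)) n :: com)"
  have "well_formed c \<and> (\<forall>io r. r d = 0 \<longrightarrow> runs c (cstate io r) (1 + n) (cstate io (r(d := n))))"
    unfolding c_def
  proof (induction n)
    case 0
    have "runs (Act 0 (\<lambda>s. s) 0) (cstate io r) 1 (cstate io r)" for io r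
      by (rule runs_shift_word) auto
    then show ?case by (auto simp: fun_upd_idem)
  next
    case (Suc n)
    have "runs (Seq (rec_nat (Act 0 (\<lambda>s. s) 0) (\<lambda>_ c. Seq c (inc d)) n) (inc d)) (cstate io r)
        (1 + n + 1) (cstate io (r(d := Suc n)))" if "r d = 0" for io r
      using Suc that by (intro runs_Seq[OF _ runs_inc[of _ "r(d := n)"]]) (auto simp del: fun_upd_apply simp: fun_upd_same)
    then show ?case using Suc by (simp del: fun_upd_apply)
  qed
  then have "evaluates U (\<lambda>w s. n) \<rho> d c (\<lambda>N. 1 + n)"
    unfolding evaluates_def by (auto intro!: polynomial_intros)
  then show ?thesis by blast
qed

text \<open>The head finds the right end of the word by its blank; the way back is measured by the
  counter just obtained, whose value survives in \<open>Suc d\<close>.\<close>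

lemma evaluates_len:
  assumes "k \<in> U"
  shows "\<exists>c T. evaluates U (\<lambda>w s. length (w k)) \<rho> d c T"
proof -
  let ?fwd = "Seq (Act k (\<lambda>s. s) 1) (inc d)"
  let ?bwd = "Seq (dec d) (Seq (inc (Suc d)) (Act k (\<lambda>s. s) (- 1)))"
  let ?c = "Seq (WhileN k 0 ?fwd) (Seq (while_pos d ?bwd) (move (Suc d) d))"
  have "runs ?c (cstate io r) (13 * N + 3) (cstate io (r(d := length (w k))))"
    if "\<forall>k\<in>U. k < 2 \<and> io k = (0, word_tape (w k)) \<and> length (w k) \<le> N"
      and r: "\<forall>j\<ge>d. r j = 0" for io w r N
  proof -
    have k: "k < 2" "io k = (0, word_tape (w k))" "length (w k) \<le> N" using that(1) assms by auto
    let ?l = "length (w k)"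
    let ?io = "\<lambda>j::nat. io(k := (int j, word_tape (w k)))"
    have io: "?io 0 = io" using k by (auto simp: fun_eq_iff)
    let ?S = "\<lambda>j. cstate (?io j) (r(d := j))"
    have "runs (WhileN k 0 ?fwd) (?S 0) (?l * (2 + 2) + 1) (?S ?l)"
    proof (rule runs_WhileN)
      fix j assume "j < ?l"
      then show "scan (?S j) k \<noteq> 0" using k word_tape_nonblank[of "w k" j] by (simp add: scan_cstate_word)
      have "runs ?fwd (?S j) (1 + 1) (?S (Suc j))"
        using k by (intro runs_Seq[OF runs_shift_word[of k _ _ 1] runs_inc]) auto
      then show "runs ?fwd (?S j) 2 (?S (Suc j))" by (simp add: numeral_2_eq_2)
    next
      show "scan (?S ?l) k = 0" using k word_tape_nonblank[of "w k" ?l] by (simp add: scan_cstate_word)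
    qed
    moreover have "r(d := 0) = r" using r by (auto simp: fun_eq_iff)
    ultimately have 1: "runs (WhileN k 0 ?fwd) (cstate io r) (?l * (2 + 2) + 1) (?S ?l)"
      using io by simp
    let ?R = "\<lambda>j. r(d := ?l - j, Suc d := j)"
    have 2: "runs (while_pos d ?bwd) (?S ?l) (?l * (3 + 2) + 1) (cstate io (?R ?l))"
    proof (rule runs_while_pos[where R = ?R and IO = "\<lambda>j. ?io (?l - j)"])
      fix j assume j: "j < ?l"
      have "runs ?bwd (cstate (?io (?l - j)) (?R j)) (1 + (1 + 1)) (cstate (?io (?l - Suc j)) (?R (Suc j)))"
        using j k
        by (intro runs_Seq[OF runs_dec[OF _ refl] runs_Seq[OF runs_inc[OF refl]]]
              runs_Act)
           (auto simp: act_def cstate_def scan_def fun_eq_iff)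
      then show "runs ?bwd (cstate (?io (?l - j)) (?R j)) 3 (cstate (?io (?l - Suc j)) (?R (Suc j)))"
        by (simp add: eval_nat_numeral)
    next
      have "?R 0 = r(d := ?l)" using r by (auto simp: fun_eq_iff)
      then show "?S ?l = cstate (?io (?l - 0)) (?R 0)" by simp
    qed (use io in auto)
    have 3: "runs (move (Suc d) d) (cstate io (?R ?l)) (?l * 4 + 1) (cstate io (r(d := ?l)))"
      using runs_move[of "Suc d" d _ "?R ?l" io] r by (auto simp: fun_eq_iff)
    show ?thesis by (rule runs_mono[OF runs_Seq[OF 1 runs_Seq[OF 2 3]]]) (use k in simp)
  qed
  then have "evaluates U (\<lambda>w s. length (w k)) \<rho> d ?c (\<lambda>N. 13 * N + 3)"
    unfolding evaluates_def by (auto intro!: polynomial_intros)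
  then show ?thesis by blast
qed

text \<open>A position behind the end of the word shows a blank, which takes care of the range
  condition. The answer is set to 1 in advance and withdrawn, because \<open>IfN\<close> acts only
  on a symbol different from the given one.\<close>

lemma evaluates_bit:
  assumes k: "k \<in> U" and A: "evaluates U A \<rho> d c T" "polynomial V"
    "\<And>w s N. \<lbrakk>\<forall>k\<in>U. length (w k) \<le> N; \<forall>v. s v \<le> N\<rbrakk> \<Longrightarrow> A w s \<le> V N"
  shows "\<exists>c T. evaluates U (\<lambda>w s. of_bool (A w s < length (w k) \<and> w k ! A w s)) \<rho> d c T"
proof -
  let ?fwd = "Seq (dec d) (Seq (inc (Suc d)) (Act k (\<lambda>s. s) 1))"
  let ?bwd = "Seq (dec (Suc d)) (Act k (\<lambda>s. s) (- 1))"
  let ?c = "Seq c (Seq (while_pos d ?fwd) (Seq (inc d) (Seq (IfN k 2 (dec d)) (while_pos (Suc d) ?bwd))))"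
  let ?T = "\<lambda>N. T N + 9 * V N + 5"
  have "runs ?c (cstate io r) (?T N)
      (cstate io (r(d := of_bool (A w (\<lambda>v. r (\<rho> v)) < length (w k) \<and> w k ! A w (\<lambda>v. r (\<rho> v))))))"
    if U: "\<forall>k\<in>U. k < 2 \<and> io k = (0, word_tape (w k)) \<and> length (w k) \<le> N"
      and r: "\<forall>j\<ge>d. r j = 0" and N: "\<forall>j. r j \<le> N" for io w r N
  proof -
    let ?a = "A w (\<lambda>v. r (\<rho> v))"
    let ?b = "of_bool (?a < length (w k) \<and> w k ! ?a) :: nat"
    have a: "?a \<le> V N" using U N by (intro A(3)) auto
    have k: "k < 2" "io k = (0, word_tape (w k))" using U k by auto
    let ?io = "\<lambda>j::nat. io(k := (int j, word_tape (w k)))"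
    have io: "?io 0 = io" using k by (auto simp: fun_eq_iff)
    have 1: "runs c (cstate io r) (T N) (cstate io (r(d := ?a)))"
      by (rule evaluatesD[OF A(1)]) (use U r N in auto)
    let ?R = "\<lambda>j. r(d := ?a - j, Suc d := j)"
    have 2: "runs (while_pos d ?fwd) (cstate io (r(d := ?a))) (?a * (3 + 2) + 1) (cstate (?io ?a) (?R ?a))"
    proof (rule runs_while_pos[where R = ?R and IO = ?io])
      fix j assume j: "j < ?a"
      have "runs ?fwd (cstate (?io j) (?R j)) (1 + (1 + 1)) (cstate (?io (Suc j)) (?R (Suc j)))"
        using j k
        by (intro runs_Seq[OF runs_dec[OF _ refl] runs_Seq[OF runs_inc[OF refl]]] runs_Act)
           (auto simp: act_def cstate_def scan_def fun_eq_iff)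
      then show "runs ?fwd (cstate (?io j) (?R j)) 3 (cstate (?io (Suc j)) (?R (Suc j)))"
        by (simp add: eval_nat_numeral)
    next
      have "?R 0 = r(d := ?a)" using r by (auto simp: fun_eq_iff)
      then show "cstate io (r(d := ?a)) = cstate (?io 0) (?R 0)" using io by simp
    qed auto
    have 3: "runs (inc d) (cstate (?io ?a) (?R ?a)) 1 (cstate (?io ?a) (r(d := 1, Suc d := ?a)))"
      by (rule runs_inc) (auto simp: fun_eq_iff)
    have 4: "runs (IfN k 2 (dec d)) (cstate (?io ?a) (r(d := 1, Suc d := ?a))) (1 + 1)
       (cstate (?io ?a) (r(d := ?b, Suc d := ?a)))"
    proof (rule runs_IfN)
      assume "scan (cstate (?io ?a) (r(d := 1, Suc d := ?a))) k \<noteq> 2"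
      then have "?b = 0" using k word_tape_eq_2[of "w k" ?a] by (auto simp: scan_cstate_word)
      then show "runs (dec d) (cstate (?io ?a) (r(d := 1, Suc d := ?a))) 1 (cstate (?io ?a) (r(d := ?b, Suc d := ?a)))"
        by (intro runs_dec) (auto simp: fun_eq_iff)
    next
      assume "scan (cstate (?io ?a) (r(d := 1, Suc d := ?a))) k = 2"
      then have "?b = 1" using k word_tape_eq_2[of "w k" ?a] by (auto simp: scan_cstate_word)
      then show "cstate (?io ?a) (r(d := ?b, Suc d := ?a)) = cstate (?io ?a) (r(d := 1, Suc d := ?a))" by simp
    qed
    let ?Q = "\<lambda>j. r(d := ?b, Suc d := ?a - j)"
    have 5: "runs (while_pos (Suc d) ?bwd) (cstate (?io ?a) (r(d := ?b, Suc d := ?a))) (?a * (2 + 2) + 1)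
        (cstate io (r(d := ?b)))"
    proof (rule runs_while_pos[where R = ?Q and IO = "\<lambda>j. ?io (?a - j)"])
      fix j assume j: "j < ?a"
      have "runs ?bwd (cstate (?io (?a - j)) (?Q j)) (1 + 1) (cstate (?io (?a - Suc j)) (?Q (Suc j)))"
        using j k
        by (intro runs_Seq[OF runs_dec[OF _ refl]] runs_Act)
           (auto simp: act_def cstate_def scan_def fun_eq_iff)
      then show "runs ?bwd (cstate (?io (?a - j)) (?Q j)) 2 (cstate (?io (?a - Suc j)) (?Q (Suc j)))"
        by (simp add: eval_nat_numeral)
    next
      have "?Q ?a = r(d := ?b)" using r by (auto simp: fun_eq_iff)
      then show "cstate io (r(d := ?b)) = cstate (?io (?a - ?a)) (?Q ?a)" using io by simp
    qed auto
    show ?thesis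
      by (rule runs_mono[OF runs_Seq[OF 1 runs_Seq[OF 2 runs_Seq[OF 3 runs_Seq[OF 4 5]]]]]) (use a in simp)
  qed
  then have "evaluates U (\<lambda>w s. of_bool (A w s < length (w k) \<and> w k ! A w s)) \<rho> d ?c ?T"
    using A(1,2) unfolding evaluates_def by (auto intro!: polynomial_intros)
  then show ?thesis by blast
qed

text \<open>The first value stays in counter \<open>d\<close> during the second evaluation, so the
  bound on the counters grows to \<open>N + V N\<close>.\<close>

lemma evaluates_two:
  assumes A: "evaluates U A \<rho> d a S" "polynomial V"
    "\<And>w s N. \<lbrakk>\<forall>k\<in>U. length (w k) \<le> N; \<forall>v. s v \<le> N\<rbrakk> \<Longrightarrow> A w s \<le> V N"
    and B: "evaluates U B \<rho> (Suc d) b T" and \<rho>: "\<And>v. \<rho> v < d"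
    and U: "\<forall>k\<in>U. k < 2 \<and> io k = (0, word_tape (w k)) \<and> length (w k) \<le> N"
    and r: "\<forall>j\<ge>d. r j = 0" and N: "\<forall>j. r j \<le> N"
  shows "runs (Seq a b) (cstate io r) (S N + T (N + V N))
    (cstate io (r(d := A w (\<lambda>v. r (\<rho> v)), Suc d := B w (\<lambda>v. r (\<rho> v)))))"
proof (rule runs_Seq)
  let ?x = "A w (\<lambda>v. r (\<rho> v))"
  have x: "?x \<le> V N" using U N by (intro A(3)) auto
  show "runs a (cstate io r) (S N) (cstate io (r(d := ?x)))"
    by (rule evaluatesD[OF A(1)]) (use U r N in auto)
  show "runs b (cstate io (r(d := ?x))) (T (N + V N)) (cstate io (r(d := ?x, Suc d := B w (\<lambda>v. r (\<rho> v)))))"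
  proof (rule evaluatesD[OF B])
    have "(\<lambda>v. (r(d := ?x)) (\<rho> v)) = (\<lambda>v. r (\<rho> v))" using \<rho> by (auto simp: fun_eq_iff)
    then show "B w (\<lambda>v. r (\<rho> v)) = B w (\<lambda>v. (r(d := ?x)) (\<rho> v))" by simp
    show "(r(d := ?x)) j \<le> N + V N" for j using N x by (auto intro: trans_le_add1 trans_le_add2)
  qed (use U r in \<open>auto intro: trans_le_add1\<close>)
qed

lemma evaluates_plus:
  assumes A: "evaluates U A \<rho> d a S" "polynomial V"
    "\<And>w s N. \<lbrakk>\<forall>k\<in>U. length (w k) \<le> N; \<forall>v. s v \<le> N\<rbrakk> \<Longrightarrow> A w s \<le> V N"
    and B: "evaluates U B \<rho> (Suc d) b T" "polynomial W"
    "\<And>w s N. \<lbrakk>\<forall>k\<in>U. length (w k) \<le> N; \<forall>v. s v \<le> N\<rbrakk> \<Longrightarrow> B w s \<le> W N"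
    and \<rho>: "\<And>v. \<rho> v < d"
  shows "\<exists>c T. evaluates U (\<lambda>w s. A w s + B w s) \<rho> d c T"
proof -
  let ?c = "Seq (Seq a b) (move (Suc d) d)"
  let ?T = "\<lambda>N. S N + T (N + V N) + (4 * W N + 1)"
  have "runs ?c (cstate io r) (?T N) (cstate io (r(d := A w (\<lambda>v. r (\<rho> v)) + B w (\<lambda>v. r (\<rho> v)))))"
    if U: "\<forall>k\<in>U. k < 2 \<and> io k = (0, word_tape (w k)) \<and> length (w k) \<le> N"
      and r: "\<forall>j\<ge>d. r j = 0" and N: "\<forall>j. r j \<le> N" for io w r N
  proof -
    let ?x = "A w (\<lambda>v. r (\<rho> v))" and ?y = "B w (\<lambda>v. r (\<rho> v))"
    have y: "?y \<le> W N" using U N by (intro B(3)) auto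
    have 1: "runs (move (Suc d) d) (cstate io (r(d := ?x, Suc d := ?y))) (?y * 4 + 1) (cstate io (r(d := ?x + ?y)))"
      using runs_move[of "Suc d" d _ "r(d := ?x, Suc d := ?y)" io] r by (auto simp: fun_eq_iff)
    have "?y * 4 + 1 \<le> 4 * W N + 1" using y by simp
    then show ?thesis
      by (intro runs_mono[OF runs_Seq[OF evaluates_two[OF A B(1) \<rho> U r N] 1]] add_left_mono)
  qed
  then have "evaluates U (\<lambda>w s. A w s + B w s) \<rho> d ?c ?T"
    using A(1,2) B(1,2) unfolding evaluates_def by (auto intro!: polynomial_intros polynomial_comp[of T])
  then show ?thesis by blast
qed

lemma evaluates_minus:
  assumes A: "evaluates U A \<rho> d a S" "polynomial V"
    "\<And>w s N. \<lbrakk>\<forall>k\<in>U. length (w k) \<le> N; \<forall>v. s v \<le> N\<rbrakk> \<Longrightarrow> A w s \<le> V N"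
    and B: "evaluates U B \<rho> (Suc d) b T" "polynomial W"
    "\<And>w s N. \<lbrakk>\<forall>k\<in>U. length (w k) \<le> N; \<forall>v. s v \<le> N\<rbrakk> \<Longrightarrow> B w s \<le> W N"
    and \<rho>: "\<And>v. \<rho> v < d"
  shows "\<exists>c T. evaluates U (\<lambda>w s. A w s - B w s) \<rho> d c T"
proof -
  \<comment> \<open>Tape \<open>d + 2\<close> belongs to counter \<open>d\<close>, where the mark 1
    means zero: this test realises the truncation.\<close>
  let ?body = "Seq (dec (Suc d)) (IfN (Suc (Suc d)) 1 (dec d))"
  let ?c = "Seq (Seq a b) (while_pos (Suc d) ?body)"
  let ?T = "\<lambda>N. S N + T (N + V N) + (5 * W N + 1)"
  have "runs ?c (cstate io r) (?T N) (cstate io (r(d := A w (\<lambda>v. r (\<rho> v)) - B w (\<lambda>v. r (\<rho> v)))))"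
    if U: "\<forall>k\<in>U. k < 2 \<and> io k = (0, word_tape (w k)) \<and> length (w k) \<le> N"
      and r: "\<forall>j\<ge>d. r j = 0" and N: "\<forall>j. r j \<le> N" for io w r N
  proof -
    let ?x = "A w (\<lambda>v. r (\<rho> v))" and ?y = "B w (\<lambda>v. r (\<rho> v))"
    let ?R = "\<lambda>j. r(d := ?x - j, Suc d := ?y - j)"
    have y: "?y \<le> W N" using U N by (intro B(3)) auto
    have 1: "runs (while_pos (Suc d) ?body) (cstate io (r(d := ?x, Suc d := ?y))) (?y * (3 + 2) + 1)
        (cstate io (r(d := ?x - ?y)))"
    proof (rule runs_while_pos[where R = ?R and IO = "\<lambda>_. io"])
      fix j assume j: "j < ?y"
      have "runs ?body (cstate io (?R j)) (1 + (1 + 1)) (cstate io (?R (Suc j)))"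
      proof (rule runs_Seq)
        show "runs (dec (Suc d)) (cstate io (?R j)) 1 (cstate io (r(d := ?x - j, Suc d := ?y - Suc j)))"
          using j by (intro runs_dec) (auto simp: fun_eq_iff)
        have "r(d := ?x - j, Suc d := ?y - Suc j) = ?R (Suc j)" if "?x - j = 0"
          using that by (auto simp: fun_eq_iff)
        then show "runs (IfN (Suc (Suc d)) 1 (dec d)) (cstate io (r(d := ?x - j, Suc d := ?y - Suc j))) (1 + 1)
            (cstate io (?R (Suc j)))"
          by (intro runs_IfN) (auto intro!: runs_dec[simplified] simp: fun_eq_iff split: if_splits)
      qed
      then show "runs ?body (cstate io (?R j)) 3 (cstate io (?R (Suc j)))" by (simp add: eval_nat_numeral)
    next
      have "?R ?y = r(d := ?x - ?y)" using r by (auto simp: fun_eq_iff)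
      then show "cstate io (r(d := ?x - ?y)) = cstate io (?R ?y)" by simp
    qed auto
    have "?y * (3 + 2) + 1 \<le> 5 * W N + 1" using y by simp
    then show ?thesis
      by (intro runs_mono[OF runs_Seq[OF evaluates_two[OF A B(1) \<rho> U r N] 1]] add_left_mono)
  qed
  then have "evaluates U (\<lambda>w s. A w s - B w s) \<rho> d ?c ?T"
    using A(1,2) B(1,2) unfolding evaluates_def by (auto intro!: polynomial_intros polynomial_comp[of T])
  then show ?thesis by blast
qed

text \<open>Counter \<open>d\<close> accumulates the sum, \<open>d + 1\<close> counts the remaining
  rounds, \<open>d + 2\<close> holds the index and becomes stack variable 0 of the summand, and
  \<open>d + 3\<close> receives the value of the summand.\<close>

lemma evaluates_sum:
  assumes A: "evaluates U A \<rho> (Suc d) a S" "polynomial V"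
    "\<And>w s N. \<lbrakk>\<forall>k\<in>U. length (w k) \<le> N; \<forall>v. s v \<le> N\<rbrakk> \<Longrightarrow> A w s \<le> V N"
    and B: "evaluates U B (case_nat (d + 2) \<rho>) (d + 3) b T" "polynomial W"
    "\<And>w s N. \<lbrakk>\<forall>k\<in>U. length (w k) \<le> N; \<forall>v. s v \<le> N\<rbrakk> \<Longrightarrow> B w s \<le> W N"
    and \<rho>: "\<And>v. \<rho> v < d"
  shows "\<exists>c T. evaluates U (\<lambda>w s. \<Sum>i<A w s. B w (case_nat i s)) \<rho> d c T"
proof -
  let ?body = "Seq (dec (d + 1)) (Seq b (Seq (move (d + 3) d) (inc (d + 2))))"
  let ?c = "Seq a (Seq (while_pos (d + 1) ?body) (clear (d + 2)))"
  let ?N = "\<lambda>N. N + V N + V N * W (N + V N)"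
  let ?b = "\<lambda>N. 1 + (T (?N N) + ((4 * W (N + V N) + 1) + 1))"
  let ?T = "\<lambda>N. S N + (V N * (?b N + 2) + 1 + (3 * V N + 1))"
  have "runs ?c (cstate io r) (?T N)
      (cstate io (r(d := \<Sum>i<A w (\<lambda>v. r (\<rho> v)). B w (case_nat i (\<lambda>v. r (\<rho> v))))))"
    if U: "\<forall>k\<in>U. k < 2 \<and> io k = (0, word_tape (w k)) \<and> length (w k) \<le> N"
      and r: "\<forall>j\<ge>d. r j = 0" and N: "\<forall>j. r j \<le> N" for io w r N
  proof -
    let ?x = "A w (\<lambda>v. r (\<rho> v))"
    let ?y = "\<lambda>i. B w (case_nat i (\<lambda>v. r (\<rho> v)))"
    have x: "?x \<le> V N" using U N by (intro A(3)) auto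
    have y: "?y i \<le> W (N + V N)" if "i < ?x" for i
      using U N x that
      by (intro B(3)) (auto split: nat.split intro: trans_le_add1)
    have ysum: "(\<Sum>i<k. ?y i) \<le> V N * W (N + V N)" if "k \<le> ?x" for k
    proof -
      have "(\<Sum>i<k. ?y i) \<le> k * W (N + V N)"
        using sum_bounded_above[of "{..<k}" ?y "W (N + V N)"] y that by auto
      also have "\<dots> \<le> V N * W (N + V N)" using that x by simp
      finally show ?thesis .
    qed
    have 1: "runs a (cstate io r) (S N) (cstate io (r(d + 1 := ?x)))"
      unfolding Suc_eq_plus1[symmetric] by (rule evaluatesD[OF A(1)]) (use U r N in auto)
    let ?R = "\<lambda>k. r(d := \<Sum>i<k. ?y i, d + 1 := ?x - k, d + 2 := k)"
    have 2: "runs (while_pos (d + 1) ?body) (cstate io (r(d + 1 := ?x))) (?x * (?b N + 2) + 1) (cstate io (?R ?x))"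
    proof (rule runs_while_pos[where R = ?R and IO = "\<lambda>_. io"])
      fix k assume k: "k < ?x"
      let ?r1 = "r(d := \<Sum>i<k. ?y i, d + 1 := ?x - Suc k, d + 2 := k)"
      have a1: "runs (dec (d + 1)) (cstate io (?R k)) 1 (cstate io ?r1)"
        using k by (intro runs_dec) (auto simp: fun_eq_iff)
      have a2: "runs b (cstate io ?r1) (T (?N N)) (cstate io (?r1(d + 3 := ?y k)))"
      proof (rule evaluatesD[OF B(1)])
        have "(\<lambda>v. ?r1 (case_nat (d + 2) \<rho> v)) = case_nat k (\<lambda>v. r (\<rho> v))"
        proof
          fix v show "?r1 (case_nat (d + 2) \<rho> v) = case_nat k (\<lambda>v. r (\<rho> v)) v"
            using \<rho>[of "v - 1"] by (cases v) auto
        qed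
        then show "?y k = B w (\<lambda>v. ?r1 (case_nat (d + 2) \<rho> v))" by simp
        show "?r1 j \<le> ?N N" for j
          using k x N[rule_format, of j] ysum[of k] by auto
      qed (use U r in \<open>auto intro: trans_le_add1\<close>)
      have a3: "runs (move (d + 3) d) (cstate io (?r1(d + 3 := ?y k))) (4 * W (N + V N) + 1)
         (cstate io (?r1(d := \<Sum>i<Suc k. ?y i)))"
        using y[OF k] r
        by (intro runs_mono[OF runs_move[of "d + 3" d _ "?r1(d + 3 := ?y k)"]]) (auto simp: fun_eq_iff)
      have a4: "runs (inc (d + 2)) (cstate io (?r1(d := \<Sum>i<Suc k. ?y i))) 1 (cstate io (?R (Suc k)))"
        by (intro runs_inc) (auto simp: fun_eq_iff)
      show "runs ?body (cstate io (?R k)) (?b N) (cstate io (?R (Suc k)))"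
        by (rule runs_Seq[OF a1 runs_Seq[OF a2 runs_Seq[OF a3 a4]]])
    next
      have "r(d + 1 := ?x) = ?R 0" using r by (auto simp: fun_eq_iff)
      then show "cstate io (r(d + 1 := ?x)) = cstate io (?R 0)" by simp
    qed auto
    have 3: "runs (clear (d + 2)) (cstate io (?R ?x)) (?x * 3 + 1) (cstate io (r(d := \<Sum>i<?x. ?y i)))"
      using runs_clear[of _ "?R ?x" "d + 2" io] r by (auto simp: fun_eq_iff)
    have "?x * (?b N + 2) \<le> V N * (?b N + 2)" using x by (rule mult_le_mono1)
    then show ?thesis
      by (intro runs_mono[OF runs_Seq[OF 1 runs_Seq[OF 2 3]]]) (use x in linarith)
  qed
  moreover have "polynomial ?T"
    using A(1,2) B(1,2) unfolding evaluates_def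
    by (auto intro!: polynomial_intros polynomial_comp[of T] polynomial_comp[of W])
  ultimately have "evaluates U (\<lambda>w s. \<Sum>i<A w s. B w (case_nat i s)) \<rho> d ?c ?T"
    using A(1) B(1) unfolding evaluates_def by auto
  then show ?thesis by blast
qed

text \<open>The counter assignment \<open>\<rho>\<close> must be arbitrary in the induction, as each
  sum allocates a counter for its index variable.\<close>

theorem computable_evaluates:
  assumes "computable U F" and "\<And>v. \<rho> v < d"
  shows "\<exists>c T. evaluates U F \<rho> d c T"
  using assms
proof (induction arbitrary: \<rho> d)
  case (var n)
  then show ?case by (intro evaluates_var) auto
next
  case (const n)
  show ?case by (rule evaluates_const)
next
  case (len k)
  then show ?case by (intro evaluates_len)
next
  case (bit k A)
  obtain c T where "evaluates U A \<rho> d c T" using bit.IH bit.prems by blast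
  moreover obtain V where "polynomial V"
    and "\<And>w s N. \<lbrakk>\<forall>k\<in>U. length (w k) \<le> N; \<forall>v. s v \<le> N\<rbrakk> \<Longrightarrow> A w s \<le> V N"
    using computable_boundedE[OF bit.hyps(2)] by blast
  ultimately show ?case by (intro evaluates_bit[OF bit.hyps(1)])
next
  case (plus A B)
  obtain c T where "evaluates U A \<rho> d c T" using plus.IH(1) plus.prems by blast
  moreover obtain c' T' where "evaluates U B \<rho> (Suc d) c' T'"
    using plus.IH(2)[of \<rho> "Suc d"] plus.prems less_SucI by blast
  moreover obtain V where "polynomial V"
    and "\<And>w s N. \<lbrakk>\<forall>k\<in>U. length (w k) \<le> N; \<forall>v. s v \<le> N\<rbrakk> \<Longrightarrow> A w s \<le> V N"
    using computable_boundedE[OF plus.hyps(1)] by blast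
  moreover obtain W where "polynomial W"
    and "\<And>w s N. \<lbrakk>\<forall>k\<in>U. length (w k) \<le> N; \<forall>v. s v \<le> N\<rbrakk> \<Longrightarrow> B w s \<le> W N"
    using computable_boundedE[OF plus.hyps(2)] by blast
  ultimately show ?case using plus.prems by (intro evaluates_plus)
next
  case (minus A B)
  obtain c T where "evaluates U A \<rho> d c T" using minus.IH(1) minus.prems by blast
  moreover obtain c' T' where "evaluates U B \<rho> (Suc d) c' T'"
    using minus.IH(2)[of \<rho> "Suc d"] minus.prems less_SucI by blast
  moreover obtain V where "polynomial V"
    and "\<And>w s N. \<lbrakk>\<forall>k\<in>U. length (w k) \<le> N; \<forall>v. s v \<le> N\<rbrakk> \<Longrightarrow> A w s \<le> V N"
    using computable_boundedE[OF minus.hyps(1)] by blast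
  moreover obtain W where "polynomial W"
    and "\<And>w s N. \<lbrakk>\<forall>k\<in>U. length (w k) \<le> N; \<forall>v. s v \<le> N\<rbrakk> \<Longrightarrow> B w s \<le> W N"
    using computable_boundedE[OF minus.hyps(2)] by blast
  ultimately show ?case using minus.prems by (intro evaluates_minus)
next
  case (sum_stack A B)
  obtain c T where "evaluates U A \<rho> (Suc d) c T"
    using sum_stack.IH(1)[of \<rho> "Suc d"] sum_stack.prems less_SucI by blast
  moreover have "case_nat (d + 2) \<rho> v < d + 3" for v
    using sum_stack.prems[of "v - 1"] by (cases v) auto
  then obtain c' T' where "evaluates U B (case_nat (d + 2) \<rho>) (d + 3) c' T'"
    using sum_stack.IH(2) by blast
  moreover obtain V where "polynomial V"
    and "\<And>w s N. \<lbrakk>\<forall>k\<in>U. length (w k) \<le> N; \<forall>v. s v \<le> N\<rbrakk> \<Longrightarrow> A w s \<le> V N"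
    using computable_boundedE[OF sum_stack.hyps(1)] by blast
  moreover obtain W where "polynomial W"
    and "\<And>w s N. \<lbrakk>\<forall>k\<in>U. length (w k) \<le> N; \<forall>v. s v \<le> N\<rbrakk> \<Longrightarrow> B w s \<le> W N"
    using computable_boundedE[OF sum_stack.hyps(2)] by blast
  ultimately show ?case using sum_stack.prems by (intro evaluates_sum)
qed



section \<open>From programs to polynomial-time machines\<close>

fun marks :: "nat \<Rightarrow> com" where
  "marks 0 = Act 0 (\<lambda>s. s) 0"
| "marks (Suc j) = Seq (marks j) (Act (j + 2) (\<lambda>_. 1) 0)"

lemma marks_simps: "well_formed (marks j)" "tape_bound (marks j) \<le> j + 2"
  by (induction j) auto

lemma exec_marks:
  "exec (marks j) (h, T) (Suc j) (h, \<lambda>i. if 2 \<le> i \<and> i < j + 2 then (T i)(h i := 1) else T i)"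
proof (induction j)
  case 0
  have "(\<lambda>i. if 2 \<le> i \<and> i < 0 + 2 then (T i)(h i := 1) else T i) = T" by (auto simp: fun_eq_iff)
  then show ?case using exec_Act[of 0 "\<lambda>s. s" 0 "(h, T)"] by (simp add: act_def scan_def)
next
  case (Suc j)
  let ?T = "\<lambda>j i. if 2 \<le> i \<and> i < j + 2 then (T i)(h i := 1) else T i"
  have "act (j + 2) (\<lambda>_. 1) 0 (h, ?T j) = (h, ?T (Suc j))"
    by (auto simp: act_def scan_def fun_eq_iff)
  then have "exec (marks (Suc j)) (h, T) (Suc j + 1) (h, ?T (Suc j))"
    using exec_Seq[OF Suc.IH exec_Act[of "j + 2" "\<lambda>_. 1" 0 "(h, ?T j)"]] by simp
  then show ?case by simp
qed

text \<open>The last instruction turns counter \<open>x\<close> into the verdict: seeing the mark,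
  that is value 0, accepts.\<close>

definition program :: "com \<Rightarrow> nat \<Rightarrow> instr list" where
  "program c x = (let m = marks (max (tape_bound c) (Suc x)) in
     compile m 0 @ compile c (csize m) @
     [(x + 2, \<lambda>s. (s, 0, if s = 1 then csize m + csize c + 1 else csize m + csize c + 2))])"

definition program_machine :: "com \<Rightarrow> nat \<Rightarrow> tm" where
  "program_machine c x = machine (max (tape_bound c) (Suc x) + 2) (program c x)"

lemma length_program:
  "length (program c x) = csize (marks (max (tape_bound c) (Suc x))) + csize c + 1"
  by (simp add: program_def Let_def)

lemma turing_machine_program_machine:
  assumes "well_formed c"
  shows "turing_machine (program_machine c x)"
  unfolding program_machine_def
proof (rule turing_machine_machine)
  let ?J = "max (tape_bound c) (Suc x)"
  let ?m = "marks ?J"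
  fix I assume "I \<in> set (program c x)"
  then consider "I \<in> set (compile ?m 0)" | "I \<in> set (compile c (csize ?m))"
    | "I = (x + 2, \<lambda>s. (s, 0, if s = 1 then csize ?m + csize c + 1 else csize ?m + csize c + 2))"
    by (auto simp: program_def Let_def)
  then show "ok_instr (?J + 2) (length (program c x) + 2) I"
  proof cases
    case 1
    then show ?thesis
      using marks_simps[of ?J] by (intro ok_compile[of ?m _ 0]) (auto simp: length_program)
  next
    case 2
    then show ?thesis
      using assms by (intro ok_compile[of c _ "csize ?m"]) (auto simp: length_program)
  next
    case 3
    then show ?thesis by (auto simp: ok_instr_def length_program)
  qed
qed simp

lemma halted_run_stable:
  assumes "halted M (run M t ws)" and "t \<le> t'"
  shows "run M t' ws = run M t ws"
proof -
  have "(step M ^^ n) c = c" if "halted M c" for n c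
    using that by (induction n) (auto simp: step_def)
  then have "(step M ^^ (t' - t)) (run M t ws) = run M t ws" using assms(1) by blast
  moreover have "t' = (t' - t) + t" using assms(2) by simp
  ultimately show ?thesis unfolding run_def by (metis comp_apply funpow_add)
qed

lemma agree_cong:
  "agree K c \<sigma> \<Longrightarrow> (\<And>i. i < K \<Longrightarrow> snd \<sigma> i = snd \<sigma>' i \<and> fst \<sigma> i = fst \<sigma>' i) \<Longrightarrow> agree K c \<sigma>'"
  by (auto simp: agree_def)

text \<open>Serves verifiers through the final state and functions through tape 1. Writing the marks
  takes \<open>max (tape_bound c) (Suc x) + 1\<close> steps and the verdict one, whence the summand
  2.\<close>

lemma run_program_machine:
  assumes "runs c (cstate io (\<lambda>_. 0)) b (cstate io' r')"
    and io: "\<And>i. i < 2 \<Longrightarrow> io i = (0, word_tape (if i < length ws then ws ! i else []))"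
    and "length ws \<le> 2" and t: "b + max (tape_bound c) (Suc x) + 2 \<le> t"
  shows "halted (program_machine c x) (run (program_machine c x) t ws)"
    and "tape (run (program_machine c x) t ws) 1 = snd (io' 1)"
    and "state (run (program_machine c x) t ws) = accept (program_machine c x) \<longleftrightarrow> r' x = 0"
proof -
  let ?J = "max (tape_bound c) (Suc x)"
  let ?m = "marks ?J"
  let ?K = "?J + 2"
  let ?ins = "program c x"
  define M where "M = machine ?K ?ins"
  let ?I = "(x + 2, \<lambda>s. (s, 0, if s = 1 then csize ?m + csize c + 1 else csize ?m + csize c + 2)) :: instr"
  have ins: "?ins = compile ?m 0 @ compile c (csize ?m) @ [?I]" by (simp add: program_def Let_def)
  let ?c0 = "initial M ws"
  let ?T = "\<lambda>i. word_tape (if i < length ws then ws ! i else [])"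
  let ?T' = "\<lambda>i. if 2 \<le> i \<and> i < ?J + 2 then (?T i)(0 := 1) else ?T i"
  have c0: "state ?c0 = 0" "agree ?K ?c0 (\<lambda>_. 0, ?T)"
    by (auto simp: initial_def agree_def M_def machine_def)
  let ?c1 = "(step M ^^ Suc ?J) ?c0"
  have c1: "state ?c1 = csize ?m" "agree ?K ?c1 (\<lambda>_. 0, ?T')"
    using simulation[OF exec_marks[of ?J "\<lambda>_. 0" ?T], of ?K ?ins "[]" _ ?c0] marks_simps[of ?J] c0
    unfolding M_def ins by auto
  have "?T' i = snd (cstate io (\<lambda>_. 0)) i \<and> 0 = fst (cstate io (\<lambda>_. 0)) i" if "i < ?K" for i
    using that io[of i] assms(3) by (auto simp: cstate_def mark_def word_tape_def fun_eq_iff)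
  then have c1': "agree ?K ?c1 (cstate io (\<lambda>_. 0))"
    by (intro agree_cong[OF c1(2)]) simp
  obtain t1 where t1: "t1 \<le> b" "exec c (cstate io (\<lambda>_. 0)) t1 (cstate io' r')"
    using assms(1) by (auto simp: runs_def)
  let ?c2 = "(step M ^^ t1) ?c1"
  have c2: "state ?c2 = csize ?m + csize c" "agree ?K ?c2 (cstate io' r')"
  proof -
    have "?ins = compile ?m 0 @ compile c (length (compile ?m 0)) @ [?I]" by (simp add: ins)
    moreover have "state ?c1 = length (compile ?m 0)" by (simp only: c1(1) length_compile)
    moreover have "tape_bound c \<le> ?K" by simp
    ultimately have "state ?c2 = length (compile ?m 0) + csize c \<and> agree ?K ?c2 (cstate io' r')"
      using c1' unfolding M_def by (intro simulation[OF t1(2)])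
    then show "state ?c2 = csize ?m + csize c" "agree ?K ?c2 (cstate io' r')" by simp_all
  qed
  define c2 where "c2 = ?c2"
  have c2_state: "state c2 = csize ?m + csize c" and c2_agree: "agree ?K c2 (cstate io' r')"
    unfolding c2_def by (fact c2)+
  let ?c3 = "step M c2"
  have "state ?c3 = (if r' x = 0 then csize ?m + csize c + 1 else csize ?m + csize c + 2) \<and>
      agree ?K ?c3 (cstate io' r')"
    unfolding M_def
    by (rule step_test[of _ ?ins "x + 2" "snd ?I"])
       (use c2_state c2_agree in \<open>auto simp: length_program nth_append ins\<close>)
  moreover have "accept M = csize ?m + csize c + 1" "reject M = csize ?m + csize c + 2"
    by (simp_all add: M_def machine_def length_program)
  ultimately have c3: "halted M ?c3" "tape ?c3 1 = snd (io' 1)" "state ?c3 = accept M \<longleftrightarrow> r' x = 0"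
    by (auto simp: halted_def agree_def cstate_def split: if_splits)
  have "?c3 = run M (Suc (t1 + Suc ?J)) ws"
    unfolding run_def c2_def by (simp add: funpow_add funpow_swap1)
  moreover have "Suc (t1 + Suc ?J) \<le> t" using t t1(1) by simp
  ultimately have "run M t ws = ?c3" using halted_run_stable c3(1) by metis
  then show "halted (program_machine c x) (run (program_machine c x) t ws)"
    "tape (run (program_machine c x) t ws) 1 = snd (io' 1)"
    "state (run (program_machine c x) t ws) = accept (program_machine c x) \<longleftrightarrow> r' x = 0"
    using c3 unfolding program_machine_def M_def by simp_all
qed

theorem computable_verifier_NP:
  assumes "computable {0, 1} (\<lambda>w s. of_bool (V (w 0) (w 1)))" and "polynomial p"
    and L: "\<And>x. x \<in> L \<longleftrightarrow> (\<exists>y. length y \<le> p (length x) \<and> V x y)"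
  shows "L \<in> NP"
proof -
  \<comment> \<open>Complemented, since the value 0 is what the machine accepts.\<close>
  let ?F = "\<lambda>w s. 1 - of_bool (V (w 0) (w 1)) :: nat"
  have "computable {0, 1} ?F" by (intro computable.minus computable.const assms(1))
  \<comment> \<open>All stack variables are read from counter 0, which stays zero; the result goes
    to counter 1.\<close>
  then have "\<exists>c T. evaluates {0, 1} ?F (\<lambda>_. 0) 1 c T"
    by (rule computable_evaluates) simp
  then obtain c T where c: "evaluates {0, 1} ?F (\<lambda>_. 0) 1 c T" by blast
  have wf: "well_formed c" and T: "polynomial T" using c by (auto simp: evaluates_def)
  let ?M = "program_machine c 1"
  let ?r = "\<lambda>n. T (n + p n) + max (tape_bound c) 2 + 2"
  have "polynomial ?r"
    using T assms(2) by (auto intro!: polynomial_intros polynomial_comp[of T])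
  then obtain r where r: "\<And>n. ?r n = poly r n" by (auto simp: polynomial_def)
  obtain q where q: "\<And>n. p n = poly q n" using assms(2) by (auto simp: polynomial_def)
  have *: "halted ?M (run ?M (poly r (length x)) [x, y]) \<and>
      (state (run ?M (poly r (length x)) [x, y]) = accept ?M \<longleftrightarrow> V x y)"
    if y: "length y \<le> p (length x)" for x y
  proof -
    let ?w = "\<lambda>i. if i = 0 then x else if i = 1 then y else []"
    let ?io = "\<lambda>i::nat. (0::int, word_tape (?w i))"
    let ?v = "1 - of_bool (V x y) :: nat"
    have run: "runs c (cstate ?io (\<lambda>_. 0)) (T (length x + p (length x))) (cstate ?io ((\<lambda>_. 0)(1 := ?v)))"
      by (rule evaluatesD[OF c, of _ ?w]) (use y in auto)
    note M = run_program_machine[OF run, of "[x, y]" 1 "poly r (length x)"]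
    have "halted ?M (run ?M (poly r (length x)) [x, y])"
      by (rule M(1)) (auto simp: r[symmetric] less_2_cases_iff)
    moreover have "state (run ?M (poly r (length x)) [x, y]) = accept ?M \<longleftrightarrow> ((\<lambda>_::nat. 0)(1 := ?v)) 1 = 0"
      by (rule M(3)) (auto simp: r[symmetric] less_2_cases_iff)
    ultimately show ?thesis by simp
  qed
  show ?thesis
    unfolding NP_def mem_Collect_eq
  proof (intro exI conjI allI impI)
    show "turing_machine ?M" using wf by (rule turing_machine_program_machine)
    fix x y :: "bool list"
    assume "length y \<le> poly q (length x)"
    then show "halted ?M (run ?M (poly r (length x)) [x, y])" using *[of y x] q by simp
  next
    fix x
    show "x \<in> L \<longleftrightarrow> (\<exists>y. length y \<le> poly q (length x) \<and>
        state (run ?M (poly r (length x)) [x, y]) = accept ?M)"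
      using * L q by metis
  qed
qed

section \<open>Output of sequences of unary codes\<close>

definition emit :: "bool \<Rightarrow> com" where
  "emit b = Act 1 (\<lambda>_. if b then 2 else 1) 1"

lemma word_tape_snoc: "(word_tape out)(int (length out) := if b then 2 else 1) = word_tape (out @ [b])"
  by (auto simp: word_tape_def fun_eq_iff nth_append)

definition output_io :: "bool list \<Rightarrow> bool list \<Rightarrow> nat \<Rightarrow> int \<times> (int \<Rightarrow> nat)" where
  "output_io x out i = (if i = 0 then (0, word_tape x) else (int (length out), word_tape out))"

lemma runs_emit:
  assumes "out' = out @ [b]"
  shows "runs (emit b) (cstate (output_io x out) r) 1 (cstate (output_io x out') r)"
  unfolding emit_def assms
  by (rule runs_Act)
     (auto simp: act_def cstate_def scan_def output_io_def fun_eq_iff word_tape_snoc[symmetric])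

text \<open>Counter 0 stays zero, 1 counts the remaining codes, 2 is the index and 3 the number to
  be written. With \<open>U = {0}\<close>, the evaluation programs tolerate any content and head
  position of tape 1, which meanwhile collects the output.\<close>

theorem computable_unary_output:
  assumes "computable {0} m" and "computable {0} g"
  shows "polytime_computable
    (\<lambda>x. concat (map (\<lambda>j. unary (g (\<lambda>_. x) (\<lambda>_. j))) [0..<m (\<lambda>_. x) (\<lambda>_. 0)]))"
proof -
  obtain c S where c: "evaluates {0} m (\<lambda>_. 0) 1 c S"
    using computable_evaluates[OF assms(1), of "\<lambda>_. 0" 1] by auto
  obtain e T where e: "evaluates {0} g (\<lambda>_. 2) 3 e T"
    using computable_evaluates[OF assms(2), of "\<lambda>_. 2" 3] by auto
  obtain V where V: "polynomial V"
    "\<And>w s N. \<lbrakk>\<forall>k\<in>{0}. length (w k) \<le> N; \<forall>v. s v \<le> N\<rbrakk> \<Longrightarrow> m w s \<le> V N"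
    using computable_boundedE[OF assms(1)] by blast
  obtain W where W: "polynomial W"
    "\<And>w s N. \<lbrakk>\<forall>k\<in>{0}. length (w k) \<le> N; \<forall>v. s v \<le> N\<rbrakk> \<Longrightarrow> g w s \<le> W N"
    using computable_boundedE[OF assms(2)] by blast
  let ?trues = "while_pos 3 (Seq (dec 3) (emit True))"
  let ?body = "Seq (dec 1) (Seq e (Seq ?trues (Seq (emit False) (inc 2))))"
  let ?c = "Seq c (while_pos 1 ?body)"
  let ?N = "\<lambda>N. N + V N"
  let ?b = "\<lambda>N. 1 + (T (?N N) + (W (?N N) * (2 + 2) + 1 + (1 + 1)))"
  let ?R = "\<lambda>N. S N + (V N * (?b N + 2) + 1)"
  let ?p = "\<lambda>n. ?R n + max (tape_bound ?c) 1 + 2"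
  have pol: "polynomial S" "polynomial T" and wf: "well_formed c" "well_formed e"
    using c e by (auto simp: evaluates_def)
  have "polynomial ?p"
    using pol V(1) W(1)
    by (auto intro!: polynomial_intros polynomial_comp[of T] polynomial_comp[of W])
  then obtain p where p: "\<forall>n. ?p n = poly p n" unfolding polynomial_def by (rule exE)
  let ?M = "program_machine ?c 0"
  have "halted ?M (run ?M (poly p (length x)) [x]) \<and>
    tape (run ?M (poly p (length x)) [x]) 1 =
      word_tape (concat (map (\<lambda>j. unary (g (\<lambda>_. x) (\<lambda>_. j))) [0..<m (\<lambda>_. x) (\<lambda>_. 0)]))" for x
  proof -
    let ?w = "\<lambda>_::nat. x"
    let ?n = "length x"
    let ?io = "output_io x"
    let ?m = "m ?w (\<lambda>_. 0)"
    let ?g = "\<lambda>j. g ?w (\<lambda>_. j)"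
    let ?out = "\<lambda>k. concat (map (\<lambda>j. unary (?g j)) [0..<k])"
    let ?r = "\<lambda>k. (\<lambda>_::nat. 0::nat)(1 := ?m - k, 2 := k)"
    have m: "?m \<le> V ?n" by (rule V(2)) auto
    have 1: "runs c (cstate (?io []) (\<lambda>_. 0)) (S ?n) (cstate (?io []) ((\<lambda>_. 0)(1 := ?m)))"
      by (rule evaluatesD[OF c, of _ ?w]) (auto simp: output_io_def)
    have 2: "runs (while_pos 1 ?body) (cstate (?io []) ((\<lambda>_. 0)(1 := ?m))) (?m * (?b ?n + 2) + 1)
        (cstate (?io (?out ?m)) (?r ?m))"
    proof (rule runs_while_pos[where R = ?r and IO = "\<lambda>k. ?io (?out k)"])
      fix k assume k: "k < ?m"
      let ?r1 = "(\<lambda>_::nat. 0::nat)(1 := ?m - Suc k, 2 := k)"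
      let ?o1 = "\<lambda>j. ?out k @ replicate j True"
      have a1: "runs (dec 1) (cstate (?io (?out k)) (?r k)) 1 (cstate (?io (?out k)) ?r1)"
        using k by (intro runs_dec) (auto simp: fun_eq_iff)
      have a2: "runs e (cstate (?io (?out k)) ?r1) (T (?N ?n)) (cstate (?io (?out k)) (?r1(3 := ?g k)))"
        by (rule evaluatesD[OF e, of _ ?w]) (use k m in \<open>auto simp: output_io_def\<close>)
      have gk: "?g k \<le> W (?N ?n)" by (rule W(2)) (use k m in auto)
      have "runs ?trues (cstate (?io (?out k)) (?r1(3 := ?g k))) (?g k * (2 + 2) + 1)
          (cstate (?io (?o1 (?g k))) ?r1)"
      proof (rule runs_while_pos[where R = "\<lambda>j. ?r1(3 := ?g k - j)" and IO = "\<lambda>j. ?io (?o1 j)"])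
        fix j assume j: "j < ?g k"
        have "runs (Seq (dec 3) (emit True)) (cstate (?io (?o1 j)) (?r1(3 := ?g k - j))) (1 + 1)
            (cstate (?io (?o1 (Suc j))) (?r1(3 := ?g k - Suc j)))"
        proof (rule runs_Seq)
          show "runs (dec 3) (cstate (?io (?o1 j)) (?r1(3 := ?g k - j))) 1
              (cstate (?io (?o1 j)) (?r1(3 := ?g k - Suc j)))"
            using j by (intro runs_dec) (auto simp: fun_eq_iff)
          show "runs (emit True) (cstate (?io (?o1 j)) (?r1(3 := ?g k - Suc j))) 1
              (cstate (?io (?o1 (Suc j))) (?r1(3 := ?g k - Suc j)))"
            by (rule runs_emit) (simp add: replicate_append_same)
        qed
        then show "runs (Seq (dec 3) (emit True)) (cstate (?io (?o1 j)) (?r1(3 := ?g k - j))) 2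
            (cstate (?io (?o1 (Suc j))) (?r1(3 := ?g k - Suc j)))" by (simp add: numeral_2_eq_2)
      next
        have "?r1 = ?r1(3 := ?g k - ?g k)" by (auto simp: fun_eq_iff)
        then show "cstate (?io (?o1 (?g k))) ?r1 = cstate (?io (?o1 (?g k))) (?r1(3 := ?g k - ?g k))" by simp
      qed auto
      then have a3: "runs ?trues (cstate (?io (?out k)) (?r1(3 := ?g k))) (W (?N ?n) * (2 + 2) + 1)
          (cstate (?io (?o1 (?g k))) ?r1)"
        by (rule runs_mono) (use gk in simp)
      have a4: "runs (emit False) (cstate (?io (?o1 (?g k))) ?r1) 1 (cstate (?io (?out (Suc k))) ?r1)"
        by (rule runs_emit) (simp add: unary_def)
      have a5: "runs (inc 2) (cstate (?io (?out (Suc k))) ?r1) 1 (cstate (?io (?out (Suc k))) (?r (Suc k)))"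
        by (intro runs_inc) (auto simp: fun_eq_iff)
      show "runs ?body (cstate (?io (?out k)) (?r k)) (?b ?n) (cstate (?io (?out (Suc k))) (?r (Suc k)))"
        by (rule runs_Seq[OF a1 runs_Seq[OF a2 runs_Seq[OF a3 runs_Seq[OF a4 a5]]]])
    next
      have "(\<lambda>_. 0)(1 := ?m) = ?r 0" by (auto simp: fun_eq_iff)
      then show "cstate (?io []) ((\<lambda>_. 0)(1 := ?m)) = cstate (?io (?out 0)) (?r 0)" by simp
    qed auto
    have "?m * (?b ?n + 2) \<le> V ?n * (?b ?n + 2)" using m by (rule mult_le_mono1)
    then have run: "runs ?c (cstate (?io []) (\<lambda>_. 0)) (?R ?n) (cstate (?io (?out ?m)) (?r ?m))"
      by (intro runs_mono[OF runs_Seq[OF 1 2]] add_left_mono add_right_mono)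
    note M = run_program_machine[OF run, of "[x]" 0 "poly p ?n"]
    have "halted ?M (run ?M (poly p ?n) [x])"
      by (rule M(1)) (auto simp: p[rule_format, symmetric] less_2_cases_iff output_io_def)
    moreover have "tape (run ?M (poly p ?n) [x]) 1 = snd (?io (?out ?m) 1)"
      by (rule M(2)) (auto simp: p[rule_format, symmetric] less_2_cases_iff output_io_def)
    ultimately show ?thesis by (simp add: output_io_def)
  qed
  moreover have "turing_machine ?M"
    using wf by (intro turing_machine_program_machine) (simp add: emit_def)
  ultimately show ?thesis unfolding polytime_computable_def by blast
qed



section \<open>Closure properties of counter-computable functions\<close>

named_theorems computable_intros

lemmas [computable_intros] = computable.var computable.const computable.plus computable.minus computable.len

text \<open>Moving a term under a sum shifts its stack variables, which is the main use of this
  lemma. Under a binder the renaming \<open>g\<close> is itself lifted so as to fix variable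
  0.\<close>

lemma computable_rename:
  "computable U F \<Longrightarrow> computable U (\<lambda>w s. F w (\<lambda>i. s (g i)))"
proof (induction arbitrary: g rule: computable.induct)
  case (sum_stack A B)
  have "(\<lambda>j. case_nat i s (case_nat 0 (\<lambda>v. Suc (g v)) j)) = case_nat i (\<lambda>j. s (g j))" for i and s :: "nat \<Rightarrow> nat"
    by (auto split: nat.split)
  then show ?case
    using computable.sum_stack[OF sum_stack.IH(1)[of g] sum_stack.IH(2)[of "case_nat 0 (\<lambda>v. Suc (g v))"]]
    by simp
qed (auto intro: computable.intros)

text \<open>Named form of the sum rule: \<open>B\<close> takes the index as an argument, and the
  premise puts the top of the stack in its place. The rule thus applies to sums as they are
  ordinarily written.\<close>

lemma computable_sum [computable_intros]:
  assumes "computable U A" and "computable U (\<lambda>w s. B w (s 0) (\<lambda>i. s (Suc i)))"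
  shows "computable U (\<lambda>w s. \<Sum>i<A w s. B w i s)"
  using computable.sum_stack[OF assms] by simp

lemma computable_mult [computable_intros]:
  assumes "computable U A" and "computable U B"
  shows "computable U (\<lambda>w s. A w s * B w s)"
proof -
  have "computable U (\<lambda>w s. \<Sum>i<A w s. B w s)"
    by (intro computable_sum assms computable_rename[OF assms(2)])
  then show ?thesis by simp
qed

lemma computable_Suc [computable_intros]:
  "computable U A \<Longrightarrow> computable U (\<lambda>w s. Suc (A w s))"
  using computable.plus[OF computable.const[of U 1]] by simp

lemma computable_le [computable_intros]:
  assumes "computable U A" and "computable U B"
  shows "computable U (\<lambda>w s. of_bool (A w s \<le> B w s))"
proof -
  have "computable U (\<lambda>w s. 1 - (A w s - B w s))" by (intro computable_intros assms)
  moreover have "1 - (a - b) = of_bool (a \<le> b)" for a b :: nat by auto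
  ultimately show ?thesis by simp
qed

lemma computable_less [computable_intros]:
  "computable U A \<Longrightarrow> computable U B \<Longrightarrow> computable U (\<lambda>w s. of_bool (A w s < B w s))"
  unfolding less_eq_Suc_le by (intro computable_intros)

lemma computable_conj [computable_intros]:
  "computable U (\<lambda>w s. of_bool (P w s)) \<Longrightarrow> computable U (\<lambda>w s. of_bool (Q w s)) \<Longrightarrow>
   computable U (\<lambda>w s. of_bool (P w s \<and> Q w s))"
  unfolding of_bool_conj by (intro computable_intros)

lemma computable_not [computable_intros]:
  assumes "computable U (\<lambda>w s. of_bool (P w s))"
  shows "computable U (\<lambda>w s. of_bool (\<not> P w s))"
proof -
  have "computable U (\<lambda>w s. 1 - of_bool (P w s))" by (intro computable_intros assms)
  moreover have "1 - of_bool p = (of_bool (\<not> p) :: nat)" for p by simp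
  ultimately show ?thesis by simp
qed

lemma computable_disj [computable_intros]:
  assumes "computable U (\<lambda>w s. of_bool (P w s))" and "computable U (\<lambda>w s. of_bool (Q w s))"
  shows "computable U (\<lambda>w s. of_bool (P w s \<or> Q w s))"
proof -
  have "computable U (\<lambda>w s. of_bool (\<not> (\<not> P w s \<and> \<not> Q w s)))" by (intro computable_intros assms)
  then show ?thesis by simp
qed

lemma computable_imp [computable_intros]:
  "computable U (\<lambda>w s. of_bool (P w s)) \<Longrightarrow> computable U (\<lambda>w s. of_bool (Q w s)) \<Longrightarrow>
   computable U (\<lambda>w s. of_bool (P w s \<longrightarrow> Q w s))"
  unfolding imp_conv_disj by (intro computable_intros)

lemma computable_iff [computable_intros]:
  "computable U (\<lambda>w s. of_bool (P w s)) \<Longrightarrow> computable U (\<lambda>w s. of_bool (Q w s)) \<Longrightarrow>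
   computable U (\<lambda>w s. of_bool (P w s \<longleftrightarrow> Q w s))"
  unfolding iff_conv_conj_imp by (intro computable_intros)

lemma computable_eq [computable_intros]:
  "computable U A \<Longrightarrow> computable U B \<Longrightarrow> computable U (\<lambda>w s. of_bool (A w s = B w s))"
  for A B :: "(nat \<Rightarrow> bool list) \<Rightarrow> (nat \<Rightarrow> nat) \<Rightarrow> nat"
  unfolding order_eq_iff by (intro computable_intros)

lemma computable_all [computable_intros]:
  assumes "computable U A" and "computable U (\<lambda>w s. of_bool (P w (s 0) (\<lambda>i. s (Suc i))))"
  shows "computable U (\<lambda>w s. of_bool (\<forall>i<A w s. P w i s))"
proof -
  have "computable U (\<lambda>w s. of_bool ((\<Sum>i<A w s. of_bool (\<not> P w i s)) = (0::nat)))"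
    by (intro computable_intros assms)
  moreover have "(\<Sum>i<a. of_bool (\<not> Q i)) = (0::nat) \<longleftrightarrow> (\<forall>i<a. Q i)" for a :: nat and Q by auto
  ultimately show ?thesis by simp
qed

lemma computable_if [computable_intros]:
  assumes "computable U (\<lambda>w s. of_bool (P w s))" and "computable U A" and "computable U B"
  shows "computable U (\<lambda>w s. if P w s then A w s else B w s)"
proof -
  have "computable U (\<lambda>w s. of_bool (P w s) * A w s + of_bool (\<not> P w s) * B w s)"
    by (intro computable_intros assms)
  moreover have "of_bool p * a + of_bool (\<not> p) * b = (if p then a else b)" for p and a b :: nat by simp
  ultimately show ?thesis by simp
qed

lemma sum_of_bool_card: "(\<Sum>i<n. of_bool (P i)) = card {i. i < n \<and> P i}" for n :: nat
proof -
  have "{..<n} \<inter> {i. P i} = {i. i < n \<and> P i}" by auto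
  then show ?thesis by (simp add: sum_of_bool_eq)
qed

text \<open>The quotient counts the positive multiples of the divisor up to the dividend; the
  conjunct \<open>0 < B w s\<close> yields the value 0 for division by zero.\<close>

lemma computable_div [computable_intros]:
  assumes A: "computable U A" and B: "computable U B"
  shows "computable U (\<lambda>w s. A w s div B w s)"
proof -
  have "computable U (\<lambda>w s. \<Sum>i<A w s. of_bool (0 < B w s \<and> Suc i * B w s \<le> A w s))"
    by (intro computable_intros assms computable_rename[OF A] computable_rename[OF B])
  moreover have "(\<Sum>i<a. of_bool (0 < b \<and> Suc i * b \<le> a)) = a div b" for a b :: nat
  proof (cases "b = 0")
    case False
    then have "Suc i * b \<le> a \<longleftrightarrow> i < a div b" for i
      by (simp only: Suc_le_eq[symmetric] less_eq_div_iff_mult_less_eq neq0_conv)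
    moreover have "i < a" if "i < a div b" for i using that div_le_dividend less_le_trans by blast
    ultimately have "{i. i < a \<and> 0 < b \<and> Suc i * b \<le> a} = {..<a div b}" using False by auto
    moreover have "(\<Sum>i<a. of_bool (0 < b \<and> Suc i * b \<le> a)) = card {i. i < a \<and> 0 < b \<and> Suc i * b \<le> a}"
      by (rule sum_of_bool_card)
    ultimately show ?thesis by simp
  qed simp
  ultimately show ?thesis by simp
qed

lemma computable_mod [computable_intros]:
  assumes "computable U A" and "computable U B"
  shows "computable U (\<lambda>w s. A w s mod B w s)"
proof -
  have "computable U (\<lambda>w s. A w s - B w s * (A w s div B w s))" by (intro computable_intros assms)
  then show ?thesis by (simp only: minus_mult_div_eq_mod)
qed

text \<open>\<open>f\<close> is an arbitrary function: finitely many of its values are wired into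
  nested conditionals. This is how the transition function of a machine enters.\<close>

lemma computable_table:
  assumes "computable U A"
  shows "computable U (\<lambda>w s. if A w s < n then f (A w s) else 0)"
proof (induction n)
  case 0
  show ?case using computable.const[of U 0] by simp
next
  case (Suc n)
  have "computable U (\<lambda>w s. if A w s = n then f n else if A w s < n then f (A w s) else 0)"
    by (intro computable_intros Suc assms)
  moreover have "(if a = n then f n else if a < n then f a else 0) = (if a < Suc n then f a else 0)" for a
    by auto
  ultimately show ?case by simp
qed

lemma computable_poly [computable_intros]:
  assumes "computable U A"
  shows "computable U (\<lambda>w s. poly p (A w s))"
proof (induction p)
  case 0
  show ?case using computable.const[of U 0] by simp
next
  case (pCons c p)
  then show ?case by (simp, intro computable_intros assms)
qed


section \<open>Membership in NP\<close>

definition nth_bit :: "bool list \<Rightarrow> nat \<Rightarrow> bool" where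
  "nth_bit x j \<longleftrightarrow> j < length x \<and> x ! j"

lemma computable_nth_bit [computable_intros]:
  "k \<in> U \<Longrightarrow> computable U A \<Longrightarrow> computable U (\<lambda>w s. of_bool (nth_bit (w k) (A w s)))"
  unfolding nth_bit_def by (rule computable.bit)

definition falses :: "bool list \<Rightarrow> nat \<Rightarrow> nat" where
  "falses x j = (\<Sum>i<j. of_bool (\<not> nth_bit x i))"

text \<open>In a concatenation of unary codes, the \<open>i\<close>-th number is the number of those ones that are
  preceded by exactly \<open>i\<close> zeros.\<close>

definition code_nth :: "bool list \<Rightarrow> nat \<Rightarrow> nat" where
  "code_nth x i = (\<Sum>j<length x. of_bool (nth_bit x j \<and> falses x j = i))"

lemma computable_falses [computable_intros]:
  "k \<in> U \<Longrightarrow> computable U A \<Longrightarrow> computable U (\<lambda>w s. falses (w k) (A w s))"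
  unfolding falses_def by (intro computable_intros)

lemma computable_code_nth [computable_intros]:
  assumes "k \<in> U" and A: "computable U A"
  shows "computable U (\<lambda>w s. code_nth (w k) (A w s))"
  unfolding code_nth_def by (intro computable_intros assms computable_rename[OF A])

lemma nth_bit_Cons: "nth_bit (b # x) 0 = b" "nth_bit (b # x) (Suc j) = nth_bit x j"
  by (auto simp: nth_bit_def)

lemma falses_Cons: "falses x 0 = 0" "falses (b # x) (Suc j) = of_bool (\<not> b) + falses x j"
  by (simp_all add: falses_def sum.lessThan_Suc_shift nth_bit_Cons del: sum.lessThan_Suc)

lemma code_nth_Cons:
  "code_nth (True # x) i = of_bool (i = 0) + code_nth x i"
  "code_nth (False # x) 0 = 0" "code_nth (False # x) (Suc i) = code_nth x i"
  by (simp_all add: code_nth_def sum.lessThan_Suc_shift nth_bit_Cons falses_Cons del: sum.lessThan_Suc)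

lemma falses_unary: "falses (unary n @ x) (length (unary n @ x)) = Suc (falses x (length x))"
  by (induction n) (auto simp: unary_def falses_Cons)

lemma code_nth_unary: "code_nth (unary n @ x) 0 = n" "code_nth (unary n @ x) (Suc i) = code_nth x i"
  by (induction n) (auto simp: unary_def code_nth_Cons)

lemma falses_codes: "falses (concat (map unary ns)) (length (concat (map unary ns))) = length ns"
proof (induction ns)
  case (Cons n ns)
  then show ?case using falses_unary[of n "concat (map unary ns)"] by simp
qed (simp add: falses_Cons)

lemma code_nth_codes: "i < length ns \<Longrightarrow> code_nth (concat (map unary ns)) i = ns ! i"
proof (induction ns arbitrary: i)
  case (Cons n ns)
  then show ?case by (cases i) (auto simp: code_nth_unary)
qed simp

text \<open>Every zero closes a code, so only a trailing run of ones could spoil the decomposition.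
  Prepending a one lengthens the first code; prepending a zero adds a code of 0.\<close>

lemma codes_exist:
  "x = [] \<or> \<not> last x \<Longrightarrow> \<exists>ns. x = concat (map unary ns)"
proof (induction x)
  case Nil
  then show ?case by (intro exI[of _ "[]"]) simp
next
  case (Cons b x)
  then obtain ns where ns: "x = concat (map unary ns)" by (auto split: if_splits)
  show ?case
  proof (cases b)
    case True
    then have "x \<noteq> []" using Cons.prems by auto
    then obtain n ns' where "ns = n # ns'" using ns by (cases ns) auto
    then have "b # x = concat (map unary (Suc n # ns'))" using ns True by (simp add: unary_def)
    then show ?thesis by blast
  next
    case False
    then have "b # x = concat (map unary (0 # ns))" using ns by (simp add: unary_def)
    then show ?thesis by blast
  qed
qed

lemma concat_pairs_nth:
  "e < length es \<Longrightarrow> concat (map (\<lambda>(u, v). [u, v]) es) ! (2 * e) = fst (es ! e) \<and>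
     concat (map (\<lambda>(u, v). [u, v]) es) ! Suc (2 * e) = snd (es ! e)"
proof (induction es arbitrary: e)
  case (Cons a es)
  then show ?case by (cases e) (auto split: prod.splits)
qed simp

lemma length_concat_pairs [simp]: "length (concat (map (\<lambda>(u, v). [u, v]) es)) = 2 * length es"
  by (induction es) auto

lemma concat_pairs_exist: "even (length ys) \<Longrightarrow> \<exists>es. ys = concat (map (\<lambda>(u, v). [u, v]) es)"
proof (induction ys rule: induct_list012)
  case 1
  then show ?case by (intro exI[of _ "[]"]) simp
next
  case (3 a b ys)
  then obtain es where "ys = concat (map (\<lambda>(u, v). [u, v]) es)" by auto
  then show ?case by (intro exI[of _ "(a, b) # es"]) simp
qed simp

text \<open>\<open>LEAST\<close> says nothing unless some colouring exists; as edges are not loops,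
  an injective numbering of the finite set is one.\<close>

lemma chromatic_number_le_iff:
  assumes "finite S" and "\<forall>e\<in>E. card e = 2"
  shows "chromatic_number S E \<le> k \<longleftrightarrow> (\<exists>f. proper_coloring S E k f)"
proof
  obtain f :: "'a \<Rightarrow> nat" and n where f: "f ` S = {i. i < n}" "inj_on f S"
    using finite_imp_inj_to_nat_seg[OF assms(1)] by blast
  have "proper_coloring S E n f"
    unfolding proper_coloring_def
  proof (intro conjI ballI impI)
    show "f v < n" if "v \<in> S" for v using f(1) that by blast
    fix u v assume "u \<in> S" "v \<in> S" "{u, v} \<in> E"
    moreover then have "u \<noteq> v" using assms(2) by force
    ultimately show "f u \<noteq> f v" using f(2) by (auto dest: inj_onD)
  qed
  then have "\<exists>f. proper_coloring S E (chromatic_number S E) f"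
    unfolding chromatic_number_def by (rule LeastI[of "\<lambda>k. \<exists>f. proper_coloring S E k f", OF exI])
  moreover assume "chromatic_number S E \<le> k"
  ultimately show "\<exists>f. proper_coloring S E k f"
    unfolding proper_coloring_def by (meson less_le_trans)
next
  assume "\<exists>f. proper_coloring S E k f"
  then show "chromatic_number S E \<le> k" unfolding chromatic_number_def by (rule Least_le)
qed

definition small_classes :: "nat list \<Rightarrow> bool" where
  "small_classes ls \<longleftrightarrow> (\<forall>v<length ls. card {u. u < length ls \<and> ls ! u = ls ! v} \<le> 2)"

definition proper_edges :: "nat list \<Rightarrow> (nat \<times> nat) list \<Rightarrow> bool" where
  "proper_edges ls es \<longleftrightarrow> (\<forall>(u, v) \<in> set es. u < length ls \<and> v < length ls \<and> u \<noteq> v)"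

definition solves :: "nat list \<Rightarrow> (nat \<times> nat) list \<Rightarrow> (nat \<Rightarrow> bool) \<Rightarrow> (nat \<Rightarrow> bool) \<Rightarrow> bool" where
  "solves ls es sel col \<longleftrightarrow>
     (\<forall>v<length ls. card {u. u < length ls \<and> ls ! u = ls ! v \<and> sel u} = 1) \<and>
     (\<forall>(u, v) \<in> set es. \<not> (sel u \<and> sel v \<and> (col u \<longleftrightarrow> col v)))"

text \<open>Replaces sets by lists and predicates. The fibres of the labels always form a partition,
  so validity of the instance concerns the edges alone, and colours below 2 become truth
  values.\<close>

lemma PCP_restricted_iff:
  "x \<in> PCP_restricted 2 2 \<longleftrightarrow>
     (\<exists>ls es. x = pcp_word 2 ls es \<and> proper_edges ls es \<and> small_classes ls \<and> (\<exists>sel col. solves ls es sel col))"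
proof -
  have main: "pcp_instance V E P \<and> (\<forall>X\<in>P. card X \<le> 2) \<and> pcp_yes V E P 2 \<longleftrightarrow>
      proper_edges ls es \<and> small_classes ls \<and> (\<exists>sel col. solves ls es sel col)"
    if V: "V = {..<length ls}" and E: "E = {{u, v} | u v. (u, v) \<in> set es}"
      and P: "P = {{v \<in> V. ls ! v = l} | l. l \<in> set ls}" for V E P ls es
  proof -
    let ?n = "length ls"
    have P': "P = (\<lambda>v. {u. u < ?n \<and> ls ! u = ls ! v}) ` {..<?n}"
      unfolding P V by (force simp: in_set_conv_nth)
    have part: "partition_on V P"
      unfolding partition_on_def P' V by (auto simp: disjoint_def)
    have inst: "pcp_instance V E P \<longleftrightarrow> proper_edges ls es"
    proof -
      have "card {u, v} = 2 \<longleftrightarrow> u \<noteq> v" for u v :: nat by (cases "u = v") auto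
      moreover have "pcp_instance V E P \<longleftrightarrow> (\<forall>e\<in>E. e \<subseteq> V \<and> card e = 2)"
        using part by (simp add: pcp_instance_def simple_graph_def V)
      moreover have "\<dots> \<longleftrightarrow> (\<forall>(u, v)\<in>set es. {u, v} \<subseteq> V \<and> card {u, v} = 2)"
        unfolding E by blast
      ultimately show ?thesis by (simp add: proper_edges_def V)
    qed
    have small: "(\<forall>X\<in>P. card X \<le> 2) \<longleftrightarrow> small_classes ls"
      by (auto simp: P' small_classes_def)
    have yes: "pcp_yes V E P 2 \<longleftrightarrow> (\<exists>sel col. solves ls es sel col)" if pe: "proper_edges ls es"
    proof -
      have card2: "\<forall>e\<in>induced_edges E S. card e = 2" for S
        using pe by (auto simp: induced_edges_def E proper_edges_def)
      have "pcp_yes V E P 2 \<longleftrightarrow> (\<exists>S f. selection V P S \<and> proper_coloring S (induced_edges E S) 2 f)"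
        unfolding pcp_yes_def selection_def using chromatic_number_le_iff[OF _ card2] V
        by (meson finite_lessThan finite_subset)
      also have "\<dots> \<longleftrightarrow> (\<exists>sel col. solves ls es sel col)"
      proof safe
        fix S f assume S: "selection V P S" and f: "proper_coloring S (induced_edges E S) 2 f"
        have eq: "S \<inter> {u. u < ?n \<and> ls ! u = ls ! v} = {u. u < ?n \<and> ls ! u = ls ! v \<and> u \<in> S}" for v
          by auto
        have "solves ls es (\<lambda>u. u \<in> S) (\<lambda>u. f u = 0)"
          unfolding solves_def
        proof (intro conjI allI impI)
          fix v assume "v < ?n"
          then show "card {u. u < ?n \<and> ls ! u = ls ! v \<and> u \<in> S} = 1"
            using S unfolding selection_def P' eq[symmetric] by blast
        next
          show "\<forall>(u, v)\<in>set es. \<not> (u \<in> S \<and> v \<in> S \<and> (f u = 0 \<longleftrightarrow> f v = 0))"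
          proof clarify
            fix u v assume uv: "(u, v) \<in> set es" "u \<in> S" "v \<in> S" and ff: "f u = 0 \<longleftrightarrow> f v = 0"
            have "{u, v} \<in> induced_edges E S" using uv by (auto simp: induced_edges_def E)
            then have "f u \<noteq> f v" "f u < 2" "f v < 2" using f uv unfolding proper_coloring_def by blast+
            then show False using ff by linarith
          qed
        qed
        then show "\<exists>sel col. solves ls es sel col" by blast
      next
        fix sel col assume s: "solves ls es sel col"
        let ?S = "{u. u < ?n \<and> sel u}"
        have eq: "?S \<inter> {u. u < ?n \<and> ls ! u = ls ! v} = {u. u < ?n \<and> ls ! u = ls ! v \<and> sel u}" for v
          by auto
        have "selection V P ?S"
          unfolding selection_def P' V using s by (auto simp: solves_def eq)
        moreover have "proper_coloring ?S (induced_edges E ?S) 2 (\<lambda>u. of_bool (col u))"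
          using s by (auto simp: proper_coloring_def induced_edges_def E doubleton_eq_iff solves_def)
        ultimately show "\<exists>S f. selection V P S \<and> proper_coloring S (induced_edges E S) 2 f" by blast
      qed
      finally show ?thesis .
    qed
    show ?thesis using inst small yes by blast
  qed
  show ?thesis
  proof
    assume "x \<in> PCP_restricted 2 2"
    then obtain V E P where VEP: "pcp_encodes x V E P 2"
      "pcp_instance V E P \<and> (\<forall>X\<in>P. card X \<le> 2) \<and> pcp_yes V E P 2"
      unfolding PCP_restricted_def by blast
    from VEP(1) obtain ls es where x: "x = pcp_word 2 ls es" and enc: "V = {..<length ls}"
      "E = {{u, v} | u v. (u, v) \<in> set es}" "P = {{v \<in> V. ls ! v = l} | l. l \<in> set ls}"
      unfolding pcp_encodes_def by blast
    show "\<exists>ls es. x = pcp_word 2 ls es \<and> proper_edges ls es \<and> small_classes ls \<and>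
        (\<exists>sel col. solves ls es sel col)"
      using main[OF enc] VEP(2) x by blast
  next
    assume "\<exists>ls es. x = pcp_word 2 ls es \<and> proper_edges ls es \<and> small_classes ls \<and>
        (\<exists>sel col. solves ls es sel col)"
    then obtain ls es where x: "x = pcp_word 2 ls es"
      and s: "proper_edges ls es \<and> small_classes ls \<and> (\<exists>sel col. solves ls es sel col)" by blast
    have "pcp_encodes x {..<length ls} {{u, v} | u v. (u, v) \<in> set es}
       {{v \<in> {..<length ls}. ls ! v = l} | l. l \<in> set ls} 2"
      unfolding pcp_encodes_def using x by blast
    then show "x \<in> PCP_restricted 2 2"
      unfolding PCP_restricted_def using main[OF refl refl refl, of ls es] s by blast
  qed
qed

section \<open>A certificate check within the computable functions\<close>

definition code_count :: "bool list \<Rightarrow> nat" where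
  "code_count x = falses x (length x)"

text \<open>The final zero makes the word decompose into codes. There must be enough of them for the
  two leading numbers and the labels, which also keeps the truncated subtraction exact, and the rest
  must pair up into edges.\<close>

definition code_ok :: "bool list \<Rightarrow> bool" where
  "code_ok x \<longleftrightarrow> 0 < length x \<and> \<not> nth_bit x (length x - 1) \<and> 2 + code_nth x 0 \<le> code_count x \<and>
     code_nth x 1 = 2 \<and> (code_count x - 2 - code_nth x 0) mod 2 = 0"

text \<open>Bits \<open>2 * u\<close> and \<open>2 * u + 1\<close> of \<open>y\<close> are the
  selection and the colour of vertex \<open>u\<close>; missing bits count as false. Labels start at
  code 2 and edges at code \<open>2 + code_nth x 0\<close>.\<close>

definition verifier :: "bool list \<Rightarrow> bool list \<Rightarrow> bool" where
  "verifier x y \<longleftrightarrow> code_ok x \<and>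
     (\<forall>v<code_nth x 0.
        (\<Sum>u<code_nth x 0. of_bool (code_nth x (2 + u) = code_nth x (2 + v))) \<le> (2::nat) \<and>
        (\<Sum>u<code_nth x 0. of_bool (code_nth x (2 + u) = code_nth x (2 + v) \<and> nth_bit y (2 * u))) = (1::nat)) \<and>
     (\<forall>e<(code_count x - 2 - code_nth x 0) div 2.
        code_nth x (2 + code_nth x 0 + 2 * e) < code_nth x 0 \<and>
        code_nth x (3 + code_nth x 0 + 2 * e) < code_nth x 0 \<and>
        code_nth x (2 + code_nth x 0 + 2 * e) \<noteq> code_nth x (3 + code_nth x 0 + 2 * e) \<and>
        \<not> (nth_bit y (2 * code_nth x (2 + code_nth x 0 + 2 * e)) \<and>
           nth_bit y (2 * code_nth x (3 + code_nth x 0 + 2 * e)) \<and>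
           (nth_bit y (2 * code_nth x (2 + code_nth x 0 + 2 * e) + 1) \<longleftrightarrow>
            nth_bit y (2 * code_nth x (3 + code_nth x 0 + 2 * e) + 1))))"

lemma computable_verifier: "computable {0, 1} (\<lambda>w s. of_bool (verifier (w 0) (w 1)))"
  unfolding verifier_def code_ok_def code_count_def
  by (intro computable_intros insertI1 insertI2)

lemma code_ok_pcp_word:
  assumes "code_ok x"
  shows "\<exists>ls es. x = pcp_word 2 ls es"
proof -
  have "x \<noteq> []" "\<not> last x" using assms by (auto simp: code_ok_def nth_bit_def last_conv_nth)
  then obtain ns where ns: "x = concat (map unary ns)" using codes_exist by blast
  have cnt: "code_count x = length ns" unfolding code_count_def ns by (rule falses_codes)
  have len: "2 + code_nth x 0 \<le> length ns" using assms cnt by (simp add: code_ok_def)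
  then obtain a b ms where ms: "ns = a # b # ms" by (metis Suc_le_length_iff add_2_eq_Suc)
  have a: "code_nth x 0 = a" and b: "b = 2"
    using code_nth_codes[of 0 ns] code_nth_codes[of 1 ns] assms unfolding ns[symmetric]
    by (auto simp: ms code_ok_def)
  have "even (length (drop a ms))" using assms cnt a by (simp add: code_ok_def ms even_iff_mod_2_eq_zero)
  then obtain es where es: "drop a ms = concat (map (\<lambda>(u, v). [u, v]) es)" using concat_pairs_exist by blast
  have "ns = [length (take a ms), 2] @ take a ms @ concat (map (\<lambda>(u, v). [u, v]) es)"
    using len a b by (simp add: ms es[symmetric])
  then have "x = pcp_word 2 (take a ms) es" unfolding pcp_word_def ns by simp
  then show ?thesis by blast
qed

lemma verifier_pcp_word:
  assumes x: "x = pcp_word 2 ls es"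
  shows "verifier x y \<longleftrightarrow> proper_edges ls es \<and> small_classes ls \<and>
    solves ls es (\<lambda>u. nth_bit y (2 * u)) (\<lambda>u. nth_bit y (2 * u + 1))"
proof -
  let ?n = "length ls"
  let ?ns = "[?n, 2] @ ls @ concat (map (\<lambda>(u, v). [u, v]) es)"
  have x': "x = concat (map unary ?ns)" using x by (simp add: pcp_word_def)
  have nth: "code_nth x i = ?ns ! i" if "i < length ?ns" for i
    unfolding x' by (rule code_nth_codes[OF that])
  have cnt: "code_count x = 2 + ?n + 2 * length es"
    unfolding code_count_def x' falses_codes by simp
  have n: "code_nth x 0 = ?n" "code_nth x (Suc 0) = 2" using nth[of 0] nth[of 1] by auto
  have lab: "code_nth x (2 + u) = ls ! u" if "u < ?n" for u
    using nth[of "2 + u"] that by (simp add: nth_append)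
  have e1: "code_nth x (2 + ?n + 2 * e) = fst (es ! e)" if "e < length es" for e
    using nth[of "2 + ?n + 2 * e"] that concat_pairs_nth[OF that] by (simp add: nth_append)
  have e2: "code_nth x (3 + ?n + 2 * e) = snd (es ! e)" if "e < length es" for e
    using nth[of "3 + ?n + 2 * e"] that concat_pairs_nth[OF that] by (simp add: nth_append eval_nat_numeral)
  have "x \<noteq> []" "\<not> last x"
  proof -
    have "concat (map unary ns) \<noteq> [] \<and> \<not> last (concat (map unary ns))" if "ns \<noteq> []" for ns
      using that by (induction ns rule: rev_induct) (auto simp: unary_def)
    then show "x \<noteq> []" "\<not> last x" unfolding x' by blast+
  qed
  then have ok: "code_ok x" by (auto simp: code_ok_def nth_bit_def last_conv_nth cnt n)
  have sum1: "(\<Sum>u<?n. of_bool (code_nth x (2 + u) = code_nth x (2 + v))) = card {u. u < ?n \<and> ls ! u = ls ! v}"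
    if "v < ?n" for v
  proof -
    have "(\<Sum>u<?n. of_bool (code_nth x (2 + u) = code_nth x (2 + v))) = (\<Sum>u<?n. of_bool (ls ! u = ls ! v))"
      by (rule sum.cong) (use lab that in auto)
    also have "\<dots> = card {u. u < ?n \<and> ls ! u = ls ! v}"
      by (rule sum_of_bool_card)
    finally show ?thesis .
  qed
  have sum2: "(\<Sum>u<?n. of_bool (code_nth x (2 + u) = code_nth x (2 + v) \<and> nth_bit y (2 * u))) =
      card {u. u < ?n \<and> ls ! u = ls ! v \<and> nth_bit y (2 * u)}"
    if "v < ?n" for v
  proof -
    have "(\<Sum>u<?n. of_bool (code_nth x (2 + u) = code_nth x (2 + v) \<and> nth_bit y (2 * u))) =
        (\<Sum>u<?n. of_bool (ls ! u = ls ! v \<and> nth_bit y (2 * u)))"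
      by (rule sum.cong) (use lab that in auto)
    also have "\<dots> = card {u. u < ?n \<and> ls ! u = ls ! v \<and> nth_bit y (2 * u)}"
      by (rule sum_of_bool_card)
    finally show ?thesis .
  qed
  have edges: "(\<forall>(u, v)\<in>set es. Q u v) \<longleftrightarrow> (\<forall>e<length es. Q (fst (es ! e)) (snd (es ! e)))" for Q
    by (simp add: all_set_conv_all_nth case_prod_beta)
  have m: "(code_count x - 2 - ?n) div 2 = length es" by (simp add: cnt)
  have "verifier x y \<longleftrightarrow>
     (\<forall>v<?n. card {u. u < ?n \<and> ls ! u = ls ! v} \<le> 2 \<and> card {u. u < ?n \<and> ls ! u = ls ! v \<and> nth_bit y (2 * u)} = 1) \<and>
     (\<forall>e<length es. fst (es ! e) < ?n \<and> snd (es ! e) < ?n \<and> fst (es ! e) \<noteq> snd (es ! e) \<and>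
        \<not> (nth_bit y (2 * fst (es ! e)) \<and> nth_bit y (2 * snd (es ! e)) \<and>
           (nth_bit y (2 * fst (es ! e) + 1) \<longleftrightarrow> nth_bit y (2 * snd (es ! e) + 1))))"
    using ok unfolding verifier_def n m by (simp only: sum1 sum2 e1 e2 simp_thms cong: imp_cong)
  then show ?thesis
    unfolding proper_edges_def small_classes_def solves_def edges by blast
qed

theorem PCP_restricted_NP: "PCP_restricted 2 2 \<in> NP"
proof (rule computable_verifier_NP[OF computable_verifier])
  \<comment> \<open>Two bits per vertex; the number of vertices occurs in the word in unary and so
    is at most its length.\<close>
  show "polynomial (\<lambda>n. 2 * n)" by (intro polynomial_intros)
  fix x
  show "x \<in> PCP_restricted 2 2 \<longleftrightarrow> (\<exists>y. length y \<le> 2 * length x \<and> verifier x y)"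
  proof
    assume "x \<in> PCP_restricted 2 2"
    then obtain ls es sel col where x: "x = pcp_word 2 ls es" and s: "proper_edges ls es" "small_classes ls"
      "solves ls es sel col" unfolding PCP_restricted_iff by blast
    let ?n = "length ls"
    define z where "z = map (\<lambda>i. if even i then sel (i div 2) else col (i div 2)) [0..<2 * ?n]"
    have y: "nth_bit z (2 * u) = sel u" "nth_bit z (2 * u + 1) = col u" if "u < ?n" for u
      using that by (auto simp: nth_bit_def z_def)
    have "length z \<le> 2 * length x" by (simp add: z_def x pcp_word_def unary_def)
    moreover have "solves ls es (\<lambda>u. nth_bit z (2 * u)) (\<lambda>u. nth_bit z (2 * u + 1))"
      unfolding solves_def
    proof (intro conjI allI impI)
      fix v assume "v < ?n"
      moreover have "{u. u < ?n \<and> ls ! u = ls ! v \<and> nth_bit z (2 * u)} = {u. u < ?n \<and> ls ! u = ls ! v \<and> sel u}"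
        using y by auto
      ultimately show "card {u. u < ?n \<and> ls ! u = ls ! v \<and> nth_bit z (2 * u)} = 1"
        using s(3) by (simp add: solves_def)
    next
      show "\<forall>(u, v)\<in>set es. \<not> (nth_bit z (2 * u) \<and> nth_bit z (2 * v) \<and>
          (nth_bit z (2 * u + 1) \<longleftrightarrow> nth_bit z (2 * v + 1)))"
      proof clarify
        fix u v assume uv: "(u, v) \<in> set es" "nth_bit z (2 * u)" "nth_bit z (2 * v)"
          "nth_bit z (2 * u + 1) \<longleftrightarrow> nth_bit z (2 * v + 1)"
        have "u < ?n" "v < ?n" using s(1) uv(1) by (auto simp: proper_edges_def)
        then have "sel u \<and> sel v \<and> (col u \<longleftrightarrow> col v)" using uv(2-4) y by metis
        then show False using s(3) uv(1) unfolding solves_def by blast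
      qed
    qed
    ultimately show "\<exists>y. length y \<le> 2 * length x \<and> verifier x y"
      using verifier_pcp_word[OF x] s by blast
  next
    assume "\<exists>y. length y \<le> 2 * length x \<and> verifier x y"
    then obtain y where y: "verifier x y" by blast
    then obtain ls es where "x = pcp_word 2 ls es" using code_ok_pcp_word unfolding verifier_def by blast
    then show "x \<in> PCP_restricted 2 2"
      unfolding PCP_restricted_iff using verifier_pcp_word y by blast
  qed
qed



section \<open>From forbidden triples of literals to partition colouring\<close>

text \<open>The literals of the variable \<open>x\<close> are \<open>2 * x\<close> (negative) and \<open>2 * x + 1\<close> (positive).\<close>

definition holds :: "(nat \<Rightarrow> bool) \<Rightarrow> nat \<Rightarrow> bool" where
  "holds \<alpha> l \<longleftrightarrow> (odd l \<longleftrightarrow> \<alpha> (l div 2))"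

definition triples_satisfiable :: "nat \<Rightarrow> (nat \<Rightarrow> nat) \<Rightarrow> bool" where
  "triples_satisfiable m lit \<longleftrightarrow> (\<exists>\<alpha>. \<forall>c<m. \<exists>i<3. \<not> holds \<alpha> (lit (3 * c + i)))"

text \<open>The literals are the vertices below \<open>2 * n\<close>, and the two literals of a variable form a part.
  The \<open>k\<close>-th occurrence of a literal in a triple has three more vertices: \<open>s\<close> and \<open>t\<close>, which form a
  part, and \<open>z\<close>, which forms a part alone. The triangle of the literal, \<open>t\<close> and \<open>z\<close> forces \<open>s\<close> to be
  selected with the literal, and the three vertices \<open>s\<close> of a triple form a triangle.\<close>

definition gadget_label :: "nat \<Rightarrow> nat \<Rightarrow> nat" where
  "gadget_label n v =
     (if v < 2 * n then v div 2 else n + 2 * ((v - 2 * n) div 3) + ((v - 2 * n) mod 3) div 2)"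

text \<open>Occurrence \<open>k\<close> owns the edges \<open>4 * k\<close> to
  \<open>4 * k + 3\<close>: three for the triangle of the literal, \<open>t\<close> and
  \<open>z\<close>, and one joining its \<open>s\<close> to that of the cyclically next occurrence
  in the same triple. Arithmetic in the edge number keeps the list computable entry by
  entry.\<close>

definition edge_src :: "nat \<Rightarrow> (nat \<Rightarrow> nat) \<Rightarrow> nat \<Rightarrow> nat" where
  "edge_src n lit e =
     (if e mod 4 = 0 then lit (e div 4) else if e mod 4 = 1 then 2 * n + 3 * (e div 4) + 1
      else if e mod 4 = 2 then 2 * n + 3 * (e div 4) + 2 else 2 * n + 3 * (e div 4))"

definition edge_tgt :: "nat \<Rightarrow> (nat \<Rightarrow> nat) \<Rightarrow> nat \<Rightarrow> nat" where
  "edge_tgt n lit e =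
     (if e mod 4 = 0 then 2 * n + 3 * (e div 4) + 1 else if e mod 4 = 1 then 2 * n + 3 * (e div 4) + 2
      else if e mod 4 = 2 then lit (e div 4)
      else 2 * n + 3 * (3 * (e div 4 div 3) + (e div 4 + 1) mod 3))"

text \<open>A triple has three occurrences with three vertices and four edges each, which gives the
  factor 9 here and 12 for the edges.\<close>

definition gadget_labels :: "nat \<Rightarrow> nat \<Rightarrow> nat list" where
  "gadget_labels n m = map (gadget_label n) [0..<2 * n + 9 * m]"

definition gadget_edges :: "nat \<Rightarrow> nat \<Rightarrow> (nat \<Rightarrow> nat) \<Rightarrow> (nat \<times> nat) list" where
  "gadget_edges n m lit = map (\<lambda>e. (edge_src n lit e, edge_tgt n lit e)) [0..<12 * m]"

lemma div_mod_3: "(3 * k + 1) mod 3 = 1" "(3 * k + 2) mod 3 = 2" "(3 * k + 1) div 3 = k" "(3 * k + 2) div 3 = k"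
  for k :: nat
  by presburger+

lemma mod_3_cases:
  fixes v :: nat
  obtains q where "v = 3 * q" | q where "v = 3 * q + 1" | q where "v = 3 * q + 2"
proof -
  have "v = 3 * (v div 3) \<or> v = 3 * (v div 3) + 1 \<or> v = 3 * (v div 3) + 2" by presburger
  then show ?thesis using that by blast
qed

lemma length_gadget_labels [simp]: "length (gadget_labels n m) = 2 * n + 9 * m"
  by (simp add: gadget_labels_def)

lemma gadget_class_literal:
  "x < n \<Longrightarrow> gadget_label n u = x \<longleftrightarrow> u = 2 * x \<or> u = 2 * x + 1"
  unfolding gadget_label_def by auto

lemma gadget_class_st:
  "gadget_label n u = n + 2 * k \<longleftrightarrow> u = 2 * n + 3 * k \<or> u = 2 * n + 3 * k + 1"
proof (cases "u < 2 * n")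
  case False
  then obtain v where "u = 2 * n + v" using le_Suc_ex not_less by blast
  moreover have "2 * (v div 3) + v mod 3 div 2 = 2 * k \<longleftrightarrow> v = 3 * k \<or> v = 3 * k + 1"
  proof (cases v rule: mod_3_cases)
    case (1 q)
    then show ?thesis by auto
  next
    case (2 q)
    then show ?thesis by (simp only: div_mod_3) presburger
  next
    case (3 q)
    then show ?thesis by (simp only: div_mod_3) presburger
  qed
  ultimately show ?thesis by (simp add: gadget_label_def)
qed (auto simp: gadget_label_def)

lemma gadget_class_z:
  "gadget_label n u = n + 2 * k + 1 \<longleftrightarrow> u = 2 * n + 3 * k + 2"
proof (cases "u < 2 * n")
  case False
  then obtain v where "u = 2 * n + v" using le_Suc_ex not_less by blast
  moreover have "2 * (v div 3) + v mod 3 div 2 = 2 * k + 1 \<longleftrightarrow> v = 3 * k + 2"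
  proof (cases v rule: mod_3_cases)
    case (1 q)
    then show ?thesis by auto
  next
    case (2 q)
    then show ?thesis by (simp only: div_mod_3) presburger
  next
    case (3 q)
    then show ?thesis by (simp only: div_mod_3) presburger
  qed
  ultimately show ?thesis by (simp add: gadget_label_def)
qed (auto simp: gadget_label_def)

lemma gadget_vertex_cases:
  assumes "v < 2 * n + 9 * m"
  obtains (literal) x where "x < n" "gadget_label n v = x"
    | (st) k where "k < 3 * m" "gadget_label n v = n + 2 * k"
    | (z) k where "k < 3 * m" "gadget_label n v = n + 2 * k + 1"
proof (cases "v < 2 * n")
  case True
  then show ?thesis using literal[of "v div 2"] by (auto simp: gadget_label_def)
next
  case False
  define k where "k = (v - 2 * n) div 3"
  have k: "k < 3 * m" using assms False unfolding k_def by auto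
  have "(v - 2 * n) mod 3 < 3" by simp
  then have "(v - 2 * n) mod 3 div 2 = 0 \<or> (v - 2 * n) mod 3 div 2 = 1" by auto
  then show ?thesis using st[OF k] z[OF k] False by (auto simp: gadget_label_def k_def)
qed

lemma card_two_filter:
  "a \<noteq> b \<Longrightarrow> card {u. (u = a \<or> u = b) \<and> P u} = 1 \<longleftrightarrow> (P a \<longleftrightarrow> \<not> P b)"
proof -
  assume "a \<noteq> b"
  have "{u. (u = a \<or> u = b) \<and> P u} = (if P a then {a} else {}) \<union> (if P b then {b} else {})" by auto
  then show ?thesis using \<open>a \<noteq> b\<close> by simp
qed

lemma gadget_class:
  "{u. u < 2 * n + 9 * m \<and> gadget_labels n m ! u = gadget_labels n m ! v \<and> P u} =
   {u. u < 2 * n + 9 * m \<and> gadget_label n u = gadget_label n v \<and> P u}"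
  if "v < 2 * n + 9 * m"
  using that by (auto simp: gadget_labels_def)

lemma gadget_small_classes: "small_classes (gadget_labels n m)"
  unfolding small_classes_def
proof (intro allI impI)
  fix v assume "v < length (gadget_labels n m)"
  then have v: "v < 2 * n + 9 * m" by (simp add: gadget_labels_def)
  have sub: "card A \<le> 2" if "A \<subseteq> {a, b}" for A and a b :: nat
    using card_mono[OF _ that] card_insert_le_m1[of 2 "{b}" a] by force
  from v have "card {u. u < 2 * n + 9 * m \<and> gadget_label n u = gadget_label n v} \<le> 2"
  proof (cases rule: gadget_vertex_cases)
    case (literal x)
    show ?thesis
      unfolding literal(2) gadget_class_literal[OF literal(1)] by (rule sub[of _ "2 * x" "2 * x + 1"]) auto
  next
    case (st k)
    show ?thesis
      unfolding st(2) gadget_class_st by (rule sub[of _ "2 * n + 3 * k" "2 * n + 3 * k + 1"]) auto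
  next
    case (z k)
    have "{u. u < 2 * n + 9 * m \<and> gadget_label n u = gadget_label n v} \<subseteq> {2 * n + 3 * k + 2, 0}"
      unfolding z(2) gadget_class_z by auto
    then show ?thesis by (rule sub)
  qed
  then show "card {u. u < length (gadget_labels n m) \<and> gadget_labels n m ! u = gadget_labels n m ! v} \<le> 2"
    using gadget_class[OF v, of "\<lambda>_. True"] by simp
qed

lemma gadget_selection_iff:
  "(\<forall>v<length (gadget_labels n m). card {u. u < length (gadget_labels n m) \<and>
      gadget_labels n m ! u = gadget_labels n m ! v \<and> sel u} = 1) \<longleftrightarrow>
   (\<forall>x<n. sel (2 * x) \<longleftrightarrow> \<not> sel (2 * x + 1)) \<and>
   (\<forall>k<3 * m. (sel (2 * n + 3 * k) \<longleftrightarrow> \<not> sel (2 * n + 3 * k + 1)) \<and> sel (2 * n + 3 * k + 2))"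
  (is "?L \<longleftrightarrow> ?R")
proof -
  let ?N = "2 * n + 9 * m"
  let ?c = "\<lambda>l. card {u. u < ?N \<and> gadget_label n u = l \<and> sel u}"
  have lit_card: "?c x = 1 \<longleftrightarrow> (sel (2 * x) \<longleftrightarrow> \<not> sel (2 * x + 1))" if "x < n" for x
  proof -
    have "{u. u < ?N \<and> gadget_label n u = x \<and> sel u} = {u. (u = 2 * x \<or> u = 2 * x + 1) \<and> sel u}"
      using that by (auto simp: gadget_class_literal)
    then show ?thesis by (simp only: card_two_filter)
  qed
  have st_card: "?c (n + 2 * k) = 1 \<longleftrightarrow> (sel (2 * n + 3 * k) \<longleftrightarrow> \<not> sel (2 * n + 3 * k + 1))" if "k < 3 * m" for k
  proof -
    have "{u. u < ?N \<and> gadget_label n u = n + 2 * k \<and> sel u} =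
        {u. (u = 2 * n + 3 * k \<or> u = 2 * n + 3 * k + 1) \<and> sel u}"
      using that unfolding gadget_class_st by auto
    then show ?thesis by (simp only: card_two_filter)
  qed
  have z_card: "?c (n + 2 * k + 1) = 1 \<longleftrightarrow> sel (2 * n + 3 * k + 2)" if "k < 3 * m" for k
  proof -
    have "{u. u < ?N \<and> gadget_label n u = n + 2 * k + 1 \<and> sel u} =
        (if sel (2 * n + 3 * k + 2) then {2 * n + 3 * k + 2} else {})"
      using that unfolding gadget_class_z by auto
    then show ?thesis by simp
  qed
  have "?L \<longleftrightarrow> (\<forall>v<?N. ?c (gadget_label n v) = 1)"
    unfolding length_gadget_labels by (intro all_cong) (simp only: gadget_class)
  also have "\<dots> \<longleftrightarrow> ?R"
  proof
    assume L: "\<forall>v<?N. ?c (gadget_label n v) = 1"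
    show ?R
    proof (intro conjI allI impI)
      fix x assume x: "x < n"
      then have "gadget_label n (2 * x) = x" by (simp add: gadget_class_literal)
      then show "sel (2 * x) \<longleftrightarrow> \<not> sel (2 * x + 1)"
        using L[rule_format, of "2 * x"] lit_card[OF x] x by simp
    next
      fix k assume k: "k < 3 * m"
      have "gadget_label n (2 * n + 3 * k) = n + 2 * k" by (simp add: gadget_class_st)
      then show "sel (2 * n + 3 * k) \<longleftrightarrow> \<not> sel (2 * n + 3 * k + 1)"
        using L[rule_format, of "2 * n + 3 * k"] st_card[OF k] k by simp
      have "gadget_label n (2 * n + 3 * k + 2) = n + 2 * k + 1" unfolding gadget_class_z ..
      then show "sel (2 * n + 3 * k + 2)"
        using L[rule_format, of "2 * n + 3 * k + 2"] z_card[OF k] k by simp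
    qed
  next
    assume R: ?R
    show "\<forall>v<?N. ?c (gadget_label n v) = 1"
    proof (intro allI impI)
      fix v assume "v < ?N"
      then show "?c (gadget_label n v) = 1"
      proof (cases rule: gadget_vertex_cases)
        case (literal x)
        then show ?thesis using lit_card[of x] R by blast
      next
        case (st k)
        then show ?thesis using st_card[of k] R by simp
      next
        case (z k)
        then show ?thesis using z_card[of k] R by simp
      qed
    qed
  qed
  finally show ?thesis .
qed

lemma gadget_edges_iff:
  "(\<forall>(u, v)\<in>set (gadget_edges n m lit). Q u v) \<longleftrightarrow>
   (\<forall>k<3 * m. Q (lit k) (2 * n + 3 * k + 1) \<and> Q (2 * n + 3 * k + 1) (2 * n + 3 * k + 2) \<and>
      Q (2 * n + 3 * k + 2) (lit k) \<and> Q (2 * n + 3 * k) (2 * n + 3 * (3 * (k div 3) + (k + 1) mod 3)))"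
  (is "?L \<longleftrightarrow> (\<forall>k<3 * m. ?R k)")
proof -
  have "?L \<longleftrightarrow> (\<forall>e<12 * m. Q (edge_src n lit e) (edge_tgt n lit e))"
    by (auto simp: gadget_edges_def)
  also have "\<dots> \<longleftrightarrow> (\<forall>k<3 * m. \<forall>j<4. Q (edge_src n lit (4 * k + j)) (edge_tgt n lit (4 * k + j)))"
  proof safe
    fix e assume *: "\<forall>k<3 * m. \<forall>j<4. Q (edge_src n lit (4 * k + j)) (edge_tgt n lit (4 * k + j))" and "e < 12 * m"
    then have "e div 4 < 3 * m" by auto
    with *[rule_format, of "e div 4" "e mod 4"] show "Q (edge_src n lit e) (edge_tgt n lit e)" by simp
  qed auto
  also have "\<dots> \<longleftrightarrow> (\<forall>k<3 * m. ?R k)"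
  proof -
    have "(\<forall>j<4. Q (edge_src n lit (4 * k + j)) (edge_tgt n lit (4 * k + j))) \<longleftrightarrow> ?R k" for k
    proof -
      have "(\<forall>j<4. P j) \<longleftrightarrow> P 0 \<and> P 1 \<and> P 2 \<and> P 3" for P :: "nat \<Rightarrow> bool"
        by (auto simp: numeral_eq_Suc less_Suc_eq)
      moreover have "(4 * k + 1) div 4 = k" "(4 * k + 2) div 4 = k" "(4 * k + 3) div 4 = k"
        "(4 * k + 1) mod 4 = 1" "(4 * k + 2) mod 4 = 2" "(4 * k + 3) mod 4 = 3" by presburger+
      ultimately show ?thesis by (simp add: edge_src_def edge_tgt_def)
    qed
    then show ?thesis by simp
  qed
  finally show ?thesis .
qed

lemma gadget_proper_edges:
  assumes "\<And>k. k < 3 * m \<Longrightarrow> lit k < 2 * n"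
  shows "proper_edges (gadget_labels n m) (gadget_edges n m lit)"
proof -
  have "3 * (k div 3) + (k + 1) mod 3 < 3 * m \<and> 3 * (k div 3) + (k + 1) mod 3 \<noteq> k" if "k < 3 * m" for k
    using that by presburger
  then show ?thesis
    unfolding proper_edges_def gadget_edges_iff using assms
    by (fastforce simp: gadget_labels_def)
qed

text \<open>A solution yields an assignment through the selected positive literals; a violated
  triple would select a triangle of copies. Conversely, \<open>t\<close> is selected just for the
  literals that fail, so no literal triangle is selected as a whole, and of the copies of a triple
  at least one is missing, which leaves them colourable.\<close>

theorem gadget_correct:
  assumes lit: "\<And>k. k < 3 * m \<Longrightarrow> lit k < 2 * n"
  shows "pcp_word 2 (gadget_labels n m) (gadget_edges n m lit) \<in> PCP_restricted 2 2 \<longleftrightarrow>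
    triples_satisfiable m lit"
proof -
  let ?s = "\<lambda>k. 2 * n + 3 * k" and ?t = "\<lambda>k. 2 * n + 3 * k + 1" and ?z = "\<lambda>k. 2 * n + 3 * k + 2"
  let ?next = "\<lambda>k. 3 * (k div 3) + (k + 1) mod 3"
  have "(\<exists>sel col. solves (gadget_labels n m) (gadget_edges n m lit) sel col) \<longleftrightarrow> triples_satisfiable m lit"
    (is "?A \<longleftrightarrow> ?B")
  proof
    assume ?A
    then obtain sel col where
      sel: "\<And>x. x < n \<Longrightarrow> sel (2 * x) \<longleftrightarrow> \<not> sel (2 * x + 1)"
        "\<And>k. k < 3 * m \<Longrightarrow> (sel (?s k) \<longleftrightarrow> \<not> sel (?t k)) \<and> sel (?z k)"
      and col: "\<And>k. k < 3 * m \<Longrightarrow>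
          \<not> (sel (lit k) \<and> sel (?t k) \<and> (col (lit k) \<longleftrightarrow> col (?t k))) \<and>
          \<not> (sel (?t k) \<and> sel (?z k) \<and> (col (?t k) \<longleftrightarrow> col (?z k))) \<and>
          \<not> (sel (?z k) \<and> sel (lit k) \<and> (col (?z k) \<longleftrightarrow> col (lit k))) \<and>
          \<not> (sel (?s k) \<and> sel (?s (?next k)) \<and> (col (?s k) \<longleftrightarrow> col (?s (?next k))))"
      unfolding solves_def gadget_selection_iff gadget_edges_iff by blast
    let ?\<alpha> = "\<lambda>x. sel (2 * x + 1)"
    have "\<exists>i<3. \<not> holds ?\<alpha> (lit (3 * c + i))" if c: "c < m" for c
    proof (rule ccontr)
      assume "\<not> (\<exists>i<3. \<not> holds ?\<alpha> (lit (3 * c + i)))"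
      then have all: "holds ?\<alpha> (lit (3 * c + i))" if "i < 3" for i using that by blast
      have s: "sel (?s (3 * c + i))" if i: "i < 3" for i
      proof -
        let ?k = "3 * c + i"
        have k: "?k < 3 * m" using c i by simp
        have "lit ?k div 2 < n" using lit[OF k] by auto
        then have "sel (lit ?k)"
          using sel(1)[of "lit ?k div 2"] all[OF i] unfolding holds_def
          by (metis even_two_times_div_two odd_two_times_div_two_succ)
        then show ?thesis using sel(2)[OF k] col[OF k] by blast
      qed
      have "?next (3 * c + 0) = 3 * c + 1" "?next (3 * c + 1) = 3 * c + 2" "?next (3 * c + 2) = 3 * c + 0"
        by presburger+
      then show False
        using s[of 0] s[of 1] s[of 2] col[of "3 * c + 0"] col[of "3 * c + 1"] col[of "3 * c + 2"] c
        by auto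
    qed
    then show ?B unfolding triples_satisfiable_def by blast
  next
    assume ?B
    then obtain \<alpha> where \<alpha>: "\<And>c. c < m \<Longrightarrow> \<exists>i<3. \<not> holds \<alpha> (lit (3 * c + i))"
      unfolding triples_satisfiable_def by blast
    define sel where "sel u = (if u < 2 * n then holds \<alpha> u
      else if (u - 2 * n) mod 3 = 0 then holds \<alpha> (lit ((u - 2 * n) div 3))
      else if (u - 2 * n) mod 3 = 1 then \<not> holds \<alpha> (lit ((u - 2 * n) div 3))
      else True)" for u
    \<comment> \<open>Literals and \<open>t\<close> get one colour, \<open>z\<close> the other. In a
      triple the first two copies differ. The third has to differ from the first if that one is
      selected, in which case the second and third are not both selected; otherwise it has to differ
      from the second.\<close>
    define col where "col u = (if u < 2 * n then False
      else if (u - 2 * n) mod 3 = 0 then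
        (let k = (u - 2 * n) div 3 in
         if k mod 3 = 0 then True else if k mod 3 = 1 then False else \<not> holds \<alpha> (lit (3 * (k div 3))))
      else (u - 2 * n) mod 3 = 2)" for u
    have selx: "sel (?s k) \<longleftrightarrow> holds \<alpha> (lit k)" "sel (?t k) \<longleftrightarrow> \<not> holds \<alpha> (lit k)" "sel (?z k)" for k
      using div_mod_3[of k] by (simp_all add: sel_def)
    have sell: "sel u \<longleftrightarrow> holds \<alpha> u" if "u < 2 * n" for u using that by (simp add: sel_def)
    have coll: "\<not> col u" if "u < 2 * n" for u using that by (simp add: col_def)
    have colt: "\<not> col (?t k)" "col (?z k)" for k using div_mod_3[of k] by (simp_all add: col_def)
    have cols: "col (?s (3 * c + 0))" "\<not> col (?s (3 * c + 1))"
      "col (?s (3 * c + 2)) \<longleftrightarrow> \<not> holds \<alpha> (lit (3 * c + 0))" for c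
      using div_mod_3[of c] by (simp_all add: col_def Let_def)
    have tri: "\<not> (sel (?s k) \<and> sel (?s (?next k)) \<and> (col (?s k) \<longleftrightarrow> col (?s (?next k))))" if "k < 3 * m" for k
    proof -
      define c where "c = k div 3"
      have c: "c < m" using that by (auto simp: c_def)
      have nx: "?next (3 * c + 0) = 3 * c + 1" "?next (3 * c + 1) = 3 * c + 2" "?next (3 * c + 2) = 3 * c + 0"
        by presburger+
      have nh: "\<not> (holds \<alpha> (lit (3 * c + 0)) \<and> holds \<alpha> (lit (3 * c + 1)) \<and> holds \<alpha> (lit (3 * c + 2)))"
        using \<alpha>[OF c] by (auto simp: numeral_3_eq_3 less_Suc_eq numeral_2_eq_2)
      have "k = 3 * c + 0 \<or> k = 3 * c + 1 \<or> k = 3 * c + 2" unfolding c_def by presburger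
      then show ?thesis using nx cols[of c] selx(1) nh by metis
    qed
    have "holds \<alpha> (2 * x) \<longleftrightarrow> \<not> holds \<alpha> (2 * x + 1)" for x by (simp add: holds_def)
    then have "solves (gadget_labels n m) (gadget_edges n m lit) sel col"
      unfolding solves_def gadget_selection_iff gadget_edges_iff
    proof (intro conjI allI impI)
      fix k assume k: "k < 3 * m"
      note facts = selx[of k] sell[OF lit[OF k]] coll[OF lit[OF k]] colt[of k]
      show "\<not> (sel (lit k) \<and> sel (?t k) \<and> (col (lit k) \<longleftrightarrow> col (?t k)))"
        "\<not> (sel (?t k) \<and> sel (?z k) \<and> (col (?t k) \<longleftrightarrow> col (?z k)))"
        "\<not> (sel (?z k) \<and> sel (lit k) \<and> (col (?z k) \<longleftrightarrow> col (lit k)))"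
        using facts by blast+
    qed (use tri selx sell in auto)
    then show ?A by blast
  qed
  then show ?thesis
    unfolding PCP_restricted_iff pcp_word_inj
    using gadget_proper_edges[of m lit n] lit gadget_small_classes by blast
qed

section \<open>The encoded instance as a computable sequence of numbers\<close>

definition pcp_entry :: "nat \<Rightarrow> (nat \<Rightarrow> nat) \<Rightarrow> (nat \<Rightarrow> nat) \<Rightarrow> (nat \<Rightarrow> nat) \<Rightarrow> nat \<Rightarrow> nat" where
  "pcp_entry n l a b j =
     (if j = 0 then n else if j = 1 then 2 else if j < 2 + n then l (j - 2)
      else if (j - 2 - n) mod 2 = 0 then a ((j - 2 - n) div 2) else b ((j - 2 - n) div 2))"

text \<open>The right-hand side has the shape produced by \<open>computable_unary_output\<close>: a
  number of codes and a function giving the \<open>j\<close>-th one.\<close>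

lemma pcp_word_entries:
  "pcp_word 2 (map l [0..<n]) (map (\<lambda>e. (a e, b e)) [0..<m]) =
   concat (map (\<lambda>j. unary (pcp_entry n l a b j)) [0..<2 + n + 2 * m])"
proof -
  let ?es = "map (\<lambda>e. (a e, b e)) [0..<m]"
  let ?ys = "concat (map (\<lambda>(u, v). [u, v]) ?es)"
  have "[n, 2] @ map l [0..<n] @ ?ys = map (pcp_entry n l a b) [0..<2 + n + 2 * m]"
  proof (rule nth_equalityI)
    show "length ([n, 2] @ map l [0..<n] @ ?ys) = length (map (pcp_entry n l a b) [0..<2 + n + 2 * m])"
      by (simp del: map_map)
    fix j assume "j < length ([n, 2] @ map l [0..<n] @ ?ys)"
    then have j: "j < 2 + n + 2 * m" by (simp del: map_map)
    consider "j = 0" | "j = 1" | "2 \<le> j" "j < 2 + n" | "2 + n \<le> j" by linarith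
    then show "([n, 2] @ map l [0..<n] @ ?ys) ! j = map (pcp_entry n l a b) [0..<2 + n + 2 * m] ! j"
    proof cases
      case 3
      then obtain i where "j = 2 + i" using le_Suc_ex by blast
      then show ?thesis using 3 by (simp add: nth_append pcp_entry_def del: upt_Suc)
    next
      case 4
      then obtain i where i: "j = 2 + n + i" using le_Suc_ex by blast
      have e: "i div 2 < m" using i j by auto
      have "i = 2 * (i div 2) \<or> i = Suc (2 * (i div 2))" by presburger
      then have "?ys ! i = (if i mod 2 = 0 then a (i div 2) else b (i div 2))"
        using concat_pairs_nth[of "i div 2" ?es] e
        by (auto simp del: map_map) (metis mod_Suc_eq_mod_add3 mod_mult_self1_is_0 n_not_Suc_n)+
      then show ?thesis using i j by (simp add: nth_append pcp_entry_def del: map_map upt_Suc)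
    qed (auto simp: pcp_entry_def simp del: upt_Suc)
  qed
  then show ?thesis unfolding pcp_word_def by (simp add: o_def del: upt_Suc)
qed

text \<open>Substitution for a stack variable is not a building rule of the class; a sum with at
  most one nonzero term performs it.\<close>

lemma computable_subst:
  assumes "computable U (\<lambda>w s. F w (s 0))" and "computable U K"
  shows "computable U (\<lambda>w s. F w (K w s))"
proof -
  have "computable U (\<lambda>w s. \<Sum>i<Suc (K w s). of_bool (i = K w s) * F w i)"
    by (intro computable_intros assms computable_rename[OF assms(2)])
  moreover have "(\<Sum>i<Suc k. of_bool (i = k) * f i) = f k" for k :: nat and f :: "nat \<Rightarrow> nat"
    by (simp add: sum.neutral)
  ultimately show ?thesis by simp
qed

theorem computable_triples_reducible:
  assumes n: "computable {0} (\<lambda>w s. n (w 0))" and m: "computable {0} (\<lambda>w s. m (w 0))"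
    and lit: "computable {0} (\<lambda>w s. lit (w 0) (s 0))"
    and bound: "\<And>x k. k < 3 * m x \<Longrightarrow> lit x k < 2 * n x"
    and A: "\<And>x. x \<in> A \<longleftrightarrow> triples_satisfiable (m x) (lit x)"
  shows "poly_reducible A (PCP_restricted 2 2)"
proof -
  let ?entry = "\<lambda>x. pcp_entry (2 * n x + 9 * m x) (gadget_label (n x))
     (edge_src (n x) (lit x)) (edge_tgt (n x) (lit x))"
  let ?f = "\<lambda>x. concat (map (\<lambda>j. unary (?entry x j)) [0..<2 + (2 * n x + 9 * m x) + 2 * (12 * m x)])"
  have lit': "computable {0} (\<lambda>w s. lit (w 0) (K w s))" if "computable {0} K" for K
    using computable_subst[of "{0}" "\<lambda>w. lit (w 0)", OF lit that] .
  have "computable {0} (\<lambda>w s. ?entry (w 0) (s 0))"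
    unfolding pcp_entry_def gadget_label_def edge_src_def edge_tgt_def
    by (intro computable_intros n m lit')
  moreover have "computable {0} (\<lambda>w s. 2 + (2 * n (w 0) + 9 * m (w 0)) + 2 * (12 * m (w 0)))"
    by (intro computable_intros n m)
  ultimately have "polytime_computable ?f"
    using computable_unary_output by fastforce
  moreover have "x \<in> A \<longleftrightarrow> ?f x \<in> PCP_restricted 2 2" for x
    using gadget_correct[of "m x" "lit x" "n x"] bound A[of x]
    unfolding gadget_labels_def gadget_edges_def pcp_word_entries by blast
  ultimately show ?thesis unfolding poly_reducible_def by blast
qed



section \<open>Computations as forbidden triples\<close>

text \<open>Mixed-radix decoding of an index; used repeatedly, it spreads one clause number over the
  coordinates of a box.\<close>

lemma all_div_mod:
  "(\<forall>v<a * b. P (v div b) (v mod b)) \<longleftrightarrow> (\<forall>i<a. \<forall>j<b. P i j)" for a b :: nat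
proof (cases "b = 0")
  case False
  show ?thesis
  proof
    assume L: "\<forall>v<a * b. P (v div b) (v mod b)"
    show "\<forall>i<a. \<forall>j<b. P i j"
    proof (intro allI impI)
      fix i j assume ij: "i < a" "j < b"
      have "i * b + j < Suc i * b" using ij by simp
      also have "\<dots> \<le> a * b" using ij by (intro mult_le_mono1) simp
      finally show "P i j" using L[rule_format, of "i * b + j"] ij by simp
    qed
  next
    assume R: "\<forall>i<a. \<forall>j<b. P i j"
    show "\<forall>v<a * b. P (v div b) (v mod b)"
      using R False by (simp add: less_mult_imp_div_less)
  qed
qed simp

lemma computable_table2:
  assumes "computable U A" and "computable U B"
  shows "computable U (\<lambda>w s. if B w s < k then (if A w s < n then f (A w s) (B w s) else 0) else 0)"
proof (induction k)
  case 0
  show ?case using computable.const[of U 0] by simp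
next
  case (Suc k)
  have "computable U (\<lambda>w s. if B w s = k then (if A w s < n then f (A w s) k else 0)
      else if B w s < k then (if A w s < n then f (A w s) (B w s) else 0) else 0)"
    by (intro computable_intros Suc computable_table[where f = "\<lambda>a. f a k"] assms)
  moreover have "(if b = k then (if a < n then f a k else 0) else if b < k then (if a < n then f a b else 0) else 0) =
      (if b < Suc k then (if a < n then f a b else 0) else 0)" for a b by auto
  ultimately show ?case by simp
qed

definition triple :: "nat \<Rightarrow> nat \<Rightarrow> nat \<Rightarrow> nat \<Rightarrow> nat" where
  "triple a b c j = (if j = 0 then a else if j = 1 then b else c)"

lemma triple_holds: "(\<exists>j<3. \<not> holds \<alpha> (triple a b c j)) \<longleftrightarrow> \<not> (holds \<alpha> a \<and> holds \<alpha> b \<and> holds \<alpha> c)"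
  by (auto simp: triple_def numeral_3_eq_3 less_Suc_eq)

lemma holds_simps [simp]: "holds \<alpha> (2 * v) \<longleftrightarrow> \<not> \<alpha> v" "holds \<alpha> (2 * v + 1) \<longleftrightarrow> \<alpha> v"
  by (simp_all add: holds_def)

lemma computable_triple [computable_intros]:
  "computable U A \<Longrightarrow> computable U B \<Longrightarrow> computable U C \<Longrightarrow> computable U J \<Longrightarrow>
   computable U (\<lambda>w s. triple (A w s) (B w s) (C w s) (J w s))"
  unfolding triple_def by (intro computable_intros)

section \<open>Configurations seen through views and relative cells\<close>

locale np_verifier =
  fixes M :: tm and p r :: "nat poly"
  assumes tm: "turing_machine M"
begin

abbreviation "K \<equiv> tapes M"
abbreviation "Q \<equiv> states M"
abbreviation "G \<equiv> symbols M"

lemma machine_bounds: "2 \<le> K" "3 \<le> G" "start M < Q" "accept M < Q" "0 < Q" "0 < G"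
  using tm by (auto simp: turing_machine_def)

definition valid :: "config \<Rightarrow> bool" where
  "valid c \<longleftrightarrow> state c < Q \<and> (\<forall>i<K. \<forall>j. tape c i j < G)"

text \<open>The state is the leading part, followed in base \<open>G\<close> by the symbols scanned
  on the first \<open>i\<close> tapes. The number grows by one tape at a time since a triple has
  room for just a view, one symbol and the extended view; the complete view determines the
  step.\<close>

primrec view :: "config \<Rightarrow> nat \<Rightarrow> nat" where
  "view c 0 = state c"
| "view c (Suc i) = view c i * G + tape c i (head c i)"

lemma view_bound: "valid c \<Longrightarrow> i \<le> K \<Longrightarrow> view c i < Q * G ^ i"
proof (induction i)
  case (Suc i)
  have "tape c i (head c i) < G" using Suc.prems by (simp add: valid_def)
  then have "view c i * G + tape c i (head c i) < Suc (view c i) * G" by simp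
  also have "\<dots> \<le> (Q * G ^ i) * G" using Suc by (intro mult_le_mono1) simp
  finally show ?case by (simp add: mult_ac)
qed (simp add: valid_def)

lemma view_inj:
  assumes "valid c" "valid c'" "i \<le> K" "view c i = view c' i"
  shows "state c = state c' \<and> (\<forall>j<i. tape c j (head c j) = tape c' j (head c' j))"
  using assms(3,4)
proof (induction i)
  case (Suc i)
  have "tape c i (head c i) < G" "tape c' i (head c' i) < G" using Suc.prems assms by (auto simp: valid_def)
  moreover have "view c i * G + tape c i (head c i) = view c' i * G + tape c' i (head c' i)"
    using Suc.prems by simp
  moreover have "a = a' \<and> b = b'" if "a * G + b = a' * G + b'" "b < G" "b' < G" for a b a' b'
    using arg_cong[OF that(1), of "\<lambda>n. n mod G"] arg_cong[OF that(1), of "\<lambda>n. n div G"] that(2,3) by simp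
  ultimately have "view c i = view c' i" "tape c i (head c i) = tape c' i (head c' i)" by blast+
  then show ?case using Suc by (auto simp: less_Suc_eq)
qed simp

lemma step_facts:
  assumes "valid c"
  shows "valid (step M c)"
    and "i < K \<Longrightarrow> head (step M c) i - head c i \<in> {-1, 0, 1}"
    and "i < K \<Longrightarrow> tape (step M c) i = (tape c i)(head c i := tape (step M c) i (head c i))"
proof -
  let ?ss = "map (\<lambda>i. tape c i (head c i)) [0..<K]"
  obtain q as where d: "delta M (state c) ?ss = (q, as)" by force
  have ss: "length ?ss = K \<and> set ?ss \<subseteq> {..<G}" using assms by (auto simp: valid_def)
  have q: "state c < Q" using assms by (simp add: valid_def)
  have "\<forall>q<Q. \<forall>ss. length ss = K \<and> set ss \<subseteq> {..<G} \<longrightarrow> fst (delta M q ss) < Q \<and>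
      length (snd (delta M q ss)) = K \<and> set (snd (delta M q ss)) \<subseteq> {..<G} \<times> {-1, 0, 1}"
    using tm unfolding turing_machine_def by (elim conjE)
  from this[rule_format, OF q ss]
  have *: "q < Q" "length as = K" "set as \<subseteq> {..<G} \<times> {-1, 0, 1}" unfolding d by auto
  have as: "as ! i \<in> {..<G} \<times> {-1, 0, 1}" if "i < K" for i
    using subsetD[OF *(3) nth_mem[of i as]] *(2) that by simp
  then have as': "fst (as ! i) < G" "snd (as ! i) \<in> {-1, 0, 1}" if "i < K" for i
    using that by (fastforce simp: mem_Times_iff)+
  show "valid (step M c)" using assms *(1) as' by (auto simp: step_def d valid_def)
  show "head (step M c) i - head c i \<in> {-1, 0, 1}" if "i < K"
    using as'(2)[OF that] that by (auto simp: step_def d)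
  show "tape (step M c) i = (tape c i)(head c i := tape (step M c) i (head c i))" if "i < K"
    using that by (auto simp: step_def d)
qed

lemma step_view_cong:
  assumes "valid c" "valid c'" "view c K = view c' K"
  shows "state (step M c) = state (step M c')"
    and "i < K \<Longrightarrow> head (step M c) i - head c i = head (step M c') i - head c' i"
    and "i < K \<Longrightarrow> tape (step M c) i (head c i) = tape (step M c') i (head c' i)"
proof -
  have eq: "state c = state c'" "\<And>j. j < K \<Longrightarrow> tape c j (head c j) = tape c' j (head c' j)"
    using view_inj[OF assms(1,2) le_refl assms(3)] by auto
  have ss: "map (\<lambda>i. tape c i (head c i)) [0..<K] = map (\<lambda>i. tape c' i (head c' i)) [0..<K]"
    using eq(2) by simp
  have h: "halted M c \<longleftrightarrow> halted M c'" by (simp add: halted_def eq(1))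
  obtain q as where d: "delta M (state c') (map (\<lambda>i. tape c' i (head c' i)) [0..<K]) = (q, as)" by force
  show "state (step M c) = state (step M c')" by (simp add: step_def ss h eq(1) d)
  show "head (step M c) i - head c i = head (step M c') i - head c' i" if "i < K"
    using that by (simp add: step_def ss h eq(1) d)
  show "tape (step M c) i (head c i) = tape (step M c') i (head c' i)" if "i < K"
    using that by (simp add: step_def ss h eq d)
qed

text \<open>A step depends on the configuration only through its view. The outer \<open>mod\<close> only serves to bound
  the values at numbers that are not views.\<close>

definition unview :: "nat \<Rightarrow> config" where
  "unview z = (SOME c. valid c \<and> view c K = z)"

definition next_state :: "nat \<Rightarrow> nat" where
  "next_state z = (if z < Q * G ^ K then state (step M (unview z)) mod Q else 0)"

text \<open>Movements are shifted by one to become 0, 1 and 2.\<close>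

definition next_move :: "nat \<Rightarrow> nat \<Rightarrow> nat" where
  "next_move z i = (if i < K then (if z < Q * G ^ K then
     nat (head (step M (unview z)) i - head (unview z) i + 1) mod 3 else 0) else 0)"

definition next_symbol :: "nat \<Rightarrow> nat \<Rightarrow> nat" where
  "next_symbol z i = (if i < K then (if z < Q * G ^ K then
     tape (step M (unview z)) i (head (unview z) i) mod G else 0) else 0)"

lemma next_of_view:
  assumes "valid c"
  shows "next_state (view c K) = state (step M c)"
    and "i < K \<Longrightarrow> int (next_move (view c K) i) = head (step M c) i - head c i + 1"
    and "i < K \<Longrightarrow> next_symbol (view c K) i = tape (step M c) i (head c i)"
proof -
  let ?z = "view c K"
  have u: "valid (unview ?z)" "view (unview ?z) K = ?z"
    unfolding unview_def using someI[of "\<lambda>c'. valid c' \<and> view c' K = ?z" c] assms by auto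
  note cong = step_view_cong[OF u(1) assms u(2)]
  have z: "?z < Q * G ^ K" using view_bound[OF assms] by simp
  have v: "valid (step M c)" using step_facts(1)[OF assms] .
  show "next_state ?z = state (step M c)" using v z cong(1) by (simp add: next_state_def valid_def)
  show "int (next_move ?z i) = head (step M c) i - head c i + 1" if "i < K"
    using step_facts(2)[OF assms that] cong(2)[OF that] that z by (auto simp: next_move_def)
  show "next_symbol ?z i = tape (step M c) i (head c i)" if "i < K"
    using v cong(3)[OF that] that z by (simp add: next_symbol_def valid_def)
qed

text \<open>Tapes are viewed relative to their heads, so that head positions need not be represented. A step
  then shifts the whole tape.\<close>

definition rel_cell :: "nat \<Rightarrow> config \<Rightarrow> nat \<Rightarrow> nat \<Rightarrow> nat" where
  "rel_cell T c i u = tape c i (head c i + int u - int T)"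

text \<open>The real movement is \<open>next_move\<close> minus 1; the index \<open>u + 1\<close> on
  the left absorbs the difference and keeps all indices natural. Index \<open>T\<close> is the
  scanned cell, the only one that is rewritten.\<close>

lemma rel_cell_step:
  assumes "valid c" and i: "i < K"
  shows "rel_cell T (step M c) i (u + 1) =
    (if u + next_move (view c K) i = T then next_symbol (view c K) i
     else rel_cell T c i (u + next_move (view c K) i))"
proof -
  let ?m = "next_move (view c K) i"
  have m: "int ?m = head (step M c) i - head c i + 1" by (rule next_of_view(2)[OF assms])
  have pos: "head (step M c) i + int (u + 1) - int T = head c i + int (u + ?m) - int T" using m by simp
  have eqT: "u + ?m = T \<longleftrightarrow> head c i + int (u + ?m) - int T = head c i" by linarith
  have "tape (step M c) i j = (if j = head c i then next_symbol (view c K) i else tape c i j)" for j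
    unfolding next_of_view(3)[OF assms] by (subst step_facts(3)[OF assms]) simp
  then show ?thesis unfolding rel_cell_def pos eqT by simp
qed

section \<open>The clause system of a computation\<close>

definition time :: "bool list \<Rightarrow> nat" where "time x = poly r (length x)"
definition cert_len :: "bool list \<Rightarrow> nat" where "cert_len x = poly p (length x)"

text \<open>The clause parameter \<open>y\<close> packs a view and one more symbol, hence the last
  factor of \<open>zdim\<close>. Column 0 is for views and columns 1 to
  \<open>2 * time x + 1\<close> are for cells; one further column is there because family 2 mentions
  \<open>u + next_move (y div G) i + 1\<close> for \<open>u < 2 * time x\<close>.\<close>

abbreviation "zdim \<equiv> Q * G ^ K * G"
abbreviation "udim x \<equiv> 2 * time x + 3"

text \<open>The variables form a box. The variable \<open>(t, i, 0, z)\<close> says that \<open>z\<close> is the view of the first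
  \<open>i\<close> tapes at time \<open>t\<close>, and \<open>(t, i, u + 1, a)\<close> that \<open>a\<close> is the symbol at position \<open>u - time x\<close>,
  relative to the head, of tape \<open>i\<close> at time \<open>t\<close>.\<close>

definition var_index :: "bool list \<Rightarrow> nat \<Rightarrow> nat \<Rightarrow> nat \<Rightarrow> nat \<Rightarrow> nat" where
  "var_index x t i u z = ((t * (K + 1) + i) * udim x + u) * zdim + z"

definition var_count :: "bool list \<Rightarrow> nat" where
  "var_count x = (time x + 1) * (K + 1) * udim x * zdim"

abbreviation "pos x t i u z \<equiv> 2 * var_index x t i u z + 1"
abbreviation "neg x t i u z \<equiv> 2 * var_index x t i u z"

text \<open>On tape 1 this is blank, which is correct wherever no certificate symbol can lie; the
  certificate range is left to families 5 and 6.\<close>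

definition input_symbol :: "bool list \<Rightarrow> nat \<Rightarrow> nat \<Rightarrow> nat" where
  "input_symbol x i u =
     (if i = 0 \<and> time x \<le> u \<and> u - time x < length x then 1 + of_bool (nth_bit x (u - time x)) else 0)"

text \<open>The families \<open>f\<close> of clauses express: 0, extension of the view by one more scanned symbol;
  1 and 2, the next state and the next tape contents; 3 and 4, the initial state and tapes; 5 and 6,
  an arbitrary word of length at most \<open>cert_len x\<close> on tape 1; 7, acceptance. Except for 5, all are
  Horn clauses that derive facts about the computation, so a satisfying assignment may make further
  variables true and no uniqueness constraints are needed.\<close>

definition clause :: "bool list \<Rightarrow> nat \<Rightarrow> nat \<Rightarrow> nat \<Rightarrow> nat \<Rightarrow> nat \<Rightarrow> nat \<Rightarrow> nat" where
  "clause x f t i u y =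
     (if f = 0 \<and> i < K then
        triple (pos x t i 0 (y div G)) (pos x t i (time x + 1) (y mod G)) (neg x t (i + 1) 0 y)
      else if f = 1 \<and> t < time x then
        triple (pos x t K 0 (y div G)) (pos x t K 0 (y div G)) (neg x (t + 1) 0 0 (next_state (y div G)))
      else if f = 2 \<and> t < time x \<and> i < K \<and> u < 2 * time x then
        triple (pos x t K 0 (y div G)) (pos x t i (u + next_move (y div G) i + 1) (y mod G))
          (neg x (t + 1) i (u + 2)
             (if u + next_move (y div G) i = time x then next_symbol (y div G) i else y mod G))
      else if f = 3 then
        triple (neg x 0 0 0 (start M)) (neg x 0 0 0 (start M)) (neg x 0 0 0 (start M))
      else if f = 4 \<and> i < K \<and> u < 2 * time x + 1 \<and> (i = 1 \<longrightarrow> u < time x \<or> time x + cert_len x \<le> u) then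
        triple (neg x 0 i (u + 1) (input_symbol x i u)) (neg x 0 i (u + 1) (input_symbol x i u))
          (neg x 0 i (u + 1) (input_symbol x i u))
      else if f = 5 \<and> time x \<le> u \<and> u < 2 * time x + 1 \<and> u < time x + cert_len x then
        triple (neg x 0 1 (u + 1) 0) (neg x 0 1 (u + 1) 1) (neg x 0 1 (u + 1) 2)
      else if f = 6 \<and> time x \<le> u \<and> u < 2 * time x then
        triple (pos x 0 1 (u + 1) 0) (pos x 0 1 (u + 1) 0) (neg x 0 1 (u + 2) 0)
      else if f = 7 \<and> y < Q \<and> y \<noteq> accept M then
        triple (pos x (time x) 0 0 y) (pos x (time x) 0 0 y) (pos x (time x) 0 0 y)
      else triple 1 0 0)"

text \<open>The parameters of the clauses range over the same box as the variables, so the same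
  mixed-radix decoding serves both; the extra factors 3 and 8 select the position in the triple and
  the family.\<close>

definition tableau_lit :: "bool list \<Rightarrow> nat \<Rightarrow> nat" where
  "tableau_lit x k =
     clause x (k div 3 mod 8) (k div 3 div 8 div zdim div udim x div (K + 1))
       (k div 3 div 8 div zdim div udim x mod (K + 1)) (k div 3 div 8 div zdim mod udim x)
       (k div 3 div 8 mod zdim) (k mod 3)"

text \<open>Stated for an abstract relation \<open>B\<close> in place of numbered variables, so that
  the meaning of the clauses can be argued without indices.\<close>

definition clause_true ::
  "bool list \<Rightarrow> (nat \<Rightarrow> nat \<Rightarrow> nat \<Rightarrow> nat \<Rightarrow> bool) \<Rightarrow> nat \<Rightarrow> nat \<Rightarrow> nat \<Rightarrow> nat \<Rightarrow> nat \<Rightarrow> bool" where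
  "clause_true x B f t i u y \<longleftrightarrow>
     (if f = 0 \<and> i < K then B t i 0 (y div G) \<and> B t i (time x + 1) (y mod G) \<longrightarrow> B t (i + 1) 0 y
      else if f = 1 \<and> t < time x then B t K 0 (y div G) \<longrightarrow> B (t + 1) 0 0 (next_state (y div G))
      else if f = 2 \<and> t < time x \<and> i < K \<and> u < 2 * time x then
        B t K 0 (y div G) \<and> B t i (u + next_move (y div G) i + 1) (y mod G) \<longrightarrow>
        B (t + 1) i (u + 2) (if u + next_move (y div G) i = time x then next_symbol (y div G) i else y mod G)
      else if f = 3 then B 0 0 0 (start M)
      else if f = 4 \<and> i < K \<and> u < 2 * time x + 1 \<and> (i = 1 \<longrightarrow> u < time x \<or> time x + cert_len x \<le> u) then
        B 0 i (u + 1) (input_symbol x i u)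
      else if f = 5 \<and> time x \<le> u \<and> u < 2 * time x + 1 \<and> u < time x + cert_len x then
        B 0 1 (u + 1) 0 \<or> B 0 1 (u + 1) 1 \<or> B 0 1 (u + 1) 2
      else if f = 6 \<and> time x \<le> u \<and> u < 2 * time x then B 0 1 (u + 1) 0 \<longrightarrow> B 0 1 (u + 2) 0
      else if f = 7 \<and> y < Q \<and> y \<noteq> accept M then \<not> B (time x) 0 0 y
      else True)"

text \<open>A triple is what must not hold jointly, so premises occur positively and conclusions
  negated; shorter clauses repeat a literal. The filler \<open>triple 1 0 0\<close> contains both
  literals of variable 0 and is never violated.\<close>

lemma clause_holds:
  "(\<exists>j<3. \<not> holds \<alpha> (clause x f t i u y j)) \<longleftrightarrow> clause_true x (\<lambda>t i u z. \<alpha> (var_index x t i u z)) f t i u y"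
proof -
  have *: "holds \<alpha> 0 \<longleftrightarrow> \<not> \<alpha> 0" "holds \<alpha> 1 \<longleftrightarrow> \<alpha> 0" by (simp_all add: holds_def)
  have **: "(\<exists>j<3. \<not> holds \<alpha> ((if P then g else h) j)) \<longleftrightarrow>
      (if P then \<exists>j<3. \<not> holds \<alpha> (g j) else \<exists>j<3. \<not> holds \<alpha> (h j))" for P g h by simp
  show ?thesis
    unfolding clause_def clause_true_def ** triple_holds holds_simps *
    by (intro if_cong[OF refl]; blast)
qed

definition in_box :: "bool list \<Rightarrow> nat \<Rightarrow> nat \<Rightarrow> nat \<Rightarrow> nat \<Rightarrow> bool" where
  "in_box x t i u z \<longleftrightarrow> t < time x + 1 \<and> i < K + 1 \<and> u < udim x \<and> z < zdim"

lemma tableau_satisfiable_iff: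
  "triples_satisfiable (var_count x * 8) (tableau_lit x) \<longleftrightarrow>
   (\<exists>\<alpha>. \<forall>f t i u y. f < 8 \<and> in_box x t i u y \<longrightarrow>
      clause_true x (\<lambda>t i u z. \<alpha> (var_index x t i u z)) f t i u y)"
proof -
  have "(\<forall>c<var_count x * 8. \<exists>j<3. \<not> holds \<alpha> (tableau_lit x (3 * c + j))) \<longleftrightarrow>
      (\<forall>t<time x + 1. \<forall>i<K + 1. \<forall>u<udim x. \<forall>y<zdim. \<forall>f<8. \<exists>j<3. \<not> holds \<alpha> (clause x f t i u y j))" for \<alpha>
  proof -
    have lit: "tableau_lit x (3 * c + j) =
      clause x (c mod 8) (c div 8 div zdim div udim x div (K + 1))
       (c div 8 div zdim div udim x mod (K + 1)) (c div 8 div zdim mod udim x) (c div 8 mod zdim) j"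
      if "j < 3" for c j
    proof -
      have "(3 * c + j) div 3 = c" "(3 * c + j) mod 3 = j" using that by simp_all
      then show ?thesis by (simp only: tableau_lit_def)
    qed
    let ?C = "\<lambda>f t i u y. \<exists>j<3. \<not> holds \<alpha> (clause x f t i u y j)"
    have "(\<forall>c<var_count x * 8. \<exists>j<3. \<not> holds \<alpha> (tableau_lit x (3 * c + j))) \<longleftrightarrow>
      (\<forall>c<var_count x * 8. ?C (c mod 8) (c div 8 div zdim div udim x div (K + 1))
         (c div 8 div zdim div udim x mod (K + 1)) (c div 8 div zdim mod udim x) (c div 8 mod zdim))"
      by (simp only: lit cong: conj_cong)
    also have "\<dots> \<longleftrightarrow> (\<forall>v<var_count x. \<forall>f<8. ?C f (v div zdim div udim x div (K + 1))
         (v div zdim div udim x mod (K + 1)) (v div zdim mod udim x) (v mod zdim))"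
      by (rule all_div_mod)
    also have "\<dots> \<longleftrightarrow> (\<forall>v<(time x + 1) * (K + 1) * udim x. \<forall>y<zdim. \<forall>f<8. ?C f (v div udim x div (K + 1))
         (v div udim x mod (K + 1)) (v mod udim x) y)"
      unfolding var_count_def by (rule all_div_mod)
    also have "\<dots> \<longleftrightarrow> (\<forall>v<(time x + 1) * (K + 1). \<forall>u<udim x. \<forall>y<zdim. \<forall>f<8. ?C f (v div (K + 1))
         (v mod (K + 1)) u y)"
      by (rule all_div_mod)
    also have "\<dots> \<longleftrightarrow> (\<forall>t<time x + 1. \<forall>i<K + 1. \<forall>u<udim x. \<forall>y<zdim. \<forall>f<8. ?C f t i u y)"
      by (rule all_div_mod)
    finally show ?thesis .
  qed
  then show ?thesis unfolding triples_satisfiable_def clause_holds in_box_def by (simp only:) meson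
qed

lemma zdim_bounds: "G \<le> zdim" "Q \<le> zdim" "2 < zdim" "Q * G ^ K \<le> zdim"
proof -
  have g: "1 \<le> G ^ K" using machine_bounds by simp
  then have q: "Q \<le> Q * G ^ K" "1 \<le> Q * G ^ K" using machine_bounds by auto
  then show "G \<le> zdim" "Q * G ^ K \<le> zdim" using machine_bounds by auto
  then show "Q \<le> zdim" "2 < zdim" using q machine_bounds by linarith+
qed

lemma next_bounds: "next_state z < Q" "next_move z i < 3" "next_symbol z i < G"
  using machine_bounds by (simp_all add: next_state_def next_move_def next_symbol_def)

lemma input_symbol_bound: "input_symbol x i u < G"
  using machine_bounds by (simp add: input_symbol_def)

lemma var_index_decode:
  assumes "in_box x t i u z"
  shows "var_index x t i u z mod zdim = z" "var_index x t i u z div zdim mod udim x = u"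
    "var_index x t i u z div zdim div udim x mod (K + 1) = i"
    "var_index x t i u z div zdim div udim x div (K + 1) = t"
    "var_index x t i u z < var_count x"
proof -
  have box: "z < zdim" "u < udim x" "i < K + 1" "t < time x + 1" using assms by (auto simp: in_box_def)
  have 1: "(a * d + b) mod d = b" "(a * d + b) div d = a" if "b < d" for a b d :: nat using that by auto
  have 2: "a * d + b < c * d" if "a < c" "b < d" for a b c d :: nat
  proof -
    have "a * d + b < Suc a * d" using that by simp
    also have "\<dots> \<le> c * d" using that by (intro mult_le_mono1) simp
    finally show ?thesis .
  qed
  show "var_index x t i u z mod zdim = z" "var_index x t i u z div zdim mod udim x = u"
    "var_index x t i u z div zdim div udim x mod (K + 1) = i"
    "var_index x t i u z div zdim div udim x div (K + 1) = t"
    unfolding var_index_def by (simp_all only: 1[OF box(1)] 1[OF box(2)] 1[OF box(3)])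
  show "var_index x t i u z < var_count x"
    unfolding var_index_def var_count_def by (intro 2 box)
qed

text \<open>Needed twice: the literals of clauses must be vertices of the constructed graph, and the
  intended assignment is decoded correctly only inside the box.\<close>

lemma in_box_clause:
  assumes "in_box x t i u y"
  shows "in_box x t i 0 (y div G)" "in_box x t i (time x + 1) (y mod G)"
    "i < K \<Longrightarrow> in_box x t (i + 1) 0 y" "in_box x t K 0 (y div G)"
    "t < time x \<Longrightarrow> in_box x (t + 1) 0 0 (next_state z)"
    "u < 2 * time x \<Longrightarrow> in_box x t i (u + next_move z i + 1) (y mod G)"
    "t < time x \<Longrightarrow> u < 2 * time x \<Longrightarrow>
       in_box x (t + 1) i (u + 2) (if b then next_symbol z i else y mod G)"
    "in_box x 0 0 0 (start M)"
    "u < 2 * time x + 1 \<Longrightarrow> in_box x 0 i (u + 1) (input_symbol x i u)"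
    "u < 2 * time x + 1 \<Longrightarrow> a < 3 \<Longrightarrow> in_box x 0 1 (u + 1) a"
    "u < 2 * time x \<Longrightarrow> in_box x 0 1 (u + 2) 0"
    "in_box x (time x) 0 0 y" "in_box x 0 0 0 0"
proof -
  have "y < zdim" using assms by (simp add: in_box_def)
  then have y: "y mod G < zdim" "y div G < zdim"
    using less_le_trans[OF mod_less_divisor zdim_bounds(1)] machine_bounds le_less_trans[OF div_le_dividend]
    by auto
  have bounds: "next_state z < zdim" "next_symbol z i < zdim" "start M < zdim" "input_symbol x i u < zdim"
    "next_move z i \<le> 2"
    using less_le_trans[OF next_bounds(1) zdim_bounds(2)] less_le_trans[OF next_bounds(3) zdim_bounds(1)]
      less_le_trans[OF machine_bounds(3) zdim_bounds(2)] less_le_trans[OF input_symbol_bound zdim_bounds(1)]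
      next_bounds(2)[of z i] by simp_all
  show "in_box x t i 0 (y div G)" "in_box x t i (time x + 1) (y mod G)"
    "i < K \<Longrightarrow> in_box x t (i + 1) 0 y" "in_box x t K 0 (y div G)"
    "t < time x \<Longrightarrow> in_box x (t + 1) 0 0 (next_state z)"
    "u < 2 * time x \<Longrightarrow> in_box x t i (u + next_move z i + 1) (y mod G)"
    "t < time x \<Longrightarrow> u < 2 * time x \<Longrightarrow>
       in_box x (t + 1) i (u + 2) (if b then next_symbol z i else y mod G)"
    "in_box x 0 0 0 (start M)"
    "u < 2 * time x + 1 \<Longrightarrow> in_box x 0 i (u + 1) (input_symbol x i u)"
    "u < 2 * time x + 1 \<Longrightarrow> a < 3 \<Longrightarrow> in_box x 0 1 (u + 1) a"
    "u < 2 * time x \<Longrightarrow> in_box x 0 1 (u + 2) 0"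
    "in_box x (time x) 0 0 y" "in_box x 0 0 0 0"
    using assms y bounds machine_bounds(1,5,6) zdim_bounds(3) by (auto simp: in_box_def)
qed

lemma clause_bound:
  assumes "in_box x t i u y"
  shows "clause x f t i u y j < 2 * var_count x"
proof -
  have lt: "2 * var_index x t i u z < 2 * var_count x" "2 * var_index x t i u z + 1 < 2 * var_count x"
    if "in_box x t i u z" for t i u z
    using var_index_decode(5)[OF that] by simp_all
  have small: "0 < 2 * var_count x" "1 < 2 * var_count x"
    using var_index_decode(5)[OF in_box_clause(13)[OF assms]] by auto
  have tri: "triple a b c j < n" if "a < n" "b < n" "c < n" for a b c n
    using that by (simp add: triple_def)
  have split: "(if P then g else h) j < n" if "P \<Longrightarrow> g j < n" "\<not> P \<Longrightarrow> h j < n"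
    for P and g h :: "nat \<Rightarrow> nat" and n using that by simp
  show ?thesis
    unfolding clause_def
    by (intro split tri small lt in_box_clause[OF assms]; (elim conjE)?; simp)
qed

lemma tableau_lit_bound: "k < 3 * (var_count x * 8) \<Longrightarrow> tableau_lit x k < 2 * var_count x"
proof -
  assume k: "k < 3 * (var_count x * 8)"
  let ?v = "k div 3 div 8"
  have "?v < var_count x" using k by (simp add: less_mult_imp_div_less mult.commute)
  then have "?v div zdim div udim x div (K + 1) < time x + 1"
    unfolding var_count_def by (simp only: less_mult_imp_div_less)
  moreover have "0 < zdim" using zdim_bounds by linarith
  ultimately have "in_box x (?v div zdim div udim x div (K + 1)) (?v div zdim div udim x mod (K + 1))
      (?v div zdim mod udim x) (?v mod zdim)"
    unfolding in_box_def by (intro conjI mod_less_divisor) auto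
  then show ?thesis unfolding tableau_lit_def by (rule clause_bound)
qed

section \<open>Computability of the clause system\<close>

lemma computable_time [computable_intros]: "k \<in> U \<Longrightarrow> computable U (\<lambda>w s. time (w k))"
  unfolding time_def by (intro computable_intros)

lemma computable_cert_len [computable_intros]: "k \<in> U \<Longrightarrow> computable U (\<lambda>w s. cert_len (w k))"
  unfolding cert_len_def by (intro computable_intros)

text \<open>The verifier is fixed, so its transition function is a finite table.\<close>

lemma computable_next [computable_intros]:
  "computable U A \<Longrightarrow> computable U (\<lambda>w s. next_state (A w s))"
  "computable U A \<Longrightarrow> computable U B \<Longrightarrow> computable U (\<lambda>w s. next_move (A w s) (B w s))"
  "computable U A \<Longrightarrow> computable U B \<Longrightarrow> computable U (\<lambda>w s. next_symbol (A w s) (B w s))"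
  unfolding next_state_def next_move_def next_symbol_def
  by (intro computable_table computable_table2; assumption)+

lemma computable_clause [computable_intros]:
  assumes "k \<in> U" "computable U F" "computable U T" "computable U I" "computable U A" "computable U Y" "computable U J"
  shows "computable U (\<lambda>w s. clause (w k) (F w s) (T w s) (I w s) (A w s) (Y w s) (J w s))"
  unfolding clause_def if_distribR var_index_def input_symbol_def by (intro computable_intros assms)

lemma computable_tableau: 
  "computable {0} (\<lambda>w s. var_count (w 0))" "computable {0} (\<lambda>w s. var_count (w 0) * 8)"
  "computable {0} (\<lambda>w s. tableau_lit (w 0) (s 0))"
  unfolding var_count_def tableau_lit_def by (intro computable_intros insertI1)+


section \<open>Faithfulness of the clauses to the computation\<close>

definition conf :: "bool list \<Rightarrow> bool list \<Rightarrow> nat \<Rightarrow> config" where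
  "conf x y t = run M t [x, y]"

lemma conf_0: "state (conf x y 0) = start M" "head (conf x y 0) i = 0"
  "tape (conf x y 0) i = word_tape (if i = 0 then x else if i = 1 then y else [])"
  by (auto simp: conf_def run_def initial_def less_2_cases_iff)

lemma conf_Suc: "conf x y (Suc t) = step M (conf x y t)"
  by (simp add: conf_def run_def)

lemma valid_conf: "valid (conf x y t)"
proof (induction t)
  case 0
  show ?case using machine_bounds by (auto simp: valid_def conf_0 word_tape_def)
next
  case (Suc t)
  then show ?case by (simp add: conf_Suc step_facts(1))
qed

lemma rel_cell_0:
  "rel_cell (time x) (conf x y 0) i u =
     (if i = 1 then word_tape y (int u - int (time x)) else input_symbol x i u)"
  by (auto simp: rel_cell_def conf_0 input_symbol_def word_tape_def nth_bit_def of_nat_diff nat_diff_distrib)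

lemma tableau_complete:
  assumes len: "length y \<le> cert_len x" and acc: "state (conf x y (time x)) = accept M"
  shows "triples_satisfiable (var_count x * 8) (tableau_lit x)"
proof -
  let ?T = "time x"
  \<comment> \<open>The intended model: exactly the true statements about the run with certificate
    \<open>y\<close>. Column 0 compares with views, the others with cells, shifted by one.\<close>
  define B where "B t i u z \<longleftrightarrow>
    (if u = 0 then z = view (conf x y t) i else z = rel_cell ?T (conf x y t) i (u - 1))" for t i u z
  define \<alpha> where "\<alpha> v = B (v div zdim div udim x div (K + 1)) (v div zdim div udim x mod (K + 1))
    (v div zdim mod udim x) (v mod zdim)" for v
  have \<alpha>: "\<alpha> (var_index x t i u z) \<longleftrightarrow> B t i u z" if "in_box x t i u z" for t i u z
    unfolding \<alpha>_def var_index_decode(1-4)[OF that] ..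
  have B0: "B t i 0 z \<longleftrightarrow> z = view (conf x y t) i" for t i z by (simp add: B_def)
  have BS: "B t i (u + 1) z \<longleftrightarrow> z = rel_cell ?T (conf x y t) i u" for t i u z by (simp add: B_def)
  have BSS: "B t i (u + 2) z \<longleftrightarrow> z = rel_cell ?T (conf x y t) i (u + 1)" for t i u z by (simp add: B_def)
  have true: "clause_true x B f t i u v" for f t i u v
  proof -
    let ?c = "conf x y t"
    have c0: "B t i 0 (v div G) \<and> B t i (?T + 1) (v mod G) \<longrightarrow> B t (i + 1) 0 v"
    proof
      assume "B t i 0 (v div G) \<and> B t i (?T + 1) (v mod G)"
      then have "v div G = view ?c i" "v mod G = tape ?c i (head ?c i)"
        unfolding B0 BS by (simp_all add: rel_cell_def)
      then have "v = view ?c i * G + tape ?c i (head ?c i)" by (metis div_mult_mod_eq)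
      then show "B t (i + 1) 0 v" by (simp add: B0)
    qed
    have c1: "B t K 0 z \<longrightarrow> B (t + 1) 0 0 (next_state z)" for z
      using next_of_view(1)[OF valid_conf[of x y t]] by (simp add: B0 conf_Suc)
    have c2: "B t K 0 z \<and> B t i (u + next_move z i + 1) a \<longrightarrow>
        B (t + 1) i (u + 2) (if u + next_move z i = ?T then next_symbol z i else a)" if "i < K" for z a
      using rel_cell_step[OF valid_conf[of x y t] that, of ?T u] unfolding B0 BS BSS by (simp add: conf_Suc)
    have c3: "B 0 0 0 (start M)" by (simp add: B0 conf_0)
    \<comment> \<open>On tape 1 the condition excludes the range of the certificate, and
      \<open>len\<close> makes the remaining cells blank.\<close>
    have c4: "B 0 i (u + 1) (input_symbol x i u)" if "i = 1 \<longrightarrow> u < ?T \<or> ?T + cert_len x \<le> u"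
      unfolding BS rel_cell_0 using that len by (auto simp: input_symbol_def word_tape_def)
    have c5: "B 0 1 (u + 1) 0 \<or> B 0 1 (u + 1) 1 \<or> B 0 1 (u + 1) 2"
      unfolding BS rel_cell_0 by (simp add: word_tape_def)
    have c6: "B 0 1 (u + 1) 0 \<longrightarrow> B 0 1 (u + 2) 0" if "?T \<le> u"
      unfolding BS BSS rel_cell_0 using that by (auto simp: word_tape_def split: if_splits)
    have c7: "\<not> B ?T 0 0 v" if "v \<noteq> accept M" using that acc by (simp add: B0)
    show ?thesis
      unfolding clause_true_def using c0 c1 c2 c3 c4 c5 c6 c7 by (simp split del: if_split) (auto split: if_split)
  qed
  have "clause_true x (\<lambda>t i u z. \<alpha> (var_index x t i u z)) f t i u v" if box: "in_box x t i u v" for f t i u v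
  proof -
    note box' = in_box_clause(1-9,11,12)[OF box]
    have cert: "in_box x 0 1 (u + 1) 0" "in_box x 0 1 (u + 1) 1" "in_box x 0 1 (u + 1) 2" if "u < 2 * ?T + 1"
      using in_box_clause(10)[OF box that] by simp_all
    have cert': "in_box x 0 1 (u + 1) 0" if "u < 2 * ?T" using cert(1) that by simp
    have "clause_true x (\<lambda>t i u z. \<alpha> (var_index x t i u z)) f t i u v \<longleftrightarrow> clause_true x B f t i u v"
      unfolding clause_true_def
      by (intro if_cong[OF refl]; (elim conjE)?; simp only: \<alpha> box' cert cert')
    then show ?thesis using true by simp
  qed
  then show ?thesis unfolding tableau_satisfiable_iff by blast
qed

text \<open>The certificate is read off from the model. By induction over time the model contains
  the state of the run and the cells near the heads, hence the final state, and family 7 leaves only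
  the accepting one.\<close>

lemma tableau_sound:
  assumes "triples_satisfiable (var_count x * 8) (tableau_lit x)"
  shows "\<exists>y. length y \<le> cert_len x \<and> state (conf x y (time x)) = accept M"
proof -
  let ?T = "time x" and ?P = "cert_len x"
  obtain B where B: "\<And>f t i u y. f < 8 \<Longrightarrow> in_box x t i u y \<Longrightarrow> clause_true x B f t i u y"
    using assms unfolding tableau_satisfiable_iff by blast
  have z0: "0 < zdim" by (rule less_trans[OF _ zdim_bounds(3)]) simp
  have y_split: "(z * G + a) div G = z" "(z * G + a) mod G = a" "z * G + a < zdim"
    if "z < Q * G ^ K" "a < G" for z a
  proof -
    have "z * G + a < Suc z * G" using that by simp
    also have "\<dots> \<le> zdim" using that by (intro mult_le_mono1) simp
    finally show "z * G + a < zdim" .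
  qed (use that in simp_all)
  have f0: "B t (i + 1) 0 (z * G + a)"
    if "t \<le> ?T" "i < K" "z < Q * G ^ K" "a < G" "B t i 0 z" "B t i (?T + 1) a" for t i z a
    using B[of 0 t i 0 "z * G + a"] that y_split[OF that(3,4)] by (simp add: clause_true_def in_box_def)
  \<comment> \<open>Family 1 looks only at \<open>y div G\<close>; the symbol part of
    \<open>y\<close> is filled with 0.\<close>
  have f1: "B (t + 1) 0 0 (next_state z)" if "t < ?T" "z < Q * G ^ K" "B t K 0 z" for t z
    using B[of 1 t 0 0 "z * G + 0"] that y_split[OF that(2), of 0] machine_bounds
    by (simp add: clause_true_def in_box_def)
  have f2: "B (t + 1) i (u + 2) (if u + next_move z i = ?T then next_symbol z i else a)"
    if "t < ?T" "i < K" "u < 2 * ?T" "z < Q * G ^ K" "a < G" "B t K 0 z" "B t i (u + next_move z i + 1) a"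
    for t i u z a
    using B[of 2 t i u "z * G + a"] that y_split[OF that(4,5)]
    by (simp add: clause_true_def in_box_def cong: if_cong)
  have f3: "B 0 0 0 (start M)"
    using B[of 3 0 0 0 0] z0 by (simp add: clause_true_def in_box_def)
  have f4: "B 0 i (u + 1) (input_symbol x i u)"
    if "i < K" "u < 2 * ?T + 1" "i = 1 \<longrightarrow> u < ?T \<or> ?T + ?P \<le> u" for i u
    using B[of 4 0 i u 0] z0 that by (simp add: clause_true_def in_box_def)
  have f5: "B 0 1 (u + 1) 0 \<or> B 0 1 (u + 1) 1 \<or> B 0 1 (u + 1) 2"
    if "?T \<le> u" "u < 2 * ?T + 1" "u < ?T + ?P" for u
    using B[of 5 0 0 u 0] z0 that by (simp add: clause_true_def in_box_def)
  have f6: "B 0 1 (u + 2) 0" if "?T \<le> u" "u < 2 * ?T" "B 0 1 (u + 1) 0" for u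
    using B[of 6 0 0 u 0] z0 that by (simp add: clause_true_def in_box_def)
  have f7: "q = accept M" if "q < Q" "B ?T 0 0 q" for q
    using B[of 7 0 0 0 q] zdim_bounds(2) that by (auto simp: clause_true_def in_box_def split: if_splits)

  \<comment> \<open>The certificate ends at the first cell where the model admits a blank, and at
    \<open>?P\<close> at the latest, where family 4 supplies one within the recorded range.\<close>
  define l where "l = (LEAST j. j = ?P \<or> B 0 1 (?T + j + 1) 0)"
  have l: "l = ?P \<or> B 0 1 (?T + l + 1) 0"
    unfolding l_def by (rule LeastI[of _ ?P]) simp
  have l_le: "l \<le> ?P" unfolding l_def by (rule Least_le) simp
  have l_less: "\<not> B 0 1 (?T + j + 1) 0" if "j < l" for j
    using not_less_Least[of j "\<lambda>j. j = ?P \<or> B 0 1 (?T + j + 1) 0"] that unfolding l_def by blast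
  \<comment> \<open>If the model admits both bits at a cell, \<open>True\<close> wins. Cells farther
    than \<open>?T\<close> from the start are unconstrained, but no head gets beyond that distance
    in time.\<close>
  define y where "y = map (\<lambda>j. B 0 1 (?T + j + 1) 2) [0..<l]"
  have blank: "B 0 1 (?T + j + 1) 0" if "l \<le> j" "j \<le> ?T" for j
    using that
  proof (induction j rule: dec_induct)
    case base
    show ?case
    proof (cases "l = ?P")
      case True
      then show ?thesis using f4[of 1 "?T + l"] machine_bounds base by (simp add: input_symbol_def)
    qed (use l in auto)
  next
    case (step j)
    then show ?case using f6[of "?T + j"] by (simp add: add_ac)
  qed
  have cert: "B 0 1 (u + 1) (word_tape y (int u - int ?T))" if u: "u < 2 * ?T + 1" for u
  proof (cases "u < ?T")
    case True
    then show ?thesis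
      using f4[of 1 u] machine_bounds u by (simp add: word_tape_def input_symbol_def)
  next
    case False
    then obtain j where j: "u = ?T + j" using le_Suc_ex not_less by blast
    show ?thesis
    proof (cases "j < l")
      case True
      then have "B 0 1 (?T + j + 1) 1 \<or> B 0 1 (?T + j + 1) 2"
        using f5[of "?T + j"] l_less[OF True] l_le j u by auto
      then show ?thesis using True j by (auto simp: word_tape_def y_def)
    next
      case False
      then show ?thesis using blank[of j] j u by (simp add: word_tape_def y_def)
    qed
  qed
  \<comment> \<open>A head movement shifts the window, so it loses one cell at either end per step.
    At time \<open>t\<close> it extends \<open>?T - t\<close> cells from the head and thus contains
    the scanned cell up to the end.\<close>
  have inv: "B t 0 0 (state (conf x y t)) \<and>
      (\<forall>i<K. \<forall>u. t \<le> u \<and> u + t \<le> 2 * ?T \<longrightarrow> B t i (u + 1) (rel_cell ?T (conf x y t) i u))" if "t \<le> ?T" for t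
    using that
  proof (induction t)
    case 0
    have "B 0 i (u + 1) (rel_cell ?T (conf x y 0) i u)" if "i < K" "u \<le> 2 * ?T" for i u
      unfolding rel_cell_0 using cert[of u] f4[of i u] that by (cases "i = 1") auto
    then show ?case using f3 by (simp add: conf_0)
  next
    case (Suc t)
    let ?c = "conf x y t"
    have v: "valid ?c" by (rule valid_conf)
    have cell: "B t i (u + 1) (rel_cell ?T ?c i u)" if "i < K" "t \<le> u" "u + t \<le> 2 * ?T" for i u
      using Suc that by auto
    have sym: "rel_cell ?T ?c i u < G" if "i < K" for i u using v that by (simp add: rel_cell_def valid_def)
    have vb: "view ?c i < Q * G ^ K" if "i \<le> K" for i
    proof -
      have "G ^ i \<le> G ^ K" using that machine_bounds by (intro power_increasing) auto
      then show ?thesis using view_bound[OF v that] by (meson less_le_trans mult_le_mono2)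
    qed
    have views: "B t i 0 (view ?c i)" if "i \<le> K" for i
      using that
    proof (induction i)
      case 0
      show ?case using Suc by simp
    next
      case (Suc i)
      have "B t i (?T + 1) (rel_cell ?T ?c i ?T)"
        using cell[of i ?T] Suc.prems \<open>Suc t \<le> ?T\<close> by simp
      then have "B t (i + 1) 0 (view ?c i * G + rel_cell ?T ?c i ?T)"
        using Suc \<open>Suc t \<le> ?T\<close> vb[of i] sym[of i] by (intro f0) auto
      then show ?case by (simp add: rel_cell_def)
    qed
    let ?z = "view ?c K"
    have "B (t + 1) 0 0 (next_state ?z)" using Suc.prems views vb by (intro f1) auto
    moreover have "B (t + 1) i (u + 1) (rel_cell ?T (step M ?c) i u)"
      if i: "i < K" and u: "Suc t \<le> u" "u + Suc t \<le> 2 * ?T" for i u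
    proof -
      \<comment> \<open>\<open>rel_cell_step\<close> speaks of cell \<open>w + 1\<close> after the
        step; the lower end \<open>Suc t\<close> of the window guarantees the predecessor.\<close>
      obtain w where w: "u = w + 1" using u(1) by (cases u) auto
      have m: "next_move ?z i < 3" by (rule next_bounds)
      have "B (t + 1) i (w + 2)
          (if w + next_move ?z i = ?T then next_symbol ?z i else rel_cell ?T ?c i (w + next_move ?z i))"
        using Suc.prems views vb sym i u w m by (intro f2 cell) auto
      then show ?thesis unfolding w rel_cell_step[OF v i] by simp
    qed
    ultimately show ?case using next_of_view(1)[OF v] by (simp add: conf_Suc)
  qed
  have "state (conf x y ?T) = accept M"
    using f7 inv[of ?T] valid_conf[of x y ?T] by (simp add: valid_def)
  moreover have "length y \<le> ?P" using l_le by (simp add: y_def)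
  ultimately show ?thesis by blast
qed

theorem np_verifier_reducible:
  assumes "\<And>x. x \<in> A \<longleftrightarrow>
    (\<exists>c. length c \<le> poly p (length x) \<and> state (run M (poly r (length x)) [x, c]) = accept M)"
  shows "poly_reducible A (PCP_restricted 2 2)"
proof (rule computable_triples_reducible[OF computable_tableau tableau_lit_bound])
  fix x
  show "x \<in> A \<longleftrightarrow> triples_satisfiable (var_count x * 8) (tableau_lit x)"
    using assms[of x] tableau_complete[of _ x] tableau_sound[of x]
    unfolding conf_def time_def cert_len_def by blast
qed

end

theorem theorem4: "NP_complete (PCP_restricted 2 2)"
  unfolding NP_complete_def NP_hard_def
proof (intro conjI ballI PCP_restricted_NP)
  fix A :: "bool list set"
  assume "A \<in> NP"
  then obtain M p r where "turing_machine M" and A: "\<And>x. x \<in> A \<longleftrightarrow>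
      (\<exists>c. length c \<le> poly p (length x) \<and> state (run M (poly r (length x)) [x, c]) = accept M)"
    unfolding NP_def by blast
  then interpret np_verifier M p r by unfold_locales
  show "poly_reducible A (PCP_restricted 2 2)" using A by (rule np_verifier_reducible)
qed


end
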